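(* Let $d\in\mathbb Z_{\ge0}$. The deformed quantum affine algebra $\mathcal U_d=\mathcal U_v(\widehat{\mathfrak{sl}_2})_{0,d}$ is isomorphic to the quotient of the free algebra $$\mathcal F=\mathbb C(v)\langle E_0,\,F_d,\,S^{\pm1},\,C^{\pm1/2},\,H_{\pm1},\,\{\Phi_l: 2\le l\le d-2\}\rangle$$ (with $S^{\pm1}$ and $C^{\pm1/2}$ mutually inverse pairs) by the following relations, in which $K,E_n,F_n,\Psi_n,\Phi_n,H_n$ denote the elements of $\mathcal F$ defined in the context: - $C^{1/2}$ is central; - $[S,H_{\pm1}]=[S,\Phi_n]=0$ for $2\le n\le d-2$; - $SE_0S^{-1}=vE_0$ and $SF_dS^{-1}=v^{-1}F_d$; - $[H_n,H_m]=[H_{-m},H_{-n}]=0$ for $1\le m,n\le\max\{2,2d-2\}$; - $E_1E_0=v^2E_0E_1$ and $F_dF_{d-1}=v^{-2}F_{d-1}F_d$; - $[E_k,F_l]=\dfrac{C^{(k-l)/2}\Psi_{k+l}-C^{(l-k)/2}\Phi_{k+l}}{v-v^{-1}}$ for $0\le|k|,|l|\le\max\{2,2d-1\}$; - $[H_1,H_{-1}]=[2]\dfrac{C-C^{-1}}{v-v^{-1}}$; - $[H_{\pm l},E_{\mp1}]=\dfrac{[2l]}{l}C^{-l/2}E_{\pm l\mp1}$ for $1\le l\le\max\{2,2d-2\}$; - $[H_{\pm l},F_{d\mp1}]=-\dfrac{[2l]}{l}C^{l/2}F_{d\pm l\mp1}$ for $1\le l\le\max\{2,2d-2\}$.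
   Context: $v$ is an indeterminate, $[n]=\frac{v^n-v^{-n}}{v-v^{-1}}$, $[x,y]=xy-yx$. **The algebra $\mathcal U_d$.** It is the $\mathbb C(v)$-algebra generated by $E_l,F_l$ ($l\in\mathbb Z$), $H_n$ ($n\in\mathbb Z\setminus\{0\}$), $S^{\pm1},K^{\pm1},C^{\pm1/2}$ with relations: $C^{1/2}$ is central; $S^2=KC^{1/2}$; $SE_kS^{-1}=vE_k$; $SF_kS^{-1}=v^{-1}F_k$; $SH_nS^{-1}=H_n$; $E_{k+1}E_l-v^2E_lE_{k+1}=v^2E_kE_{l+1}-E_{l+1}E_k$; $F_{k+1}F_l-v^{-2}F_lF_{k+1}=v^{-2}F_kF_{l+1}-F_{l+1}F_k$; $[E_k,F_l]=\frac{C^{(k-l)/2}\Psi_{k+l}-C^{(l-k)/2}\Phi_{k+l}}{v-v^{-1}}$; $[H_l,E_k]=\frac{[2l]}{l}C^{-|l|/2}E_{k+l}$; $[H_l,F_k]=-\frac{[2l]}{l}C^{|l|/2}F_{k+l}$; $[H_l,H_k]=\delta_{l,-k}\frac{[2l]}{l}\frac{C^l-C^{-l}}{v-v^{-1}}$; where $\sum_{k\ge0}\Psi_ku^k=K\exp\big((v-v^{-1})\sum_{k\ge1}H_ku^k\big)$, $\sum_{k\ge0}\Phi_{-k+d}u^k=K^{-1}\exp\big(-(v-v^{-1})\sum_{k\ge1}H_{-k}u^k\big)$, $\Psi_k=0$ for $k<0$, $\Phi_k=0$ for $k>d$. **Elements of $\mathcal F$.** In $\mathcal F$ define: - $K:=S^2C^{-1/2}$,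 $\Psi_0:=K$, $\Phi_d:=K^{-1}$, $\Psi_1:=(v-v^{-1})KH_1$, $\Phi_{d-1}:=-(v-v^{-1})K^{-1}H_{-1}$; - $E_{n+1}:=\frac1{[2]}C^{1/2}[H_1,E_n]$ for $n\ge0$; $F_{m+1}:=-\frac1{[2]}C^{-1/2}[H_1,F_m]$ for $m\ge d$; - $E_{n-1}:=\frac1{[2]}C^{1/2}[H_{-1},E_n]$ for $n\le0$; $F_{m-1}:=-\frac1{[2]}C^{-1/2}[H_{-1},F_m]$ for $m\le d$; - $\Psi_n:=0$ for $n<0$, $\Phi_n:=0$ for $n>d$; - $\Psi_n$ for $n>1$ and $\Phi_n$ for $n<\min\{2,d-1\}$ are defined by requiring $[E_0,F_n]=\frac{C^{-n/2}\Psi_n-C^{n/2}\Phi_n}{v-v^{-1}}$ (for each such $n$ the other of $\Psi_n,\Phi_n$ is already given as a generator or by the preceding items); - $H_n$ for $|n|\ge2$ are defined by the generating series $\sum_{k\ge0}\Psi_ku^k=K\exp\big((v-v^{-1})\sum_{k\ge1}H_ku^k\big)$ and $\sum_{k\ge0}\Phi_{-k+d}u^k=K^{-1}\exp\big(-(v-v^{-1})\sum_{k\ge1}H_{-k}u^k\big)$. *)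

theory Defs
  imports
    "HOL-Library.Poly_Mapping"
    "HOL-Computational_Algebra.Polynomial"
    "HOL-Computational_Algebra.Formal_Power_Series"
    "HOL-Computational_Algebra.Fraction_Field"
    "HOL-Algebra.QuotRing"
    "HOL-Algebra.Module"
begin

section \<open>The field \<open>\<complex>(v)\<close> and quantum integers\<close>

type_synonym Cv = "complex poly fract"

definition qv :: Cv where
  "qv = Fract [:0, 1:] 1"

definition qdiff :: Cv where
  "qdiff = qv - inverse qv"

definition qint :: "int \<Rightarrow> Cv" where
  "qint n = (qv powi n - qv powi (- n)) / qdiff"

section \<open>Free associative unital algebras\<close>

text \<open>
  The free algebra is the monoid algebra of the free monoid of words. Words are
  wrapped in their own type because the monoid algebra needs an additively written monoid.
\<close>

datatype 'g word = Word (letters: "'g list")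

instantiation word :: (type) monoid_add
begin

definition zero_word :: "'a word" where
  "zero_word = Word []"

definition plus_word :: "'a word \<Rightarrow> 'a word \<Rightarrow> 'a word" where
  "plus_word x y = Word (letters x @ letters y)"

instance
  by standard (simp_all add: zero_word_def plus_word_def)

end

type_synonym 'g free = "'g word \<Rightarrow>\<^sub>0 Cv"

definition gen :: "'g \<Rightarrow> 'g free" where
  "gen g = Poly_Mapping.single (Word [g]) 1"

definition scal :: "Cv \<Rightarrow> 'g free" where
  "scal c = Poly_Mapping.single 0 c"

definition comm :: "'a::ring_1 \<Rightarrow> 'a \<Rightarrow> 'a" where
  "comm x y = x * y - y * x"

text \<open>The free algebra on a set \<open>X\<close> of letters; the letter type may contain unused letters.\<close>

definition free_algebra :: "'g set \<Rightarrow> (Cv, 'g free) module" where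
  "free_algebra X =
    \<lparr>carrier = {p. \<forall>w \<in> Poly_Mapping.keys p. set (letters w) \<subseteq> X},
     mult = (*), one = 1, zero = 0, add = (+), smult = (\<lambda>c p. scal c * p)\<rparr>"

text \<open>
  A relation \<open>(a, b)\<close> stands for \<open>a = b\<close>. The ideal generated by the relations is
  two-sided. The library quotient is a plain ring; its scalar multiplication is the
  induced one, \<open>c \<odot> (I + a) = (I + c) (I + a) = I + c a\<close>.
\<close>

definition rel_ideal :: "'g set \<Rightarrow> ('g free \<times> 'g free) set \<Rightarrow> 'g free set" where
  "rel_ideal X R = Idl\<^bsub>free_algebra X\<^esub> {a - b | a b. (a, b) \<in> R}"

definition presented_algebra ::
  "'g set \<Rightarrow> ('g free \<times> 'g free) set \<Rightarrow> (Cv, 'g free set) module" where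
  "presented_algebra X R =
    (let A = free_algebra X; I = rel_ideal X R; Q = A Quot I in
     \<lparr>carrier = carrier Q, mult = mult Q, one = one Q, zero = zero Q, add = add Q,
      smult = (\<lambda>c x. (I +>\<^bsub>A\<^esub> scal c) \<otimes>\<^bsub>Q\<^esub> x)\<rparr>)"

text \<open>Isomorphisms of (not necessarily commutative) unital algebras.\<close>

definition algebra_iso ::
  "('k, 'a, 'm) module_scheme \<Rightarrow> ('k, 'b, 'n) module_scheme \<Rightarrow> ('a \<Rightarrow> 'b) set" where
  "algebra_iso A B =
    {h \<in> ring_iso A B. \<forall>c. \<forall>x \<in> carrier A. h (c \<odot>\<^bsub>A\<^esub> x) = c \<odot>\<^bsub>B\<^esub> h x}"

definition algebras_isomorphic ::
  "('k, 'a, 'm) module_scheme \<Rightarrow> ('k, 'b, 'n) module_scheme \<Rightarrow> bool" where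
  "algebras_isomorphic A B \<longleftrightarrow> algebra_iso A B \<noteq> {}"

section \<open>Exponentials of power series over a free algebra\<close>

text \<open>
  The coefficients do not commute. For \<open>A\<close> without constant term only the powers
  \<open>A ^ i\<close> with \<open>i \<le> n\<close> contribute to the coefficient of \<open>u\<^sup>n\<close> in \<open>\<Sum>i. A ^ i / i!\<close>.
\<close>

definition series_exp :: "'g free fps \<Rightarrow> 'g free fps" where
  "series_exp A = Abs_fps (\<lambda>n. \<Sum>i\<le>n. scal (1 / of_nat (fact i)) * fps_nth (A ^ i) n)"

text \<open>
  The unique \<open>L\<close> without constant term such that \<open>series_exp L\<close> has the same
  coefficients as \<open>A\<close> in positive degrees. The coefficient of \<open>u\<^sup>k\<close> in the exponential
  of \<open>L\<close> is \<open>L\<^sub>k\<close> plus the same coefficient for the truncation of \<open>L\<close> below \<open>k\<close>,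
  which gives a recursion for \<open>L\<^sub>k\<close>.
\<close>

fun series_log_coeff :: "'g free fps \<Rightarrow> nat \<Rightarrow> 'g free" where
  "series_log_coeff A k =
    (if k = 0 then 0
     else fps_nth A k
        - fps_nth (series_exp (Abs_fps (\<lambda>j. if j < k then series_log_coeff A j else 0))) k)"

declare series_log_coeff.simps [simp del]

definition series_log :: "'g free fps \<Rightarrow> 'g free fps" where
  "series_log A = Abs_fps (series_log_coeff A)"

lemma fps_power_cong:
  fixes A B :: "'a::ring_1 fps"
  assumes "\<And>j. j \<le> n \<Longrightarrow> fps_nth A j = fps_nth B j"
  shows "m \<le> n \<Longrightarrow> fps_nth (A ^ i) m = fps_nth (B ^ i) m"
proof (induction i arbitrary: m)
  case (Suc i)
  then show ?case by (auto simp: fps_mult_nth assms intro!: sum.cong)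
qed auto

lemma fps_power_trunc:
  fixes A B :: "'a::ring_1 fps"
  assumes "\<And>j. j < n \<Longrightarrow> fps_nth A j = fps_nth B j" "fps_nth A 0 = 0" "fps_nth B 0 = 0" "i \<ge> 2" "n > 0"
  shows "fps_nth (A ^ i) n = fps_nth (B ^ i) n"
proof -
  obtain k where k: "i = Suc k" "k > 0" using assms(4) by (cases i) auto
  have c: "fps_nth (A ^ k) m = fps_nth (B ^ k) m" if "m < n" for m
    by (rule fps_power_cong[where n = m]) (use assms(1) that in auto)
  have z: "fps_nth (A ^ k) 0 = 0" "fps_nth (B ^ k) 0 = 0"
    using k assms(2,3) by (auto simp: fps_nth_power_0 power_0_left)
  have "fps_nth A j * fps_nth (A ^ k) (n - j) = fps_nth B j * fps_nth (B ^ k) (n - j)" if "j \<le> n" for j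
  proof -
    have "j = 0 \<or> j = n \<or> (0 < j \<and> j < n)" using that by auto
    then show ?thesis using assms c z by auto
  qed
  then show ?thesis by (simp add: k fps_mult_nth)
qed

lemma series_exp_log:
  "fps_nth (series_exp (series_log A)) k = (if k = 0 then 1 else fps_nth A k)"
proof (cases "k = 0")
  case True
  then show ?thesis by (simp add: series_exp_def scal_def)
next
  case False
  define B where "B = Abs_fps (\<lambda>j. if j < k then series_log_coeff A j else 0)"
  define L where "L = series_log A"
  have L0: "fps_nth L 0 = 0" by (simp add: L_def series_log_def series_log_coeff.simps)
  have B0: "fps_nth B 0 = 0" by (simp add: B_def series_log_coeff.simps)
  have s1: "scal 1 = (1 :: 'a free)" by (simp add: scal_def)
  have split: "{..k} = insert 0 (insert 1 {2..k})" using False by auto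
  have E: "fps_nth (series_exp D) k = fps_nth D k + (\<Sum>i=2..k. scal (1 / of_nat (fact i)) * fps_nth (D ^ i) k)"
    for D :: "'a free fps"
    unfolding series_exp_def fps_nth_Abs_fps split using False by (simp add: s1)
  have "fps_nth (L ^ i) k = fps_nth (B ^ i) k" if "i \<ge> 2" for i
    by (rule fps_power_trunc) (use L0 B0 that False in \<open>auto simp: B_def L_def series_log_def\<close>)
  then have "fps_nth (series_exp L) k = fps_nth L k + (fps_nth (series_exp B) k - fps_nth B k)"
    by (simp add: E)
  also have "fps_nth L k = fps_nth A k - fps_nth (series_exp B) k"
    unfolding L_def series_log_def fps_nth_Abs_fps B_def
    by (subst series_log_coeff.simps) (use False in simp)
  also have "fps_nth B k = 0" by (simp add: B_def)
  finally show ?thesis using False by (simp add: L_def)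
qed

section \<open>The algebra \<open>\<U>\<^sub>d\<close>\<close>

text \<open>\<open>UC\<close> is \<open>C\<^bsup>1/2\<^esup>\<close>; the letters ending in \<open>i\<close> are the inverses.\<close>

datatype U_letter = UE int | UF int | UH int | US | USi | UK | UKi | UC | UCi

definition U_letters :: "U_letter set" where
  "U_letters = UNIV - {UH 0}"

text \<open>\<open>UCpow n\<close> is \<open>C\<^bsup>n/2\<^esup>\<close>.\<close>

definition UCpow :: "int \<Rightarrow> U_letter free" where
  "UCpow n = (if 0 \<le> n then gen UC ^ nat n else gen UCi ^ nat (- n))"

text \<open>\<open>\<Psi>\<^sub>k\<close> is the coefficient of \<open>u\<^sup>k\<close>, and \<open>\<Phi>\<^sub>k\<close> that of \<open>u\<^bsup>d-k\<^esup>\<close>.\<close>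

definition UPsi :: "int \<Rightarrow> U_letter free" where
  "UPsi k = (if k < 0 then 0 else
     gen UK * fps_nth (series_exp
       (Abs_fps (\<lambda>j. if j = 0 then 0 else scal qdiff * gen (UH (int j))))) (nat k))"

definition UPhi :: "int \<Rightarrow> int \<Rightarrow> U_letter free" where
  "UPhi d k = (if k > d then 0 else
     gen UKi * fps_nth (series_exp
       (Abs_fps (\<lambda>j. if j = 0 then 0 else - (scal qdiff * gen (UH (- int j)))))) (nat (d - k)))"

inductive_set U_rels :: "int \<Rightarrow> (U_letter free \<times> U_letter free) set" for d :: int where
  S_inv1: "(gen US * gen USi, 1) \<in> U_rels d"
| S_inv2: "(gen USi * gen US, 1) \<in> U_rels d"
| K_inv1: "(gen UK * gen UKi, 1) \<in> U_rels d"
| K_inv2: "(gen UKi * gen UK, 1) \<in> U_rels d"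
| C_inv1: "(gen UC * gen UCi, 1) \<in> U_rels d"
| C_inv2: "(gen UCi * gen UC, 1) \<in> U_rels d"
| C_central: "g \<in> U_letters \<Longrightarrow> (gen UC * gen g, gen g * gen UC) \<in> U_rels d"
| S_square: "(gen US ^ 2, gen UK * gen UC) \<in> U_rels d"
| S_E: "(gen US * gen (UE k) * gen USi, scal qv * gen (UE k)) \<in> U_rels d"
| S_F: "(gen US * gen (UF k) * gen USi, scal (inverse qv) * gen (UF k)) \<in> U_rels d"
| S_H: "n \<noteq> 0 \<Longrightarrow> (gen US * gen (UH n) * gen USi, gen (UH n)) \<in> U_rels d"
| E_E: "(gen (UE (k + 1)) * gen (UE l) - scal (qv ^ 2) * gen (UE l) * gen (UE (k + 1)),
         scal (qv ^ 2) * gen (UE k) * gen (UE (l + 1)) - gen (UE (l + 1)) * gen (UE k))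
        \<in> U_rels d"
| F_F: "(gen (UF (k + 1)) * gen (UF l) - scal (qv powi (-2)) * gen (UF l) * gen (UF (k + 1)),
         scal (qv powi (-2)) * gen (UF k) * gen (UF (l + 1)) - gen (UF (l + 1)) * gen (UF k))
        \<in> U_rels d"
| E_F: "(comm (gen (UE k)) (gen (UF l)),
         scal (1 / qdiff) * (UCpow (k - l) * UPsi (k + l) - UCpow (l - k) * UPhi d (k + l)))
        \<in> U_rels d"
| H_E: "l \<noteq> 0 \<Longrightarrow>
        (comm (gen (UH l)) (gen (UE k)),
         scal (qint (2 * l) / of_int l) * UCpow (- \<bar>l\<bar>) * gen (UE (k + l))) \<in> U_rels d"
| H_F: "l \<noteq> 0 \<Longrightarrow>
        (comm (gen (UH l)) (gen (UF k)),
         - (scal (qint (2 * l) / of_int l) * UCpow \<bar>l\<bar> * gen (UF (k + l)))) \<in> U_rels d"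
| H_H: "l \<noteq> 0 \<Longrightarrow> k \<noteq> 0 \<Longrightarrow>
        (comm (gen (UH l)) (gen (UH k)),
         if l = - k
         then scal (qint (2 * l) / of_int l) * (scal (1 / qdiff) * (UCpow (2 * l) - UCpow (- 2 * l)))
         else 0) \<in> U_rels d"

definition U_algebra :: "int \<Rightarrow> (Cv, U_letter free set) module" where
  "U_algebra d = presented_algebra U_letters (U_rels d)"

section \<open>The finite presentation\<close>

text \<open>
  \<open>F_E\<close>, \<open>F_F\<close>, \<open>F_C\<close>, \<open>F_H\<close>, \<open>F_Hm\<close> are \<open>E\<^sub>0\<close>, \<open>F\<^sub>d\<close>, \<open>C\<^bsup>1/2\<^esup>\<close>, \<open>H\<^sub>1\<close>, \<open>H\<close> with index \<open>-1\<close>.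
  The inverse letters are kept as free letters; that they are inverses is
  imposed together with the other relations. Elements that are defined by solving an equation
  therefore satisfy this equation only modulo these inverse relations.
\<close>

datatype F_letter = F_E | F_F | F_S | F_Si | F_C | F_Ci | F_H | F_Hm | F_Phi int

definition F_letters :: "int \<Rightarrow> F_letter set" where
  "F_letters d = {F_E, F_F, F_S, F_Si, F_C, F_Ci, F_H, F_Hm} \<union> F_Phi ` {2..d - 2}"

definition el_Cpow :: "int \<Rightarrow> F_letter free" where
  "el_Cpow n = (if 0 \<le> n then gen F_C ^ nat n else gen F_Ci ^ nat (- n))"

definition el_K :: "F_letter free" where
  "el_K = gen F_S ^ 2 * gen F_Ci"

definition el_Ki :: "F_letter free" where
  "el_Ki = gen F_C * gen F_Si ^ 2"

definition el_E :: "int \<Rightarrow> F_letter free" where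
  "el_E n = (if 0 \<le> n
     then ((\<lambda>x. scal (1 / qint 2) * gen F_C * comm (gen F_H) x) ^^ nat n) (gen F_E)
     else ((\<lambda>x. scal (1 / qint 2) * gen F_C * comm (gen F_Hm) x) ^^ nat (- n)) (gen F_E))"

definition el_F :: "int \<Rightarrow> int \<Rightarrow> F_letter free" where
  "el_F d m = (if d \<le> m
     then ((\<lambda>x. - (scal (1 / qint 2) * gen F_Ci * comm (gen F_H) x)) ^^ nat (m - d)) (gen F_F)
     else ((\<lambda>x. - (scal (1 / qint 2) * gen F_Ci * comm (gen F_Hm) x)) ^^ nat (d - m)) (gen F_F))"

text \<open>\<open>\<Psi>\<^sub>n\<close> for \<open>n \<le> 1\<close> and \<open>\<Phi>\<^sub>n\<close> for \<open>n \<ge> min 2 (d - 1)\<close> are given directly.\<close>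

definition el_Psi_low :: "int \<Rightarrow> F_letter free" where
  "el_Psi_low n = (if n < 0 then 0 else if n = 0 then el_K else scal qdiff * el_K * gen F_H)"

definition el_Phi_high :: "int \<Rightarrow> int \<Rightarrow> F_letter free" where
  "el_Phi_high d n =
    (if n > d then 0
     else if n = d then el_Ki
     else if n = d - 1 then - (scal qdiff * el_Ki * gen F_Hm)
     else gen (F_Phi n))"

text \<open>
  The remaining \<open>\<Psi>\<^sub>n\<close> and \<open>\<Phi>\<^sub>n\<close> are obtained by solving
  \<open>[E\<^sub>0, F\<^sub>n] = (C\<^bsup>-n/2\<^esup> \<Psi>\<^sub>n - C\<^bsup>n/2\<^esup> \<Phi>\<^sub>n) / (v - v\<^bsup>-1\<^esup>)\<close> for the one that is not yet given.
\<close>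

definition el_Psi :: "int \<Rightarrow> int \<Rightarrow> F_letter free" where
  "el_Psi d n = (if n \<le> 1 then el_Psi_low n
     else el_Cpow n * (scal qdiff * comm (el_E 0) (el_F d n) + el_Cpow n * el_Phi_high d n))"

definition el_Phi :: "int \<Rightarrow> int \<Rightarrow> F_letter free" where
  "el_Phi d n = (if min 2 (d - 1) \<le> n then el_Phi_high d n
     else el_Cpow (- n) * (el_Cpow (- n) * el_Psi_low n - scal qdiff * comm (el_E 0) (el_F d n)))"

text \<open>
  For \<open>|n| \<ge> 2\<close>, \<open>H\<^sub>n\<close> is read off from \<open>K\<^bsup>-1\<^esup> \<Sum>\<^sub>k \<Psi>\<^sub>k u\<^sup>k = exp ((v - v\<^bsup>-1\<^esup>) \<Sum>\<^sub>k H\<^sub>k u\<^sup>k)\<close> and from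
  the corresponding series with \<open>\<Phi>\<close>. The value at \<open>n = 0\<close> is never used.
\<close>

definition el_H :: "int \<Rightarrow> int \<Rightarrow> F_letter free" where
  "el_H d n =
    (if n = 0 then 0
     else if n = 1 then gen F_H
     else if n = -1 then gen F_Hm
     else if n > 0 then
       scal (1 / qdiff) * fps_nth (series_log (Abs_fps (\<lambda>k. el_Ki * el_Psi d (int k)))) (nat n)
     else
       - (scal (1 / qdiff) * fps_nth (series_log (Abs_fps (\<lambda>k. el_K * el_Phi d (d - int k)))) (nat (- n))))"

inductive_set F_rels :: "int \<Rightarrow> (F_letter free \<times> F_letter free) set" for d :: int where
  S_inv1: "(gen F_S * gen F_Si, 1) \<in> F_rels d"
| S_inv2: "(gen F_Si * gen F_S, 1) \<in> F_rels d"
| C_inv1: "(gen F_C * gen F_Ci, 1) \<in> F_rels d"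
| C_inv2: "(gen F_Ci * gen F_C, 1) \<in> F_rels d"
| C_central: "g \<in> F_letters d \<Longrightarrow> (gen F_C * gen g, gen g * gen F_C) \<in> F_rels d"
| S_H_pos: "(comm (gen F_S) (el_H d 1), 0) \<in> F_rels d"
| S_H_neg: "(comm (gen F_S) (el_H d (-1)), 0) \<in> F_rels d"
| S_Phi: "2 \<le> n \<Longrightarrow> n \<le> d - 2 \<Longrightarrow> (comm (gen F_S) (el_Phi d n), 0) \<in> F_rels d"
| S_E: "(gen F_S * el_E 0 * gen F_Si, scal qv * el_E 0) \<in> F_rels d"
| S_F: "(gen F_S * el_F d d * gen F_Si, scal (inverse qv) * el_F d d) \<in> F_rels d"
| H_H_pos: "1 \<le> m \<Longrightarrow> m \<le> max 2 (2 * d - 2) \<Longrightarrow> 1 \<le> n \<Longrightarrow> n \<le> max 2 (2 * d - 2) \<Longrightarrow>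
    (comm (el_H d n) (el_H d m), 0) \<in> F_rels d"
| H_H_neg: "1 \<le> m \<Longrightarrow> m \<le> max 2 (2 * d - 2) \<Longrightarrow> 1 \<le> n \<Longrightarrow> n \<le> max 2 (2 * d - 2) \<Longrightarrow>
    (comm (el_H d (- m)) (el_H d (- n)), 0) \<in> F_rels d"
| E_E: "(el_E 1 * el_E 0, scal (qv ^ 2) * el_E 0 * el_E 1) \<in> F_rels d"
| F_F: "(el_F d d * el_F d (d - 1), scal (qv powi (-2)) * el_F d (d - 1) * el_F d d) \<in> F_rels d"
| E_F: "\<bar>k\<bar> \<le> max 2 (2 * d - 1) \<Longrightarrow> \<bar>l\<bar> \<le> max 2 (2 * d - 1) \<Longrightarrow>
    (comm (el_E k) (el_F d l),
     scal (1 / qdiff) * (el_Cpow (k - l) * el_Psi d (k + l) - el_Cpow (l - k) * el_Phi d (k + l))) \<in> F_rels d"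
| H1_Hm1: "(comm (el_H d 1) (el_H d (-1)),
     scal (qint 2) * (scal (1 / qdiff) * (el_Cpow 2 - el_Cpow (-2)))) \<in> F_rels d"
| H_E_pos: "1 \<le> l \<Longrightarrow> l \<le> max 2 (2 * d - 2) \<Longrightarrow>
    (comm (el_H d l) (el_E (-1)), scal (qint (2 * l) / of_int l) * el_Cpow (- l) * el_E (l - 1)) \<in> F_rels d"
| H_E_neg: "1 \<le> l \<Longrightarrow> l \<le> max 2 (2 * d - 2) \<Longrightarrow>
    (comm (el_H d (- l)) (el_E 1), scal (qint (2 * l) / of_int l) * el_Cpow (- l) * el_E (- l + 1)) \<in> F_rels d"
| H_F_pos: "1 \<le> l \<Longrightarrow> l \<le> max 2 (2 * d - 2) \<Longrightarrow>
    (comm (el_H d l) (el_F d (d - 1)),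
     - (scal (qint (2 * l) / of_int l) * el_Cpow l * el_F d (d + l - 1))) \<in> F_rels d"
| H_F_neg: "1 \<le> l \<Longrightarrow> l \<le> max 2 (2 * d - 2) \<Longrightarrow>
    (comm (el_H d (- l)) (el_F d (d + 1)),
     - (scal (qint (2 * l) / of_int l) * el_Cpow l * el_F d (d - l + 1))) \<in> F_rels d"

definition F_quotient :: "int \<Rightarrow> (Cv, F_letter free set) module" where
  "F_quotient d = presented_algebra (F_letters d) (F_rels d)"

section \<open>The relations lie in the free algebras\<close>

text \<open>
  Without this, \<open>rel_ideal\<close> would be an empty intersection and not an ideal.
\<close>

lemma word_plus_letters [simp]: "letters (x + y) = letters x @ letters y"
  by (simp add: plus_word_def)

lemma word_zero_letters [simp]: "letters 0 = []"
  by (simp add: zero_word_def)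

lemma carrier_free_algebra:
  "p \<in> carrier (free_algebra X) \<longleftrightarrow> (\<forall>w \<in> Poly_Mapping.keys p. set (letters w) \<subseteq> X)"
  by (simp add: free_algebra_def)

lemma scal_in: "scal c \<in> carrier (free_algebra X)"
  by (simp add: carrier_free_algebra scal_def)

lemma gen_in: "g \<in> X \<Longrightarrow> gen g \<in> carrier (free_algebra X)"
  by (simp add: carrier_free_algebra gen_def)

lemma zero_in: "0 \<in> carrier (free_algebra X)"
  by (simp add: carrier_free_algebra)

lemma one_in: "1 \<in> carrier (free_algebra X)"
  by (simp add: carrier_free_algebra)

lemma add_in:
  "a \<in> carrier (free_algebra X) \<Longrightarrow> b \<in> carrier (free_algebra X) \<Longrightarrow> a + b \<in> carrier (free_algebra X)"
  unfolding carrier_free_algebra using Poly_Mapping.keys_add[of a b] by blast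

lemma uminus_in: "a \<in> carrier (free_algebra X) \<Longrightarrow> - a \<in> carrier (free_algebra X)"
  by (simp add: carrier_free_algebra in_keys_iff)

lemma diff_in:
  "a \<in> carrier (free_algebra X) \<Longrightarrow> b \<in> carrier (free_algebra X) \<Longrightarrow> a - b \<in> carrier (free_algebra X)"
  using add_in[OF _ uminus_in, of a X b] by simp

lemma mult_in:
  assumes "a \<in> carrier (free_algebra X)" "b \<in> carrier (free_algebra X)"
  shows "a * b \<in> carrier (free_algebra X)"
  unfolding carrier_free_algebra
proof
  fix w assume "w \<in> Poly_Mapping.keys (a * b)"
  then obtain x y where "w = x + y" "x \<in> Poly_Mapping.keys a" "y \<in> Poly_Mapping.keys b"
    using keys_mult[of a b] by blast
  with assms show "set (letters w) \<subseteq> X"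
    by (auto simp: carrier_free_algebra)
qed

lemma power_in: "a \<in> carrier (free_algebra X) \<Longrightarrow> a ^ n \<in> carrier (free_algebra X)"
  by (induction n) (auto intro: one_in mult_in)

lemma sum_in:
  "(\<And>i. i \<in> I \<Longrightarrow> f i \<in> carrier (free_algebra X)) \<Longrightarrow> sum f I \<in> carrier (free_algebra X)"
  by (induction I rule: infinite_finite_induct) (auto intro: zero_in add_in)

lemma comm_in:
  "a \<in> carrier (free_algebra X) \<Longrightarrow> b \<in> carrier (free_algebra X) \<Longrightarrow> comm a b \<in> carrier (free_algebra X)"
  unfolding comm_def by (intro diff_in mult_in)

lemma fps_power_in:
  assumes "\<And>j. fps_nth A j \<in> carrier (free_algebra X)"
  shows "fps_nth (A ^ i) n \<in> carrier (free_algebra X)"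
proof (induction i arbitrary: n)
  case 0
  show ?case by (simp add: one_in zero_in)
next
  case (Suc i)
  show ?case by (auto simp: fps_mult_nth intro!: sum_in mult_in assms Suc)
qed

lemma series_exp_in:
  "(\<And>j. fps_nth A j \<in> carrier (free_algebra X)) \<Longrightarrow> fps_nth (series_exp A) n \<in> carrier (free_algebra X)"
  by (auto simp: series_exp_def intro!: sum_in mult_in scal_in fps_power_in)

lemma series_log_in:
  assumes "\<And>j. fps_nth A j \<in> carrier (free_algebra X)"
  shows "fps_nth (series_log A) n \<in> carrier (free_algebra X)"
proof (induction n rule: less_induct)
  case (less n)
  have *: "series_log_coeff A j \<in> carrier (free_algebra X)" if "j < n" for j
    using less[OF that] by (simp add: series_log_def)
  show ?case
    unfolding series_log_def fps_nth_Abs_fps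
    by (subst series_log_coeff.simps) (auto intro!: diff_in zero_in assms series_exp_in *)
qed

lemma free_algebra_sel:
  "x \<oplus>\<^bsub>free_algebra X\<^esub> y = x + y" "x \<otimes>\<^bsub>free_algebra X\<^esub> y = x * y"
  "\<zero>\<^bsub>free_algebra X\<^esub> = 0" "\<one>\<^bsub>free_algebra X\<^esub> = 1"
  by (simp_all add: free_algebra_def)

lemma ring_free_algebra: "ring (free_algebra X)"
proof (rule ringI, unfold free_algebra_sel)
  show "abelian_group (free_algebra X)"
    by (rule abelian_groupI, unfold free_algebra_sel)
      (blast intro: add_in zero_in uminus_in left_minus | simp add: ac_simps)+
  show "monoid (free_algebra X)"
    by (rule monoidI, unfold free_algebra_sel) (blast intro: mult_in one_in | simp add: mult.assoc)+
qed (simp_all add: distrib_left distrib_right)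

lemmas free_in = scal_in gen_in zero_in one_in add_in uminus_in diff_in mult_in power_in comm_in

lemma U_letters_in:
  "UE k \<in> U_letters" "UF k \<in> U_letters" "k \<noteq> 0 \<Longrightarrow> UH k \<in> U_letters"
  "US \<in> U_letters" "USi \<in> U_letters" "UK \<in> U_letters" "UKi \<in> U_letters"
  "UC \<in> U_letters" "UCi \<in> U_letters"
  by (auto simp: U_letters_def)

lemma UCpow_in: "UCpow n \<in> carrier (free_algebra U_letters)"
  by (auto simp: UCpow_def U_letters_def intro!: free_in)

lemma UPsi_in: "UPsi n \<in> carrier (free_algebra U_letters)"
  by (auto simp: UPsi_def U_letters_def intro!: free_in series_exp_in)

lemma UPhi_in: "UPhi d n \<in> carrier (free_algebra U_letters)"
  by (auto simp: UPhi_def U_letters_def intro!: free_in series_exp_in)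

lemma U_rels_in:
  "(a, b) \<in> U_rels d \<Longrightarrow> a \<in> carrier (free_algebra U_letters) \<and> b \<in> carrier (free_algebra U_letters)"
  by (erule U_rels.cases; clarify; (split if_split)?;
      intro conjI impI free_in UCpow_in UPsi_in UPhi_in U_letters_in; (assumption | simp)?)

lemma F_letters_in:
  "F_S \<in> F_letters d" "F_Si \<in> F_letters d" "F_C \<in> F_letters d" "F_Ci \<in> F_letters d"
  by (auto simp: F_letters_def)

lemma el_Cpow_in: "el_Cpow n \<in> carrier (free_algebra (F_letters d))"
  by (auto simp: el_Cpow_def F_letters_def intro!: free_in)

lemma el_K_in: "el_K \<in> carrier (free_algebra (F_letters d))"
  by (auto simp: el_K_def F_letters_def intro!: free_in)

lemma el_Ki_in: "el_Ki \<in> carrier (free_algebra (F_letters d))"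
  by (auto simp: el_Ki_def F_letters_def intro!: free_in)

lemma funpow_in:
  "(\<And>y. y \<in> S \<Longrightarrow> f y \<in> S) \<Longrightarrow> x \<in> S \<Longrightarrow> (f ^^ n) x \<in> S"
  by (induction n) auto

lemma el_E_in: "el_E n \<in> carrier (free_algebra (F_letters d))"
  by (auto simp: el_E_def F_letters_def intro!: funpow_in free_in)

lemma el_F_in: "el_F d n \<in> carrier (free_algebra (F_letters d))"
  by (auto simp: el_F_def F_letters_def intro!: funpow_in free_in)

lemma el_Psi_low_in: "el_Psi_low n \<in> carrier (free_algebra (F_letters d))"
  by (auto simp: el_Psi_low_def intro!: free_in el_K_in) (simp add: F_letters_def)

lemma el_Phi_high_in: "min 2 (d - 1) \<le> n \<Longrightarrow> el_Phi_high d n \<in> carrier (free_algebra (F_letters d))"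
  by (auto simp: el_Phi_high_def intro!: free_in el_Ki_in) (auto simp add: F_letters_def)

lemma el_Psi_in: "el_Psi d n \<in> carrier (free_algebra (F_letters d))"
  by (auto simp: el_Psi_def intro!: free_in el_Cpow_in el_E_in el_F_in el_Psi_low_in el_Phi_high_in)

lemma el_Phi_in: "el_Phi d n \<in> carrier (free_algebra (F_letters d))"
  by (auto simp: el_Phi_def intro!: free_in el_Cpow_in el_E_in el_F_in el_Psi_low_in el_Phi_high_in)

lemma el_H_in: "el_H d n \<in> carrier (free_algebra (F_letters d))"
  unfolding el_H_def
  by (auto intro!: free_in series_log_in el_K_in el_Ki_in el_Psi_in el_Phi_in)
     (auto simp: F_letters_def)

lemma F_rels_in:
  "(a, b) \<in> F_rels d \<Longrightarrow>
    a \<in> carrier (free_algebra (F_letters d)) \<and> b \<in> carrier (free_algebra (F_letters d))"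
  by (erule F_rels.cases; clarify;
      intro conjI free_in el_Cpow_in el_E_in el_F_in el_Psi_in el_Phi_in el_H_in F_letters_in; assumption?)

lemma ideal_U: "ideal (rel_ideal U_letters (U_rels d)) (free_algebra U_letters)"
  unfolding rel_ideal_def
  by (rule ring.genideal_ideal[OF ring_free_algebra]) (auto dest!: U_rels_in intro: diff_in)

lemma ideal_F: "ideal (rel_ideal (F_letters d) (F_rels d)) (free_algebra (F_letters d))"
  unfolding rel_ideal_def
  by (rule ring.genideal_ideal[OF ring_free_algebra]) (auto dest!: F_rels_in intro: diff_in)

end

theory Submission
  imports Defs
begin

text \<open>
  Both algebras are quotients of free algebras, so an isomorphism amounts to two homomorphisms,
  each given on letters, that are inverse to each other on letters. The elements of \<open>\<F>\<close> called
  \<open>E\<^sub>n, F\<^sub>n, \<Psi>\<^sub>n, \<Phi>\<^sub>n, H\<^sub>n\<close> are built so that they go to the elements of \<open>\<U>\<^sub>d\<close> with these names, and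
  the finite relations are then instances of relations of \<open>\<U>\<^sub>d\<close> (\<open>eta_relations\<close>). The substance is
  the converse (\<open>theta_relations\<close>): finitely many relations imply all of them.

  For this the generators are rescaled to \<open>e\<^sub>k = E\<^sub>k\<close>, \<open>f\<^sub>k = C\<^sup>k F\<^sub>k\<close>, \<open>h\<^sub>l = C\<^bsup>|l|/2\<^esup> H\<^sub>l\<close>, and \<open>\<Psi>\<^sub>s\<close>, \<open>\<Phi>\<^sub>s\<close> by
  \<open>C\<^bsup>s/2\<^esup>\<close>, \<open>C\<^bsup>-s/2\<^esup>\<close>. Then \<open>h\<^sub>l\<close> with \<open>l > 0\<close> shifts the indices of \<open>e\<close> and \<open>f\<close> without powers of \<open>C\<close>, and
  with \<open>X\<^sub>k\<^sub>l = (v - v\<^bsup>-1\<^esup>) [e\<^sub>k, f\<^sub>l]\<close> the main relation is \<open>X\<^sub>k\<^sub>l = \<psi>\<^bsub>k+l\<^esub> - g\<^sup>l \<phi>\<^bsub>k+l\<^esub>\<close> where \<open>g = C\<^sup>2\<close>. On the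
  diagonals \<open>k + l > d\<close>, where \<open>\<phi>\<close> vanishes, it says that \<open>X\<close> is constant. The locale
  \<open>current_seed\<close> collects what is needed of finitely many relations, and the argument in it is as follows.

  \<^item> As \<open>h\<^sub>1\<close> and \<open>h\<close> with index \<open>-1\<close> shift the indices and commute up to a central element, a relation that
    is known at one place spreads. This gives \<open>X\<^sub>k\<^sub>l\<close> on the middle diagonals (\<open>gap_middle\<close>), the action
    of the first few \<open>h\<^sub>l\<close> (\<open>h_e_f_upto_N\<close>) and, with the help of \<open>h\<^sub>2\<close>, the quadratic
    relations (\<open>quad_all\<close>).
  \<^item> Then the diagonals are treated one after the other (\<open>next_upto\<close>). If everything is known up to
    the diagonal \<open>m\<close>, then \<open>X\<close> is an arithmetic progression on the diagonal \<open>m + 1\<close>, and for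
    \<open>i + j = m + 1\<close> with \<open>i, j > d\<close> the elements \<open>\<psi>\<^sub>0 [h\<^sub>i, h\<^sub>j]\<close> and \<open>\<psi>\<^sub>0 [h\<^sub>j, h\<^sub>i]\<close> are, up to a common scalar, \<open>[2i] \<delta>\<close>
    and \<open>[2j] \<delta>\<close> with the common difference \<open>\<delta>\<close> of the progression; antisymmetry of the commutator
    forces \<open>([2i] + [2j]) \<delta> = 0\<close>, hence \<open>\<delta> = 0\<close> (\<open>next_gap\<close>). The commutator of a quadratic
    relation with \<open>f\<close> gives the action of \<open>h\<close> with index \<open>m + 1\<close> on \<open>e\<close>, because \<open>\<psi>\<close> is the
    exponential of the \<open>h\<^sub>l\<close> (\<open>sexp_exchange\<close>).
  \<^item> The symmetry \<open>e\<^sub>k \<mapsto> e\<close> with index \<open>-k\<close>, \<open>h\<^sub>l \<mapsto> h\<close> with index \<open>-l\<close>, \<open>v \<mapsto> v\<^bsup>-1\<^esup>\<close> preserves the assumptions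
    (\<open>flip\<close>) and gives the negative half. The commutators of positive with negative \<open>h\<^sub>l\<close> are read
    off from their action on \<open>\<psi>\<close> (\<open>h_h_mixed\<close>).

  To calculate with equations instead of congruences, the quotients are made into types of class
  \<open>ring_1\<close>. Two points need care. A type cannot depend on \<open>d\<close>; so the degree is a constant \<open>d0\<close>, chosen
  to be a counterexample if there is one, and if the theorem holds for \<open>d0\<close>, it holds for every \<open>d\<close>. And a ring of this
  class is not zero; but each of the two homomorphisms exists as soon as its target is not zero, so
  one algebra is zero if and only if the other one is (\<open>nontrivial_iff\<close>).
\<close>

section \<open>Commutators and exponentials in an algebra over a field\<close>

lemma comm_mult_right: "comm x (y * z) = comm x y * z + y * comm x (z::'a::ring_1)"
  by (simp add: comm_def algebra_simps)

lemma comm_add_right: "comm x (y + z) = comm x y + comm x (z::'a::ring_1)"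
  by (simp add: comm_def algebra_simps)

lemma comm_diff_right: "comm x (y - z) = comm x y - comm x (z::'a::ring_1)"
  by (simp add: comm_def algebra_simps)

lemma comm_minus_right: "comm x (- y) = - comm x (y::'a::ring_1)"
  by (simp add: comm_def)

lemma comm_minus_left: "comm (- x) y = - comm x (y::'a::ring_1)"
  by (simp add: comm_def)

lemma comm_zero [simp]: "comm x 0 = 0" "comm 0 x = (0::'a::ring_1)"
  by (simp_all add: comm_def)

lemma comm_one [simp]: "comm x 1 = 0" "comm 1 x = (0::'a::ring_1)"
  by (simp_all add: comm_def)

lemma comm_self [simp]: "comm x x = (0::'a::ring_1)"
  by (simp add: comm_def)

lemma comm_swap: "comm y x = - comm x (y::'a::ring_1)"
  by (simp add: comm_def)

lemma comm_eq_0_iff: "comm x y = 0 \<longleftrightarrow> x * y = y * (x::'a::ring_1)"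
  by (simp add: comm_def)

lemma comm_sum_right: "comm x (sum f I) = (\<Sum>i\<in>I. comm x (f i :: 'a::ring_1))"
  by (simp add: comm_def sum_distrib_left sum_distrib_right sum_subtractf)

lemma comm_jacobi: "comm x (comm y z) = comm (comm x y) z + comm y (comm x (z::'a::ring_1))"
  by (simp add: comm_def algebra_simps)

text \<open>
  Integer powers of an invertible element of a ring without division; \<open>zi\<close> is the inverse of \<open>z\<close>.
\<close>

definition zpow :: "'a::ring_1 \<Rightarrow> 'a \<Rightarrow> int \<Rightarrow> 'a" where
  "zpow z zi n = (if 0 \<le> n then z ^ nat n else zi ^ nat (- n))"

lemma zpow_Suc: "z * zi = 1 \<Longrightarrow> zpow z zi (n + 1) = z * zpow z zi n"
proof (cases "n \<ge> 0")
  case True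
  then show ?thesis by (simp add: zpow_def nat_add_distrib)
next
  case False
  assume z: "z * zi = 1"
  have "nat (- n) = Suc (nat (- n - 1))" using False by simp
  moreover have "z * (zi * x) = x" for x by (simp add: z flip: mult.assoc)
  ultimately show ?thesis using False by (auto simp: zpow_def)
qed

lemma zpow_add:
  assumes "z * zi = 1" "zi * z = 1"
  shows "zpow z zi (m + n) = zpow z zi m * zpow z zi n"
proof (induction m rule: int_induct[where k = 0])
  case base
  show ?case by (simp add: zpow_def)
next
  case (step1 i)
  have "zpow z zi (i + 1 + n) = z * zpow z zi (i + n)"
    using zpow_Suc[OF assms(1), of "i + n"] by (simp add: add_ac)
  then show ?case by (simp add: step1 zpow_Suc[OF assms(1), of i] mult.assoc)
next
  case (step2 i)
  have p: "zpow z zi (k - 1) = zi * zpow z zi k" for k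
    using zpow_Suc[OF assms(1), of "k - 1"] by (simp add: assms(2) flip: mult.assoc)
  have "zpow z zi (i - 1 + n) = zi * zpow z zi (i + n)" using p[of "i + n"] by (simp add: algebra_simps)
  then show ?case by (simp add: step2 p[of i] mult.assoc)
qed

lemma zpow_central:
  fixes z :: "'a::ring_1"
  assumes "\<And>y. z * y = y * z" "\<And>y. zi * y = y * zi"
  shows "zpow z zi n * x = x * zpow z zi n"
proof -
  have "y ^ m * x = x * y ^ m" if "\<And>x. y * x = x * y" for y :: 'a and m
  proof (induction m)
    case (Suc m)
    then show ?case using that by (simp add: mult.assoc) (simp flip: mult.assoc)
  qed simp
  then show ?thesis using assms by (auto simp: zpow_def)
qed

lemma inverse_central:
  assumes inv: "z * zi = 1" "zi * z = 1" and z: "\<And>y. z * y = y * z"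
  shows "zi * x = x * (zi::'a::ring_1)"
proof -
  have "zi * x = zi * (x * z) * zi" by (simp add: inv mult.assoc)
  also have "\<dots> = zi * (z * x) * zi" by (simp only: z)
  also have "\<dots> = x * zi" by (simp add: inv flip: mult.assoc)
  finally show ?thesis .
qed

locale scalar_algebra = vector_space scale
  for scale :: "'k::field_char_0 \<Rightarrow> 'a::ring_1 \<Rightarrow> 'a" (infixr \<open>\<cdot>\<close> 72) +
  assumes mult_scale_left: "(a \<cdot> x) * y = a \<cdot> (x * y)"
    and mult_scale_right: "x * (a \<cdot> y) = a \<cdot> (x * y)"
begin

lemmas scale_mult = mult_scale_left mult_scale_right

lemma comm_scale_right [simp]: "comm x (a \<cdot> y) = a \<cdot> comm x y"
  by (simp add: comm_def scale_mult scale_right_diff_distrib)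

lemma comm_scale_left [simp]: "comm (a \<cdot> x) y = a \<cdot> comm x y"
  by (simp add: comm_def scale_mult scale_right_diff_distrib)

lemma scale_Suc: "of_nat (Suc i) \<cdot> x = x + of_nat i \<cdot> x"
  by (simp add: scale_left_distrib)

lemma inv_fact: "of_nat (Suc i) / fact (Suc i) = (1 / fact i :: 'k)"
  unfolding fact_Suc by (simp only: nonzero_divide_mult_cancel_left[OF of_nat_neq_0])

text \<open>
  The formula of \<^const>\<open>series_exp\<close> over an arbitrary algebra, so that homomorphisms out of the free
  algebra carry one exponential into the other.
\<close>

definition sexp :: "'a fps \<Rightarrow> 'a fps" where
  "sexp A = Abs_fps (\<lambda>n. \<Sum>i\<le>n. (1 / of_nat (fact i)) \<cdot> fps_nth (A ^ i) n)"

lemma sexp_nth_0 [simp]: "fps_nth (sexp A) 0 = 1"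
  by (simp add: sexp_def)

lemma sexp_nth:
  assumes "n > 0"
  shows "fps_nth (sexp A) n = fps_nth A n + (\<Sum>i=2..n. (1 / of_nat (fact i)) \<cdot> fps_nth (A ^ i) n)"
proof -
  have "{..n} = insert 0 (insert 1 {2..n})" using assms by auto
  then show ?thesis using assms by (simp add: sexp_def)
qed

lemma sexp_nth_cong:
  assumes "\<And>j. j < n \<Longrightarrow> fps_nth A j = fps_nth B j" "fps_nth A 0 = 0" "fps_nth B 0 = 0" "n > 0"
  shows "fps_nth (sexp A) n - fps_nth A n = fps_nth (sexp B) n - fps_nth B n"
proof -
  have "fps_nth (A ^ i) n = fps_nth (B ^ i) n" if "i \<in> {2..n}" for i
    by (rule fps_power_trunc) (use assms that in auto)
  then show ?thesis using assms(4) by (simp add: sexp_nth)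
qed

text \<open>
  A coefficient of the exponential is the coefficient of the series plus a polynomial in earlier ones, so the series can be recovered degree by degree.
\<close>

lemma sexp_inj:
  assumes "fps_nth A 0 = 0" "fps_nth B 0 = 0"
    and "\<And>k. k \<le> n \<Longrightarrow> fps_nth (sexp A) k = fps_nth (sexp B) k"
  shows "k \<le> n \<Longrightarrow> fps_nth A k = fps_nth B k"
proof (induction k rule: less_induct)
  case (less k)
  show ?case
  proof (cases "k = 0")
    case False
    with less have "fps_nth (sexp A) k - fps_nth A k = fps_nth (sexp B) k - fps_nth B k"
      by (intro sexp_nth_cong assms) auto
    then show ?thesis using assms(3)[of k] less.prems by simp
  qed (simp add: assms)
qed

lemma comm_power_nth:
  assumes "\<And>j. j \<le> n \<Longrightarrow> comm x (fps_nth A j) = 0"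
  shows "m \<le> n \<Longrightarrow> comm x (fps_nth (A ^ i) m) = 0"
proof (induction i arbitrary: m)
  case (Suc i)
  then show ?case by (auto simp: fps_mult_nth comm_sum_right comm_mult_right assms)
qed auto

lemma comm_sexp:
  assumes "\<And>j. j \<le> n \<Longrightarrow> comm x (fps_nth A j) = 0"
  shows "comm x (fps_nth (sexp A) n) = 0"
  using comm_power_nth[OF assms] by (simp add: sexp_def comm_sum_right)

text \<open>
  Modulo what commutes with \<open>x\<close>, the exponential is linear in the highest coefficient. This turns
  commutators with \<open>\<psi>\<^sub>n\<close> into commutators with \<open>h\<^sub>n\<close>.
\<close>

lemma comm_sexp_top:
  assumes "\<And>j. j < n \<Longrightarrow> comm x (fps_nth A j) = 0" "fps_nth A 0 = 0" "n > 0"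
  shows "comm x (fps_nth (sexp A) n) = comm x (fps_nth A n)"
proof -
  define B where "B = Abs_fps (\<lambda>j. if j < n then fps_nth A j else 0)"
  have "fps_nth (sexp A) n - fps_nth A n = fps_nth (sexp B) n - fps_nth B n"
    by (rule sexp_nth_cong) (use assms in \<open>auto simp: B_def\<close>)
  moreover have "comm x (fps_nth (sexp B) n) = 0"
    by (rule comm_sexp) (use assms in \<open>auto simp: B_def\<close>)
  moreover have "fps_nth B n = 0" by (simp add: B_def)
  ultimately have "fps_nth (sexp A) n = fps_nth A n + fps_nth (sexp B) n"
    by (simp add: algebra_simps)
  then show ?thesis using \<open>comm x (fps_nth (sexp B) n) = 0\<close> by (simp add: comm_add_right)
qed

lemma power_nth_low:
  assumes "fps_nth (A::'a fps) 0 = 0"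
  shows "m < i \<Longrightarrow> fps_nth (A ^ i) m = 0"
proof (induction i arbitrary: m)
  case (Suc i)
  have "fps_nth A j * fps_nth (A ^ i) (m - j) = 0" if "j \<le> m" for j
    using Suc assms that by (cases "j = 0") auto
  then show ?case by (simp add: fps_mult_nth)
qed simp

lemma sexp_nth_extend:
  assumes "fps_nth A 0 = 0" "m \<le> N"
  shows "fps_nth (sexp A) m = (\<Sum>i\<le>N. (1 / of_nat (fact i)) \<cdot> fps_nth (A ^ i) m)"
  unfolding sexp_def fps_nth_Abs_fps
  by (rule sum.mono_neutral_left) (use assms power_nth_low in auto)

text \<open>
  The derivation \<open>u d/du\<close>.
\<close>

definition euler :: "'a fps \<Rightarrow> 'a fps" where
  "euler A = Abs_fps (\<lambda>n. of_nat n \<cdot> fps_nth A n)"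

lemma euler_mult: "euler (A * B) = euler A * B + A * euler B"
proof (rule fps_ext)
  fix n
  have "fps_nth (euler (A * B)) n = (\<Sum>i=0..n. of_nat n \<cdot> (fps_nth A i * fps_nth B (n - i)))"
    by (simp add: euler_def fps_mult_nth scale_sum_right)
  also have "\<dots> = (\<Sum>i=0..n. of_nat i \<cdot> (fps_nth A i * fps_nth B (n - i))
        + of_nat (n - i) \<cdot> (fps_nth A i * fps_nth B (n - i)))"
  proof (rule sum.cong[OF refl])
    fix i assume "i \<in> {0..n}"
    then have "(of_nat n :: 'k) = of_nat i + of_nat (n - i)"
      by (simp add: of_nat_diff)
    then show "of_nat n \<cdot> (fps_nth A i * fps_nth B (n - i)) =
        of_nat i \<cdot> (fps_nth A i * fps_nth B (n - i)) + of_nat (n - i) \<cdot> (fps_nth A i * fps_nth B (n - i))"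
      by (metis scale_left_distrib)
  qed
  also have "\<dots> = fps_nth (euler A * B + A * euler B) n"
    by (simp add: euler_def fps_mult_nth sum.distrib scale_mult)
  finally show "fps_nth (euler (A * B)) n = fps_nth (euler A * B + A * euler B) n" .
qed

lemma euler_diff: "euler (A - B) = euler A - euler B"
  by (rule fps_ext) (simp add: euler_def scale_right_diff_distrib)

lemma euler_const: "euler (fps_const c) = 0"
  by (rule fps_ext) (simp add: euler_def)

lemma mult_nth_cong_right:
  fixes A B C :: "'a fps"
  assumes "\<And>j. j \<le> n \<Longrightarrow> fps_nth B j = fps_nth C j" "m \<le> n"
  shows "fps_nth (A * B) m = fps_nth (A * C) m"
  using assms by (auto simp: fps_mult_nth intro!: sum.cong)

lemma mult_nth_cong_left:
  fixes A B C :: "'a fps"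
  assumes "\<And>j. j \<le> n \<Longrightarrow> fps_nth B j = fps_nth C j" "m \<le> n"
  shows "fps_nth (B * A) m = fps_nth (C * A) m"
  using assms by (auto simp: fps_mult_nth intro!: sum.cong)

text \<open>
  Only coefficients \<open>i\<close> and \<open>j\<close> with \<open>i + j \<le> n\<close> are assumed to commute: in the induction over the
  diagonals, \<open>[h\<^sub>i, h\<^sub>j] = 0\<close> is known in this range only, and it is all that matters up to degree \<open>n\<close>.
\<close>

lemma euler_power_nth:
  assumes comm: "\<And>i j. i + j \<le> n \<Longrightarrow> comm (fps_nth A i) (fps_nth A j) = 0"
  shows "m \<le> n \<Longrightarrow> fps_nth (euler (A ^ Suc i)) m = of_nat (Suc i) \<cdot> fps_nth (euler A * A ^ i) m"
proof (induction i arbitrary: m)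
  case (Suc i)
  have sw: "fps_nth (A * euler A) k = fps_nth (euler A * A) k" if "k \<le> n" for k
  proof -
    have "fps_nth (A * euler A) k = (\<Sum>j=0..k. of_nat (k - j) \<cdot> (fps_nth A j * fps_nth A (k - j)))"
      by (simp add: fps_mult_nth euler_def scale_mult)
    also have "\<dots> = (\<Sum>j=0..k. of_nat (k - j) \<cdot> (fps_nth A (k - j) * fps_nth A j))"
    proof (rule sum.cong[OF refl])
      fix j assume "j \<in> {0..k}"
      then have "comm (fps_nth A j) (fps_nth A (k - j)) = 0" using that by (intro comm) auto
      then show "of_nat (k - j) \<cdot> (fps_nth A j * fps_nth A (k - j)) =
        of_nat (k - j) \<cdot> (fps_nth A (k - j) * fps_nth A j)" by (simp add: comm_eq_0_iff)
    qed
    also have "\<dots> = (\<Sum>j=0..k. of_nat j \<cdot> (fps_nth A j * fps_nth A (k - j)))"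
      by (rule sum.reindex_bij_witness[where i = "\<lambda>j. k - j" and j = "\<lambda>j. k - j"]) auto
    also have "\<dots> = fps_nth (euler A * A) k"
      by (simp add: fps_mult_nth euler_def scale_mult)
    finally show ?thesis .
  qed
  have "fps_nth (A * euler (A ^ Suc i)) m =
      fps_nth (A * Abs_fps (\<lambda>k. of_nat (Suc i) \<cdot> fps_nth (euler A * A ^ i) k)) m"
    by (rule mult_nth_cong_right[OF _ Suc.prems]) (simp only: Suc.IH fps_nth_Abs_fps)
  also have "\<dots> = of_nat (Suc i) \<cdot> fps_nth (A * euler A * A ^ i) m"
    by (simp add: fps_mult_nth[of A] mult.assoc scale_mult scale_sum_right)
  also have "fps_nth (A * euler A * A ^ i) m = fps_nth (euler A * A * A ^ i) m"
    by (rule mult_nth_cong_left[OF sw Suc.prems])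
  finally have "fps_nth (A * euler (A ^ Suc i)) m = of_nat (Suc i) \<cdot> fps_nth (euler A * A ^ Suc i) m"
    by (simp add: mult.assoc)
  then show ?case
    unfolding power_Suc[of A "Suc i"] euler_mult
    by (simp add: scale_Suc[of "Suc i"] del: power_Suc of_nat_Suc)
qed simp

text \<open>
  The differential equation \<open>P\<^sup>\<prime> = A\<^sup>\<prime> P\<close> of \<open>P = exp A\<close>, up to degree \<open>n\<close>.
\<close>

lemma euler_sexp_nth:
  assumes comm: "\<And>i j. i + j \<le> n \<Longrightarrow> comm (fps_nth A i) (fps_nth A j) = 0"
    and A0: "fps_nth A 0 = 0" and mn: "m \<le> n"
  shows "fps_nth (euler (sexp A)) m = fps_nth (euler A * sexp A) m"
proof (cases m)
  case (Suc m')
  have "fps_nth (euler (sexp A)) m = (\<Sum>i\<le>m. (1 / of_nat (fact i)) \<cdot> fps_nth (euler (A ^ i)) m)"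
    by (simp add: euler_def sexp_def scale_sum_right mult.commute)
  also have "\<dots> = (\<Sum>i\<le>m'. (1 / of_nat (fact (Suc i))) \<cdot> fps_nth (euler (A ^ Suc i)) m)"
    unfolding Suc sum.atMost_Suc_shift by (simp add: euler_def)
  also have "\<dots> = (\<Sum>i\<le>m'. (1 / of_nat (fact i)) \<cdot> fps_nth (euler A * A ^ i) m)"
    by (rule sum.cong[OF refl])
      (simp add: euler_power_nth[OF comm mn] inv_fact del: power_Suc of_nat_Suc fact_Suc)
  also have "\<dots> = (\<Sum>i\<le>m. (1 / of_nat (fact i)) \<cdot> fps_nth (euler A * A ^ i) m)"
  proof -
    have "fps_nth (euler A) j * fps_nth (A ^ m) (m - j) = 0" if "j \<le> m" for j
      using power_nth_low[OF A0, of "m - j" m] that Suc by (cases "j = 0") (auto simp: euler_def)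
    then have "fps_nth (euler A * A ^ m) m = 0" by (simp add: fps_mult_nth)
    then show ?thesis by (simp add: Suc del: power_Suc)
  qed
  also have "\<dots> = (\<Sum>i\<le>m. \<Sum>j=0..m. fps_nth (euler A) j * (1 / of_nat (fact i)) \<cdot> fps_nth (A ^ i) (m - j))"
    by (simp add: fps_mult_nth scale_sum_right scale_mult)
  also have "\<dots> = (\<Sum>j=0..m. fps_nth (euler A) j * (\<Sum>i\<le>m. (1 / of_nat (fact i)) \<cdot> fps_nth (A ^ i) (m - j)))"
    by (subst sum.swap) (simp add: sum_distrib_left)
  also have "\<dots> = fps_nth (euler A * sexp A) m"
    by (simp add: fps_mult_nth sexp_nth_extend[OF A0, of "m - _" m])
  finally show ?thesis .
qed (simp add: euler_def)

text \<open>
  If \<open>D = [x, \<cdot>]\<close> sends \<open>A\<close> to the central monomial \<open>z u\<^sup>l\<close>, then \<open>D (exp A) = z u\<^sup>l exp A\<close>. When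
  \<open>D A = z u\<^sup>l\<close> is only known below degree \<open>n\<close>, the error in degree \<open>n\<close> enters linearly. So the lemma serves in
  both directions: it computes \<open>D (exp A)\<close> from \<open>D A\<close>, and \<open>D A\<close> from \<open>D (exp A)\<close> by induction.
\<close>

lemma comm_sexp_derivation:
  fixes z :: 'a and n l :: nat
  assumes A0: "fps_nth A 0 = 0" and l: "l > 0"
    and DA: "\<And>j. j < n \<Longrightarrow> comm x (fps_nth A j) = (if j = l then z else 0)"
    and z: "\<And>j. comm z (fps_nth A j) = 0"
    and n: "n > 0"
  shows "comm x (fps_nth (sexp A) n) =
    (if l \<le> n then z * fps_nth (sexp A) (n - l) else 0) + (comm x (fps_nth A n) - (if n = l then z else 0))"
proof -
  define D where "D = (\<lambda>B. Abs_fps (\<lambda>m. comm x (fps_nth B m)))"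
  define Z where "Z = Abs_fps (\<lambda>j. if j = l then z else 0)"
  define W where "W = D A - Z"
  have D_mult: "D (B * C) = D B * C + B * D C" for B C
    by (rule fps_ext) (simp add: D_def fps_mult_nth comm_sum_right comm_mult_right sum.distrib)
  have DZ: "D A = Z + W" by (simp add: W_def)
  have W0: "fps_nth W j = 0" if "j < n" for j
    using DA[OF that] by (simp add: W_def Z_def D_def)
  have AZ: "A * Z = Z * A"
  proof (rule fps_ext)
    fix k
    have "(\<Sum>i=0..k. fps_nth A i * fps_nth Z (k - i)) = (\<Sum>i=0..k. fps_nth A (k - i) * fps_nth Z i)"
      by (rule sum.reindex_bij_witness[where i = "\<lambda>j. k - j" and j = "\<lambda>j. k - j"]) auto
    also have "\<dots> = (\<Sum>i=0..k. fps_nth Z i * fps_nth A (k - i))"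
      by (rule sum.cong) (use z in \<open>auto simp: Z_def comm_eq_0_iff\<close>)
    finally show "fps_nth (A * Z) k = fps_nth (Z * A) k" by (simp add: fps_mult_nth)
  qed
  have C: "fps_nth (D (A ^ Suc i)) m =
      of_nat (Suc i) \<cdot> fps_nth (Z * A ^ i) m + (if i = 0 then fps_nth W m else 0)" if "m \<le> n" for i m
    using that
  proof (induction i arbitrary: m)
    case 0
    show ?case by (simp add: DZ)
  next
    case (Suc i)
    have "fps_nth W j * fps_nth (A ^ Suc i) (m - j) = 0" if "j \<le> m" for j
    proof (cases "j < n")
      case False
      then have "m - j = 0" using that Suc.prems by simp
      then show ?thesis by (simp add: A0)
    qed (simp add: W0)
    then have 1: "fps_nth (W * A ^ Suc i) m = 0" by (simp add: fps_mult_nth del: power_Suc)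
    have "fps_nth A j * fps_nth (D (A ^ Suc i)) (m - j) =
        fps_nth A j * (of_nat (Suc i) \<cdot> fps_nth (Z * A ^ i) (m - j))" if "j \<le> m" for j
    proof (cases "j = 0")
      case False
      with that Suc.prems have "m - j < n" by simp
      then show ?thesis by (subst Suc.IH) (simp_all add: W0)
    qed (simp add: A0)
    then have "fps_nth (A * D (A ^ Suc i)) m = of_nat (Suc i) \<cdot> fps_nth (A * (Z * A ^ i)) m"
      by (simp add: fps_mult_nth[of A] scale_mult scale_sum_right del: power_Suc of_nat_Suc)
    also have "A * (Z * A ^ i) = Z * A ^ Suc i" by (metis AZ mult.assoc power_Suc)
    finally have 2: "fps_nth (A * D (A ^ Suc i)) m = of_nat (Suc i) \<cdot> fps_nth (Z * A ^ Suc i) m" .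
    show ?case
      unfolding power_Suc[of A "Suc i"] D_mult DZ
      using 1 2 by (simp add: distrib_right scale_Suc[of "Suc i"] del: power_Suc of_nat_Suc)
  qed
  have Zn: "fps_nth (Z * B) m = (if l \<le> m then z * fps_nth B (m - l) else 0)" for B m
  proof -
    have "fps_nth (Z * B) m = (\<Sum>i=0..m. if i = l then z * fps_nth B (m - i) else 0)"
      unfolding fps_mult_nth by (rule sum.cong) (auto simp: Z_def)
    then show ?thesis by simp
  qed
  obtain n' where n': "n = Suc n'" using n by (cases n) auto
  have "comm x (fps_nth (sexp A) n) = (\<Sum>i\<le>n. (1 / of_nat (fact i)) \<cdot> fps_nth (D (A ^ i)) n)"
    by (simp add: sexp_def comm_sum_right D_def)
  also have "\<dots> = (\<Sum>i\<le>n'. (1 / of_nat (fact (Suc i))) \<cdot> fps_nth (D (A ^ Suc i)) n)"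
    unfolding n' sum.atMost_Suc_shift by (simp add: D_def)
  also have "\<dots> = (\<Sum>i\<le>n'. (1 / of_nat (fact i)) \<cdot> fps_nth (Z * A ^ i) n + (if i = 0 then fps_nth W n else 0))"
  proof (rule sum.cong[OF refl])
    fix i
    show "(1 / of_nat (fact (Suc i))) \<cdot> fps_nth (D (A ^ Suc i)) n =
      (1 / of_nat (fact i)) \<cdot> fps_nth (Z * A ^ i) n + (if i = 0 then fps_nth W n else 0)"
      by (simp add: C inv_fact scale_right_distrib del: power_Suc fact_Suc of_nat_Suc)
  qed
  also have "\<dots> = (\<Sum>i\<le>n'. (1 / of_nat (fact i)) \<cdot> fps_nth (Z * A ^ i) n) + fps_nth W n"
    by (simp add: sum.distrib)
  also have "(\<Sum>i\<le>n'. (1 / of_nat (fact i)) \<cdot> fps_nth (Z * A ^ i) n) =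
     (if l \<le> n then z * fps_nth (sexp A) (n - l) else 0)"
  proof (cases "l \<le> n")
    case True
    have "fps_nth (sexp A) (n - l) = (\<Sum>i\<le>n'. (1 / of_nat (fact i)) \<cdot> fps_nth (A ^ i) (n - l))"
      by (rule sexp_nth_extend[OF A0]) (use l n' in simp)
    then show ?thesis using True by (simp add: Zn sum_distrib_left scale_mult)
  qed (simp add: Zn)
  also have "fps_nth W n = comm x (fps_nth A n) - (if n = l then z else 0)"
    by (simp add: W_def Z_def D_def)
  finally show ?thesis .
qed

lemma exchange_coeff_sum:
  fixes a b :: 'k
  shows "(\<Sum>i\<le>m. a ^ (m - i) * (a - b) * (a ^ i - b ^ i)) = of_nat (Suc m) * (a - b) * a ^ m - (a ^ Suc m - b ^ Suc m)"
proof (induction m)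
  case (Suc m)
  have "(\<Sum>i\<le>m. a ^ (Suc m - i) * (a - b) * (a ^ i - b ^ i)) = a * (\<Sum>i\<le>m. a ^ (m - i) * (a - b) * (a ^ i - b ^ i))"
    unfolding sum_distrib_left by (rule sum.cong) (simp_all add: Suc_diff_le mult.assoc)
  then show ?case unfolding sum.atMost_Suc Suc by (simp add: algebra_simps)
qed simp

text \<open>
  If \<open>[A\<^sub>j, x\<^sub>k] = (a\<^sup>j - b\<^sup>j)/j x\<^bsub>k+j\<^esub>\<close> for all \<open>j\<close>, then \<open>[A(u), \<cdot>]\<close> acts as
  \<open>log (1 - b u \<sigma>) - log (1 - a u \<sigma>)\<close> where \<open>\<sigma>\<close> is the shift of \<open>k\<close>, so \<open>P = exp A\<close> satisfies
  \<open>P (1 - a u \<sigma>) x = (1 - b u \<sigma>) x P\<close>. Knowing the hypothesis below degree \<open>n\<close>, the coefficient of \<open>u\<^sup>n\<close> in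
  this equation is off by exactly the error of the hypothesis in degree \<open>n\<close>. Hence the exchange
  relation for \<open>\<psi>\<close> in the next degree yields the action of the next \<open>h\<close>.
\<close>

lemma sexp_exchange:
  fixes x :: "int \<Rightarrow> 'a" and a b :: 'k
  assumes comm: "\<And>i j. i + j \<le> n \<Longrightarrow> comm (fps_nth A i) (fps_nth A j) = 0"
    and A0: "fps_nth A 0 = 0" and n: "n > 0"
    and act: "\<And>j k. 0 < j \<Longrightarrow> j < n \<Longrightarrow> comm (fps_nth A j) (x k) = ((a ^ j - b ^ j) / of_nat j) \<cdot> x (k + int j)"
  shows "fps_nth (sexp A) n * x k - x k * fps_nth (sexp A) n
      - a \<cdot> (fps_nth (sexp A) (n - 1) * x (k + 1)) + b \<cdot> (x (k + 1) * fps_nth (sexp A) (n - 1))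
    = comm (fps_nth A n) (x k) - ((a ^ n - b ^ n) / of_nat n) \<cdot> x (k + int n)"
proof -
  define P where "P = sexp A"
  define h where "h = euler A"
  \<comment> \<open>The coefficients of \<open>(1 - b t) / (1 - a t)\<close>: the claim is \<open>P x\<^sub>k = Y\<^sub>k P\<close>, and \<open>U\<^sub>k\<close> is its defect.\<close>
  define c where "c = (\<lambda>j. if j = 0 then 1 else a ^ (j - 1) * (a - b))"
  define Y where "Y = (\<lambda>k. Abs_fps (\<lambda>j. c j \<cdot> x (k + int j)))"
  define U where "U = (\<lambda>k. P * fps_const (x k) - Y k * P)"
  define e where "e = (\<lambda>k. comm (fps_nth A n) (x k) - ((a ^ n - b ^ n) / of_nat n) \<cdot> x (k + int n))"
  \<comment> \<open>Logarithmic derivative of \<open>(1 - b t) / (1 - a t)\<close>.\<close>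
  have csum: "(\<Sum>i\<le>m. c (m - i) * (a ^ i - b ^ i)) = of_nat m * c m" for m
  proof (cases m)
    case (Suc m')
    have "(\<Sum>i\<le>m'. c (Suc m' - i) * (a ^ i - b ^ i)) = (\<Sum>i\<le>m'. a ^ (m' - i) * (a - b) * (a ^ i - b ^ i))"
      by (rule sum.cong) (auto simp: c_def)
    then show ?thesis using Suc exchange_coeff_sum[where m = m' and a = a and b = b] by (simp add: c_def mult_ac)
  qed (simp add: c_def)
  have hY: "fps_nth (h * Y k - Y k * h - euler (Y k)) m = (if m = n then of_nat n \<cdot> e k else 0)" if mn: "m \<le> n" for m k
  proof -
    have "fps_nth (Y k * h) m = (\<Sum>i\<le>m. fps_nth (Y k) (m - i) * fps_nth h i)"
      unfolding fps_mult_nth atMost_atLeast0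
      by (rule sum.reindex_bij_witness[where i = "\<lambda>j. m - j" and j = "\<lambda>j. m - j"]) auto
    then have "fps_nth (h * Y k - Y k * h) m = (\<Sum>i\<le>m. comm (fps_nth h i) (fps_nth (Y k) (m - i)))"
      by (simp add: fps_mult_nth atMost_atLeast0 comm_def sum_subtractf)
    also have "\<dots> = (\<Sum>i\<le>m. (c (m - i) * (a ^ i - b ^ i)) \<cdot> x (k + int m) + (if i = n then of_nat n \<cdot> e k else 0))"
    proof (rule sum.cong[OF refl])
      fix i assume i: "i \<in> {..m}"
      then have *: "k + int (m - i) + int i = k + int m" by simp
      consider "i = 0" | "0 < i" "i < n" | "i = n" "m = n" using i mn by (cases "i = 0"; cases "i < n") auto
      then show "comm (fps_nth h i) (fps_nth (Y k) (m - i)) =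
          (c (m - i) * (a ^ i - b ^ i)) \<cdot> x (k + int m) + (if i = n then of_nat n \<cdot> e k else 0)"
      proof cases
        case 1
        then show ?thesis using n by (simp add: h_def euler_def)
      next
        case 2
        then show ?thesis using * by (simp add: h_def euler_def Y_def act)
      next
        case 3
        then show ?thesis using n by (simp add: h_def euler_def Y_def e_def c_def scale_right_diff_distrib)
      qed
    qed
    also have "\<dots> = (of_nat m * c m) \<cdot> x (k + int m) + (if m = n then of_nat n \<cdot> e k else 0)"
    proof -
      have "(\<Sum>i\<le>m. if i = n then of_nat n \<cdot> e k else 0) = (if m = n then of_nat n \<cdot> e k else 0)"
        using that by (auto simp: sum.delta)
      then show ?thesis by (simp only: sum.distrib scale_sum_left[symmetric] csum)
    qed
    finally show ?thesis by (simp add: euler_def Y_def)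
  qed
  \<comment> \<open>Both \<open>P x\<^sub>k\<close> and \<open>Y\<^sub>k P\<close> solve the same linear differential equation, so \<open>U\<^sub>k\<close> solves the homogeneous one.\<close>
  have eU: "fps_nth (euler (U k)) m = fps_nth (h * U k) m + (if m = n then of_nat n \<cdot> e k else 0)"
    if m: "m \<le> n" for k m
  proof -
    note eP = euler_sexp_nth[OF comm A0, folded P_def h_def]
    have "euler (U k) = euler P * fps_const (x k) - euler (Y k) * P - Y k * euler P"
      by (simp add: U_def euler_diff euler_mult euler_const)
    then have "fps_nth (euler (U k)) m = fps_nth (h * P * fps_const (x k)) m - fps_nth (euler (Y k) * P) m - fps_nth (Y k * (h * P)) m"
      using mult_nth_cong_left[where A = "fps_const (x k)", OF eP m] mult_nth_cong_right[where A = "Y k", OF eP m]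
      by simp
    also have "\<dots> = fps_nth (h * U k) m + fps_nth ((h * Y k - Y k * h - euler (Y k)) * P) m"
      by (simp add: U_def algebra_simps)
    also have "fps_nth ((h * Y k - Y k * h - euler (Y k)) * P) m
        = (\<Sum>i=0..m. if i = n then of_nat n \<cdot> e k * fps_nth P (m - i) else 0)"
      unfolding fps_mult_nth[of "h * Y k - Y k * h - euler (Y k)"]
      by (rule sum.cong[OF refl]) (use hY m in auto)
    also have "\<dots> = (if m = n then of_nat n \<cdot> e k else 0)"
      using m by (auto simp: sum.delta P_def)
    finally show ?thesis .
  qed
  have U: "m \<le> n \<Longrightarrow> fps_nth (U k) m = (if m = n then e k else 0)" for m k
  proof (induction m rule: less_induct)
    case (less m)
    show ?case
    proof (cases "m = 0")
      case True
      then show ?thesis using n by (simp add: U_def P_def Y_def c_def)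
    next
      case False
      have "fps_nth h j * fps_nth (U k) (m - j) = 0" if "j \<le> m" for j
        using that less by (cases "j = 0") (auto simp: h_def euler_def)
      then have "fps_nth (h * U k) m = 0" by (simp add: fps_mult_nth)
      with eU[OF less.prems, of k] have "of_nat m \<cdot> fps_nth (U k) m = of_nat m \<cdot> (if m = n then e k else 0)"
        by (simp add: euler_def)
      then show ?thesis using False by (simp only: scale_cancel_left of_nat_eq_0_iff simp_thms)
    qed
  qed
  obtain n' where n': "n = Suc n'" using n by (cases n) auto
  have 1: "fps_nth (U k) n = fps_nth P n * x k - x k * fps_nth P n
      - (\<Sum>j\<le>n'. c (Suc j) \<cdot> (x (k + 1 + int j) * fps_nth P (n' - j)))" for k
    unfolding U_def fps_sub_nth fps_mult_nth[of "Y k"] atMost_atLeast0[symmetric] n' sum.atMost_Suc_shift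
    by (simp add: Y_def c_def scale_mult add_ac)
  have 2: "fps_nth (U (k + 1)) n' = fps_nth P n' * x (k + 1)
      - (\<Sum>j\<le>n'. c j \<cdot> (x (k + 1 + int j) * fps_nth P (n' - j)))" for k
    unfolding U_def fps_sub_nth fps_mult_nth[of "Y (k + 1)"] atMost_atLeast0[symmetric]
    by (simp add: Y_def c_def scale_mult)
  have c_Suc: "c (Suc j) = a * c j - (if j = 0 then b else 0)" for j
    by (cases j) (auto simp: c_def)
  have 3: "(\<Sum>j\<le>n'. c (Suc j) \<cdot> (x (k + 1 + int j) * fps_nth P (n' - j))) =
     a \<cdot> (\<Sum>j\<le>n'. c j \<cdot> (x (k + 1 + int j) * fps_nth P (n' - j))) - b \<cdot> (x (k + 1) * fps_nth P n')"
  proof -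
    have "(\<Sum>j\<le>n'. (if j = 0 then b else 0) \<cdot> (x (k + 1 + int j) * fps_nth P (n' - j))) = b \<cdot> (x (k + 1) * fps_nth P n')"
      by (subst sum.remove[of _ 0]) auto
    then show ?thesis by (simp add: c_Suc scale_left_diff_distrib sum_subtractf scale_sum_right)
  qed
  have "fps_nth (U k) n - a \<cdot> fps_nth (U (k + 1)) n' = e k" using U[of n k] U[of n' "k + 1"] n' by simp
  then show ?thesis
    unfolding 1 2 3 by (simp add: P_def e_def n' scale_right_diff_distrib algebra_simps)
qed

end

section \<open>Quantum numbers\<close>

definition qnum :: "'k::field \<Rightarrow> int \<Rightarrow> 'k" where
  "qnum v n = (v powi n - v powi (- n)) / (v - inverse v)"

lemma qnum_inverse: "v \<noteq> 0 \<Longrightarrow> qnum (inverse v) n = qnum v n"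
proof -
  have "qnum (inverse v) n = (v powi (- n) - v powi n) / (inverse v - v)"
    by (simp add: qnum_def power_int_minus power_int_inverse)
  also have "\<dots> = (- (v powi n - v powi (- n))) / (- (v - inverse v))"
    by simp
  also have "\<dots> = qnum v n" unfolding qnum_def by (rule minus_divide_divide)
  finally show ?thesis .
qed

locale quantum_parameter =
  fixes v :: "'k::field_char_0"
  assumes v_nz: "v \<noteq> 0" and not_root_of_unity: "n > 0 \<Longrightarrow> v ^ n \<noteq> 1"
begin

definition kap :: 'k where "kap = v - inverse v"
definition q :: 'k where "q = v\<^sup>2"
definition qi :: 'k where "qi = (inverse v)\<^sup>2"
definition wt :: "int \<Rightarrow> 'k" where "wt l = qnum v (2 * l) / of_int l"

lemma powi_eq_1_iff: "v powi n = 1 \<longleftrightarrow> n = 0"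
proof (cases n rule: int_cases3)
  case (pos m)
  then show ?thesis using not_root_of_unity[of m] by simp
next
  case (neg m)
  then show ?thesis using not_root_of_unity[of m] v_nz by (simp add: power_int_minus inverse_eq_1_iff)
qed simp

lemma kap_nz: "kap \<noteq> 0"
  using powi_eq_1_iff[of 2] v_nz by (auto simp: kap_def field_simps power2_eq_square)

lemma qnum_nz: "n \<noteq> 0 \<Longrightarrow> qnum v n \<noteq> 0"
proof
  assume n: "n \<noteq> 0" and "qnum v n = 0"
  then have "v powi n = v powi (- n)" using kap_nz by (simp add: qnum_def kap_def)
  moreover have "v powi (n + n) = v powi n * v powi n" using v_nz by (intro power_int_add) simp
  ultimately have "v powi (n + n) = v powi (- n) * v powi n" by simp
  also have "\<dots> = 1" using v_nz by (simp add: power_int_minus)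
  finally show False using n by (simp add: powi_eq_1_iff)
qed

text \<open>
  \<open>[2i] + [2j]\<close> is a multiple of \<open>(x + y) (x y - 1)\<close> with \<open>x = v\<^bsup>2i\<^esup>\<close> and \<open>y = v\<^bsup>2j\<^esup>\<close>. Neither
  factor vanishes, as \<open>v\<close> is not a root of unity.
\<close>

lemma qnum_add_nz:
  assumes "0 < i" "0 < j" shows "qnum v (2 * i) + qnum v (2 * j) \<noteq> 0"
proof
  assume 0: "qnum v (2 * i) + qnum v (2 * j) = 0"
  define x y where "x = v powi (2 * i)" and "y = v powi (2 * j)"
  have xy: "x \<noteq> 0" "y \<noteq> 0" using v_nz by (auto simp: x_def y_def)
  have "qnum v (2 * i) + qnum v (2 * j) = (x - inverse x + y - inverse y) / kap"
    by (simp add: qnum_def kap_def x_def y_def power_int_minus add_divide_distrib[symmetric])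
  with 0 have "x - inverse x + y - inverse y = 0" using kap_nz by simp
  then have "(x + y) * (x * y - 1) = 0" using xy by (simp add: field_simps)
  moreover have "x * y \<noteq> 1"
    using powi_eq_1_iff[of "2 * i + 2 * j"] assms v_nz by (simp add: x_def y_def power_int_add)
  ultimately have m: "x = - y" by (simp add: add_eq_0_iff2)
  then have "x * x = y * y" by simp
  then have "v powi (4 * i - 4 * j) = 1"
    using v_nz xy by (simp add: power_int_diff x_def y_def flip: power_int_add)
  then have "i = j" by (simp add: powi_eq_1_iff)
  with m have "y + y = 0" by (simp add: x_def y_def)
  then show False using xy by (simp add: mult_2[symmetric])
qed

lemma qqi: "q * qi = 1" "qi * q = 1"
  using v_nz by (simp_all add: q_def qi_def flip: power_mult_distrib)

lemma wt_1: "wt 1 = qnum v 2"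
  by (simp add: wt_def)

lemma wt_nz: "l \<noteq> 0 \<Longrightarrow> wt l \<noteq> 0"
  using qnum_nz[of "2 * l"] by (simp add: wt_def)

lemma kap_wt: "n > 0 \<Longrightarrow> kap * wt (int n) = (q ^ n - qi ^ n) / of_nat n"
proof -
  have 1: "v powi (2 * int n) = q ^ n"
    unfolding q_def power_mult[symmetric] by (simp flip: power_int_of_nat)
  have 2: "v powi (- (2 * int n)) = qi ^ n"
    unfolding power_int_minus 1 by (simp add: q_def qi_def power_inverse)
  show ?thesis unfolding wt_def qnum_def kap_def[symmetric] 1 2 using kap_nz by simp
qed

text \<open>
  The symmetry of the relations inverts \<open>v\<close>, so every statement is proved for all parameters at once.
\<close>

lemma inverse_parameter: "quantum_parameter (inverse v)"
  by standard (use v_nz not_root_of_unity in \<open>auto simp: power_inverse\<close>)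

lemma inverse_simps:
  "quantum_parameter.kap (inverse v) = - kap" "quantum_parameter.q (inverse v) = qi"
  "quantum_parameter.qi (inverse v) = q" "quantum_parameter.wt (inverse v) = wt"
proof -
  interpret I: quantum_parameter "inverse v" by (rule inverse_parameter)
  show "I.kap = - kap" "I.q = qi" "I.qi = q" "I.wt = wt"
    using v_nz by (simp_all add: I.kap_def kap_def I.q_def q_def I.qi_def qi_def I.wt_def[abs_def] wt_def[abs_def] qnum_inverse)
qed

end

section \<open>Families on which elements act by shifts\<close>

context scalar_algebra
begin

lemma comm_central: "(\<And>a. z * a = a * (z::'a)) \<Longrightarrow> comm u (z * w) = z * comm u w"
  unfolding comm_mult_right by (simp add: comm_def)

text \<open>
  One base relation spreads to all indices because \<open>y\<close> commutes with the shift operators. The central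
  factor \<open>z\<close> carries the powers of \<open>C\<close>.
\<close>

lemma shift_extend:
  fixes x :: "int \<Rightarrow> 'a"
  assumes u: "\<And>k. comm u (x k) = x (k + 1)" and t: "\<And>k. comm t (x k) = x (k - 1)"
    and yu: "comm y u = 0" and yt: "comm y t = 0"
    and z: "\<And>a. z * a = a * z"
    and base: "comm y (x a) = z * x (a + l)"
  shows "comm y (x k) = z * x (k + l)"
proof (induction k rule: int_induct[where k = a])
  case base
  show ?case by (rule assms)
next
  case (step1 i)
  have "comm y (x (i + 1)) = comm u (comm y (x i))"
    unfolding u[symmetric] by (subst comm_jacobi) (simp add: yu)
  also have "\<dots> = z * comm u (x (i + l))"
    unfolding step1 by (rule comm_central[OF z])
  finally show ?case by (simp add: u add_ac)
next
  case (step2 i)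
  have "comm y (x (i - 1)) = comm t (comm y (x i))"
    unfolding t[symmetric] by (subst comm_jacobi) (simp add: yt)
  also have "\<dots> = z * comm t (x (i + l))"
    unfolding step2 by (rule comm_central[OF z])
  finally show ?case by (simp add: t algebra_simps)
qed

lemma double_eq_0: "(x::'a) + x = 0 \<Longrightarrow> x = 0"
proof -
  assume "x + x = 0"
  then have "(1 + 1) \<cdot> x = 0" by (simp only: scale_left_distrib scale_one)
  then show "x = 0" by simp
qed

text \<open>
  The quadratic relation is that \<open>quad r x\<close> vanishes, with \<open>r = v\<^sup>2\<close> for \<open>e\<close> and \<open>r = v\<^bsup>-2\<^esup>\<close> for \<open>f\<close>.
\<close>

definition quad :: "'k \<Rightarrow> (int \<Rightarrow> 'a) \<Rightarrow> int \<Rightarrow> int \<Rightarrow> 'a" where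
  "quad r x k l = x (k + 1) * x l - r \<cdot> (x l * x (k + 1)) - r \<cdot> (x k * x (l + 1)) + x (l + 1) * x k"

lemma quad_sym: "quad r x k l = quad r x l k"
  by (simp add: quad_def)

lemma comm_quad:
  assumes "\<And>k. comm u (x k) = x (k + c)"
  shows "comm u (quad r x k l) = quad r x (k + c) l + quad r x k (l + c)"
proof -
  have e: "k + 1 + c = k + c + 1" "l + 1 + c = l + c + 1" by simp_all
  show ?thesis
    by (simp add: quad_def comm_add_right comm_diff_right comm_mult_right assms scale_right_distrib e)
qed

text \<open>
  Applying the shift by \<open>c\<close> to the diagonal \<open>s + c\<close> shows that \<open>Q\<close> alternates in sign along the diagonal
  \<open>s + 2c\<close>; applying the shift by \<open>2c\<close> to the diagonal \<open>s\<close> shows that \<open>Q\<close> also changes sign over two steps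
  along it. Together \<open>2 Q = 0\<close>.
\<close>

lemma quad_propagate:
  assumes u: "\<And>k. comm u (x k) = x (k + c)" and u2: "\<And>k. comm u2 (x k) = x (k + 2 * c)"
    and s0: "\<And>k. quad r x k (s - k) = 0" and s1: "\<And>k. quad r x k (s + c - k) = 0"
  shows "quad r x k (s + 2 * c - k) = 0"
proof -
  have 1: "quad r x (k + c) l = - quad r x k (l + c)" if "k + l = s + c" for k l
  proof -
    have "l = s + c - k" using that by simp
    then have "comm u (quad r x k l) = 0" by (simp add: s1)
    then show ?thesis unfolding comm_quad[of u x c, OF u] by (simp add: eq_neg_iff_add_eq_0)
  qed
  have 2: "quad r x (k + 2 * c) l = - quad r x k (l + 2 * c)" if "k + l = s" for k l
  proof -
    have "l = s - k" using that by simp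
    then have "comm u2 (quad r x k l) = 0" by (simp add: s0)
    then show ?thesis unfolding comm_quad[of u2 x "2 * c", OF u2] by (simp add: eq_neg_iff_add_eq_0)
  qed
  define l where "l = s - k"
  have "quad r x (k + c + c) l = - quad r x (k + c) (l + c)" by (rule 1) (simp add: l_def)
  also have "quad r x (k + c) (l + c) = - quad r x k (l + c + c)" by (rule 1) (simp add: l_def)
  finally have "quad r x (k + 2 * c) l = quad r x k (l + 2 * c)" by (simp add: algebra_simps)
  with 2[of k l] have "quad r x k (l + 2 * c) + quad r x k (l + 2 * c) = 0"
    by (simp add: l_def eq_neg_iff_add_eq_0)
  then have "quad r x k (l + 2 * c) = 0" by (rule double_eq_0)
  then show ?thesis by (simp add: l_def algebra_simps)
qed

text \<open>
  From \<open>Q\<close> at one point of the main diagonal, the shifts by \<open>1\<close> and \<open>-1\<close> and the symmetry of \<open>Q\<close> reach two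
  adjacent diagonals by a zigzag. All other diagonals follow with \<open>quad_propagate\<close>, which needs the
  shifts by \<open>2\<close>; this is the use of the relations for \<open>H\<^sub>2\<close> in the finite presentation.
\<close>

lemma quad_all:
  assumes u: "\<And>k. comm u (x k) = x (k + 1)" and t: "\<And>k. comm t (x k) = x (k - 1)"
    and u2: "\<And>k. comm u2 (x k) = x (k + 2)" and t2: "\<And>k. comm t2 (x k) = x (k - 2)"
    and base: "x (a + 1) * x a = r \<cdot> (x a * x (a + 1))"
  shows "quad r x k l = 0"
proof -
  let ?Q = "quad r x"
  have cu: "comm u (?Q k l) = ?Q (k + 1) l + ?Q k (l + 1)" for k l
    using comm_quad[of u x 1 r k l] u by simp
  have ct: "comm t (?Q k l) = ?Q (k - 1) l + ?Q k (l - 1)" for k l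
    using comm_quad[of t x "-1" r k l] t by simp
  have pos: "?Q (a + int n) (a - int n) = 0 \<and> ?Q (a + int n + 1) (a - int n) = 0" for n
  proof (induction n)
    case 0
    have 1: "?Q a a = 0" using base by (simp add: quad_def)
    have "?Q (a + 1) a + ?Q (a + 1) a = 0"
      using cu[of a a] 1 quad_sym[of r x "a + 1" a] by simp
    then show ?case using 1 by (auto dest: double_eq_0)
  next
    case (Suc n)
    have "?Q (a + int n + 1) (a - int n - 1) = 0"
      using ct[of "a + int n + 1" "a - int n"] Suc by simp
    moreover from this have "?Q (a + int n + 1 + 1) (a - int n - 1) = 0"
      using cu[of "a + int n + 1" "a - int n - 1"] Suc by simp
    ultimately show ?case by (simp add: algebra_simps)
  qed
  have Z0: "?Q k (2 * a - k) = 0" for k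
  proof (cases "k \<ge> a")
    case True
    then show ?thesis using pos[of "nat (k - a)"] by simp
  next
    case False
    then show ?thesis using pos[of "nat (a - k)"] quad_sym[of r x k "2 * a - k"] by simp
  qed
  have Z1: "?Q k (2 * a + 1 - k) = 0" for k
  proof (cases "k \<ge> a + 1")
    case True
    then show ?thesis using pos[of "nat (k - a - 1)"] by (simp add: algebra_simps)
  next
    case False
    then show ?thesis using pos[of "nat (a - k)"] quad_sym[of r x k "2 * a + 1 - k"]
      by (simp add: algebra_simps)
  qed
  have up: "(\<forall>k. ?Q k (2 * a + int n - k) = 0) \<and> (\<forall>k. ?Q k (2 * a + int n + 1 - k) = 0)" for n
  proof (induction n)
    case 0
    then show ?case using Z0 Z1 by simp
  next
    case (Suc n)
    have "?Q k (2 * a + int n + 2 * 1 - k) = 0" for k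
      by (rule quad_propagate[of u x 1 u2]) (use u u2 Suc in auto)
    then show ?case using Suc by (simp add: algebra_simps)
  qed
  have down: "(\<forall>k. ?Q k (2 * a - int n - k) = 0) \<and> (\<forall>k. ?Q k (2 * a - int n + 1 - k) = 0)" for n
  proof (induction n)
    case 0
    then show ?case using Z0 Z1 by simp
  next
    case (Suc n)
    have "?Q k (2 * a - int n + 1 + 2 * (- 1) - k) = 0" for k
      by (rule quad_propagate[of t x "-1" t2]) (use t t2 Suc in auto)
    then show ?case using Suc by (simp add: algebra_simps)
  qed
  show ?thesis
  proof (cases "k + l \<ge> 2 * a")
    case True
    then show ?thesis using up[of "nat (k + l - 2 * a)"] by (auto dest: spec[of _ k])
  next
    case False
    then show ?thesis using down[of "nat (2 * a - k - l)"] by (auto dest: spec[of _ k])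
  qed
qed

lemma quad_diag:
  assumes "quad r x k k = 0"
  shows "x (k + 1) * x k = r \<cdot> (x k * x (k + 1))"
proof -
  have "(x (k + 1) * x k - r \<cdot> (x k * x (k + 1))) + (x (k + 1) * x k - r \<cdot> (x k * x (k + 1))) = 0"
    using assms by (simp add: quad_def algebra_simps)
  from double_eq_0[OF this] show ?thesis by simp
qed

end

context scalar_algebra
begin

text \<open>
  The exponential is compatible with the substitution \<open>u \<mapsto> z u\<close>.
\<close>

lemma sexp_rescale:
  fixes z :: 'a
  assumes z: "\<And>x. z * x = x * z"
  shows "fps_nth (sexp (Abs_fps (\<lambda>j. z ^ j * fps_nth P j))) n = z ^ n * fps_nth (sexp P) n"
proof -
  have zp: "x * (z ^ k * y) = z ^ k * (x * y)" for x y k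
  proof (induction k)
    case (Suc k)
    have "x * (z ^ Suc k * y) = (x * z) * (z ^ k * y)" by (simp add: mult.assoc)
    also have "\<dots> = z * (x * (z ^ k * y))" unfolding z[of x, symmetric] mult.assoc ..
    finally show ?case unfolding Suc by (simp add: mult.assoc)
  qed simp
  have "fps_nth (Abs_fps (\<lambda>j. z ^ j * fps_nth P j) ^ i) m = z ^ m * fps_nth (P ^ i) m" for i m
  proof (induction i arbitrary: m)
    case (Suc i)
    have "z ^ j * fps_nth P j * (z ^ (m - j) * y) = z ^ m * (fps_nth P j * y)" if "j \<in> {0..m}" for j y
      using that zp[of "fps_nth P j" "m - j" y] by (simp add: mult.assoc) (simp flip: mult.assoc power_add)
    then show ?case by (simp add: fps_mult_nth Suc sum_distrib_left)
  qed (auto simp: power_0_left)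
  then show ?thesis by (simp add: sexp_def sum_distrib_left scale_mult)
qed

text \<open>
  In the finite presentation \<open>x\<^sub>n\<close> is defined from \<open>x\<close> at \<open>n0\<close> by applying one shift upwards and the other one
  downwards. That each shift also acts correctly on the other side follows from the single step back
  to \<open>n0\<close>, since the two shifts commute on \<open>x\<close>.
\<close>

lemma shift_two_sided:
  fixes x :: "int \<Rightarrow> 'a"
  assumes up: "\<And>n. n0 \<le> n \<Longrightarrow> comm u (x n) = x (n + 1)" and down: "\<And>n. n \<le> n0 \<Longrightarrow> comm t (x n) = x (n - 1)"
    and base: "comm u (x (n0 - 1)) = x n0" "comm t (x (n0 + 1)) = x n0"
    and ut: "\<And>n. comm (comm u t) (x n) = 0"
  shows "comm u (x n) = x (n + 1)" "comm t (x n) = x (n - 1)"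
proof -
  have u: "comm u (x (n0 - 1 - int k)) = x (n0 - 1 - int k + 1)" for k
  proof (induction k)
    case (Suc k)
    have "comm u (x (n0 - 1 - int (Suc k))) = comm u (comm t (x (n0 - 1 - int k)))"
      using down[of "n0 - 1 - int k"] by (simp add: algebra_simps)
    also have "\<dots> = comm t (comm u (x (n0 - 1 - int k)))" by (subst comm_jacobi) (simp add: ut)
    also have "\<dots> = x (n0 - 1 - int (Suc k) + 1)"
      unfolding Suc using down[of "n0 - 1 - int k + 1"] by (simp add: algebra_simps)
    finally show ?case .
  qed (use base in simp)
  have t: "comm t (x (n0 + 1 + int k)) = x (n0 + 1 + int k - 1)" for k
  proof (induction k)
    case (Suc k)
    have tu: "comm (comm t u) (x n) = 0" for n using ut[of n] by (subst comm_swap) (simp add: comm_minus_left)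
    have "comm t (x (n0 + 1 + int (Suc k))) = comm t (comm u (x (n0 + 1 + int k)))"
      using up[of "n0 + 1 + int k"] by (simp add: algebra_simps)
    also have "\<dots> = comm u (comm t (x (n0 + 1 + int k)))" by (subst comm_jacobi) (simp add: tu)
    also have "\<dots> = x (n0 + 1 + int (Suc k) - 1)"
      unfolding Suc using up[of "n0 + 1 + int k - 1"] by (simp add: algebra_simps)
    finally show ?case .
  qed (use base in simp)
  show "comm u (x n) = x (n + 1)"
    using up[of n] u[of "nat (n0 - 1 - n)"] by (cases "n0 \<le> n") auto
  show "comm t (x n) = x (n - 1)"
    using down[of n] t[of "nat (n - n0 - 1)"] by (cases "n \<le> n0") auto
qed

end

section \<open>All current relations from finitely many\<close>

text \<open>
  The rescaled generators with finitely many relations. The form of the assumptions is dictated by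
  the symmetry proved below: they refer to the existence of some index where a relation holds, since
  the symmetry moves the specific indices. The numbers \<open>N\<close> and \<open>B\<close> bound the indices of the \<open>h\<^sub>l\<close> and the
  diagonals on which something is assumed; \<open>e_f_up\<close> and \<open>e_f_down\<close> give the relation for \<open>[e\<^sub>k, f\<^sub>l]\<close>
  at a point and at its two neighbours on an adjacent diagonal. The element \<open>g n\<close> is \<open>C\<^bsup>2n\<^esup>\<close>, and \<open>K\<close>, \<open>L\<close> are
  \<open>\<psi>\<^sub>0\<close>, \<open>\<phi>\<^sub>d\<close>.
\<close>

locale current_seed = scalar_algebra scale + quantum_parameter v
  for scale :: "'k::field_char_0 \<Rightarrow> 'a::ring_1 \<Rightarrow> 'a" (infixr \<open>\<cdot>\<close> 72) and v :: 'k +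
  fixes d N B :: int and g e f h psi phi :: "int \<Rightarrow> 'a" and K Ki L Li :: 'a
  assumes g_0: "g 0 = 1" and g_add: "g (m + n) = g m * g n" and g_central: "g n * x = x * g n"
    and K_inv: "K * Ki = 1" "Ki * K = 1" and L_inv: "L * Li = 1" "Li * L = 1"
    and K_e: "K * e n = q \<cdot> (e n * K)" and K_f: "K * f n = qi \<cdot> (f n * K)"
    and L_e: "L * e n = qi \<cdot> (e n * L)" and L_f: "L * f n = q \<cdot> (f n * L)"
    and K_h: "n \<noteq> 0 \<Longrightarrow> comm (h n) K = 0" and L_h: "n \<noteq> 0 \<Longrightarrow> comm (h n) L = 0"
    and h1_e: "comm (h 1) (e n) = wt 1 \<cdot> e (n + 1)"
    and hm1_e: "comm (h (-1)) (e n) = wt 1 \<cdot> e (n - 1)"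
    and h1_f: "comm (h 1) (f n) = - (wt 1 \<cdot> f (n + 1))"
    and hm1_f: "comm (h (-1)) (f n) = - (wt 1 \<cdot> (g 1 * f (n - 1)))"
    and h1_hm1: "comm (h 1) (h (-1)) = (wt 1 / kap) \<cdot> (g 1 - 1)"
    and h_h_pos: "1 \<le> i \<Longrightarrow> i \<le> N \<Longrightarrow> 1 \<le> j \<Longrightarrow> j \<le> N \<Longrightarrow> comm (h i) (h j) = 0"
    and h_h_neg: "1 \<le> i \<Longrightarrow> i \<le> N \<Longrightarrow> 1 \<le> j \<Longrightarrow> j \<le> N \<Longrightarrow> comm (h (- i)) (h (- j)) = 0"
    and h_e_pos: "1 \<le> l \<Longrightarrow> l \<le> N \<Longrightarrow> \<exists>a. comm (h l) (e a) = wt l \<cdot> e (a + l)"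
    and h_f_pos: "1 \<le> l \<Longrightarrow> l \<le> N \<Longrightarrow> \<exists>a. comm (h l) (f a) = - (wt l \<cdot> f (a + l))"
    and h_e_neg: "1 \<le> l \<Longrightarrow> l \<le> N \<Longrightarrow> \<exists>a. comm (h (- l)) (e a) = wt l \<cdot> e (a - l)"
    and h_f_neg: "1 \<le> l \<Longrightarrow> l \<le> N \<Longrightarrow> \<exists>a. comm (h (- l)) (f a) = - (wt l \<cdot> (g l * f (a - l)))"
    and psi_eq: "psi n = (if n < 0 then 0 else
        K * fps_nth (sexp (Abs_fps (\<lambda>j. if j = 0 then 0 else kap \<cdot> h (int j)))) (nat n))"
    and phi_eq: "phi n = (if n > d then 0 else
        L * fps_nth (sexp (Abs_fps (\<lambda>j. if j = 0 then 0 else - (kap \<cdot> h (- int j))))) (nat (d - n)))"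
    and e_f_0: "kap \<cdot> comm (e 0) (f n) = psi n - g n * phi n"
    and e_f_up: "d - B \<le> s \<Longrightarrow> s < B \<Longrightarrow> \<exists>k. (\<forall>(k', l') \<in> {(k, s - k), (k + 1, s - k), (k, s - k + 1)}.
        kap \<cdot> comm (e k') (f l') = psi (k' + l') - g l' * phi (k' + l'))"
    and e_f_down: "d - B < s \<Longrightarrow> s \<le> B \<Longrightarrow> \<exists>k. (\<forall>(k', l') \<in> {(k, s - k), (k - 1, s - k), (k, s - k - 1)}.
        kap \<cdot> comm (e k') (f l') = psi (k' + l') - g l' * phi (k' + l'))"
    and e_e: "\<exists>a. e (a + 1) * e a = q \<cdot> (e a * e (a + 1))"
    and f_f: "\<exists>a. f (a + 1) * f a = qi \<cdot> (f a * f (a + 1))"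
    and bounds: "0 \<le> d" "2 \<le> N" "d \<le> N" "N \<le> B" "2 * d + 1 \<le> B"
begin

text \<open>
  The defect of the relation for \<open>[e\<^sub>k, f\<^sub>l]\<close>.
\<close>

definition gap :: "int \<Rightarrow> int \<Rightarrow> 'a" where
  "gap k l = kap \<cdot> comm (e k) (f l) - (psi (k + l) - g l * phi (k + l))"

definition A :: "'a fps" where
  "A = Abs_fps (\<lambda>j. if j = 0 then 0 else kap \<cdot> h (int j))"

lemma A_0 [simp]: "fps_nth A 0 = 0"
  by (simp add: A_def)

lemma A_pos: "j > 0 \<Longrightarrow> fps_nth A j = kap \<cdot> h (int j)"
  by (simp add: A_def)

lemma psi_nonneg: "psi (int n) = K * fps_nth (sexp A) n"
  by (simp add: psi_eq A_def)

lemma psi_neg: "n < 0 \<Longrightarrow> psi n = 0"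
  by (simp add: psi_eq)

lemma phi_high: "n > d \<Longrightarrow> phi n = 0"
  by (simp add: phi_eq)

lemma phi_d: "phi d = L"
  by (simp add: phi_eq)

lemma cancel_K: "K * x = K * y \<Longrightarrow> x = y"
  by (metis K_inv(2) mult.assoc mult_1_left)

lemma cancel_g: "g n * x = g n * y \<Longrightarrow> x = y"
  by (metis add.left_inverse g_0 g_add mult.assoc mult_1_left)

lemma comm_g: "comm x (g n * y) = g n * comm x y"
  by (rule comm_central) (rule g_central)

lemma comm_K: "comm x K = 0 \<Longrightarrow> comm x (K * y) = K * comm x y"
  by (simp add: comm_mult_right)

text \<open>
  The symmetry between positive and negative modes. Inverting \<open>v\<close> changes the sign of
  \<open>v - v\<^bsup>-1\<^esup>\<close>, which compensates the signs that come from exchanging \<open>h\<^sub>1\<close> and \<open>h\<close> with index \<open>-1\<close> and from exchanging \<open>\<psi>\<close> and \<open>\<phi>\<close>;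
  the factors \<open>g\<^sup>k\<close> and \<open>g\<^sup>d\<close> restore the normalisation.
\<close>

lemma flip: "current_seed scale (inverse v) d N B g (\<lambda>k. e (- k)) (\<lambda>k. g k * f (d - k)) (\<lambda>k. h (- k))
    (\<lambda>n. g d * phi (d - n)) (\<lambda>n. psi (d - n)) (g d * L) (g (- d) * Li) K Ki"
proof -
  interpret I: quantum_parameter "inverse v" by (rule inverse_parameter)
  have gi: "g m * (g n * x) = g (m + n) * x" for m n x by (simp add: g_add mult.assoc)
  have gl: "f m * (g n * x) = g n * (f m * x)" "e m * (g n * x) = g n * (e m * x)" "L * (g n * x) = g n * (L * x)"
    for m n x by (metis g_central mult.assoc)+
  have cg: "comm x (g n) = 0" for x n by (simp add: comm_def g_central)
  have cg2: "comm x (g n * y) = g n * comm x y" for x y n by (rule comm_g)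
  have ef: "I.kap \<cdot> comm (e (- k)) (g l * f (d - l)) = g d * phi (d - (k + l)) - g l * psi (d - (k + l))"
    if "kap \<cdot> comm (e k') (f l') = psi (k' + l') - g l' * phi (k' + l')" "k' = - k" "l' = d - l" for k l k' l'
  proof -
    have kl: "l + l' = d" "k' + l' = d - (k + l)" using that(2,3) by simp_all
    have "I.kap \<cdot> comm (e (- k)) (g l * f (d - l)) = - (g l * (kap \<cdot> comm (e k') (f l')))"
      using that(2,3) by (simp add: inverse_simps comm_g scale_mult scale_minus_left)
    also have "\<dots> = g l * (g l' * phi (k' + l')) - g l * psi (k' + l')"
      unfolding that(1) by (simp add: algebra_simps)
    also have "\<dots> = g d * phi (d - (k + l)) - g l * psi (d - (k + l))"
      unfolding gi kl ..
    finally show ?thesis .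
  qed
  have ex: "\<exists>k::int. \<forall>(k', l') \<in> {(k, s - k), (k + c, s - k), (k, s - k + c)}.
        I.kap \<cdot> comm (e (- k')) (g l' * f (d - l')) = g d * phi (d - (k' + l')) - g l' * psi (d - (k' + l'))"
    if asm: "\<exists>k. \<forall>(k', l') \<in> {(k, d - s - k), (k - c, d - s - k), (k, d - s - k - c)}.
        kap \<cdot> comm (e k') (f l') = psi (k' + l') - g l' * phi (k' + l')" for s c
  proof -
    obtain k where "\<forall>(k', l') \<in> {(k, d - s - k), (k - c, d - s - k), (k, d - s - k - c)}.
        kap \<cdot> comm (e k') (f l') = psi (k' + l') - g l' * phi (k' + l')"
      using asm by (elim exE)
    note k0 = this
    have k: "kap \<cdot> comm (e k') (f l') = psi (k' + l') - g l' * phi (k' + l')"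
      if "(k', l') \<in> {(k, d - s - k), (k - c, d - s - k), (k, d - s - k - c)}" for k' l'
      using bspec[OF k0 that] by simp
    have "I.kap \<cdot> comm (e (- k')) (g l' * f (d - l')) = g d * phi (d - (k' + l')) - g l' * psi (d - (k' + l'))"
      if "(k', l') \<in> {(- k, s + k), (- k + c, s + k), (- k, s + k + c)}" for k' l'
      by (rule ef[OF k refl refl]) (use that in auto)
    then have "\<forall>(k', l') \<in> {(- k, s + k), (- k + c, s + k), (- k, s + k + c)}.
        I.kap \<cdot> comm (e (- k')) (g l' * f (d - l')) = g d * phi (d - (k' + l')) - g l' * psi (d - (k' + l'))"
      by blast
    then show ?thesis by (intro exI[of _ "- k"]) (simp only: diff_minus_eq_add)
  qed
  show ?thesis
  proof (unfold_locales, unfold inverse_simps)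
    fix m n i j l s :: int and x :: 'a
    show "g 0 = 1" "g (m + n) = g m * g n" "g n * x = x * g n"
      by (fact g_0 g_add g_central)+
    show "g d * L * (g (- d) * Li) = 1" "g (- d) * Li * (g d * L) = 1"
      by (metis (no_types, opaque_lifting) L_inv add.right_inverse add.left_inverse g_0 g_add g_central mult.assoc mult_1_right)+
    show "K * Ki = 1" "Ki * K = 1" by (fact K_inv)+
    show "g d * L * e (- n) = qi \<cdot> (e (- n) * (g d * L))" "K * e (- n) = q \<cdot> (e (- n) * K)"
      by (simp_all add: gl K_e mult.assoc L_e scale_mult)
    show "g d * L * (g n * f (d - n)) = q \<cdot> (g n * f (d - n) * (g d * L))"
        "K * (g n * f (d - n)) = qi \<cdot> (g n * f (d - n) * K)"
      apply (simp add: gl mult.assoc L_f scale_mult gi add.commute)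
      by (metis (no_types, opaque_lifting) K_f g_central mult.assoc mult_scale_left mult_scale_right)
    show "n \<noteq> 0 \<Longrightarrow> comm (h (- n)) (g d * L) = 0" "n \<noteq> 0 \<Longrightarrow> comm (h (- n)) K = 0"
      by (simp_all add: comm_g L_h K_h)
    show "comm (h (- 1)) (e (- n)) = wt 1 \<cdot> e (- (n + 1))" "comm (h (- (- 1))) (e (- n)) = wt 1 \<cdot> e (- (n - 1))"
      by (simp_all add: hm1_e h1_e)
    show "comm (h (- 1)) (g n * f (d - n)) = - (wt 1 \<cdot> (g (n + 1) * f (d - (n + 1))))"
      by (simp add: comm_g hm1_f scale_mult gi algebra_simps)
    show "comm (h (- (- 1))) (g n * f (d - n)) = - (wt 1 \<cdot> (g 1 * (g (n - 1) * f (d - (n - 1)))))"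
      by (simp add: comm_g h1_f scale_mult gi algebra_simps)
    show "comm (h (- 1)) (h (- (- 1))) = (wt 1 / - kap) \<cdot> (g 1 - 1)"
      by (subst comm_swap) (simp add: h1_hm1)
    show "1 \<le> i \<Longrightarrow> i \<le> N \<Longrightarrow> 1 \<le> j \<Longrightarrow> j \<le> N \<Longrightarrow> comm (h (- i)) (h (- j)) = 0"
      "1 \<le> i \<Longrightarrow> i \<le> N \<Longrightarrow> 1 \<le> j \<Longrightarrow> j \<le> N \<Longrightarrow> comm (h (- (- i))) (h (- (- j))) = 0"
      by (simp_all add: h_h_pos h_h_neg)
    show "\<exists>a. comm (h (- l)) (e (- a)) = wt l \<cdot> e (- (a + l))" if l: "1 \<le> l" "l \<le> N"
    proof -
      obtain a where "comm (h (- l)) (e a) = wt l \<cdot> e (a - l)" using h_e_neg[OF l] by blast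
      then show ?thesis by (intro exI[of _ "- a"]) simp
    qed
    show "\<exists>a. comm (h (- (- l))) (e (- a)) = wt l \<cdot> e (- (a - l))" if l: "1 \<le> l" "l \<le> N"
    proof -
      obtain a where "comm (h l) (e a) = wt l \<cdot> e (a + l)" using h_e_pos[OF l] by blast
      then show ?thesis by (intro exI[of _ "- a"]) (simp add: add.commute)
    qed
    show "\<exists>a. comm (h (- l)) (g a * f (d - a)) = - (wt l \<cdot> (g (a + l) * f (d - (a + l))))" if l: "1 \<le> l" "l \<le> N"
    proof -
      obtain a where "comm (h (- l)) (f a) = - (wt l \<cdot> (g l * f (a - l)))" using h_f_neg[OF l] by blast
      then show ?thesis by (intro exI[of _ "d - a"]) (simp add: comm_g scale_mult gi)
    qed
    show "\<exists>a. comm (h (- (- l))) (g a * f (d - a)) = - (wt l \<cdot> (g l * (g (a - l) * f (d - (a - l)))))" if l: "1 \<le> l" "l \<le> N"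
    proof -
      obtain a where "comm (h l) (f a) = - (wt l \<cdot> f (a + l))" using h_f_pos[OF l] by blast
      then show ?thesis by (intro exI[of _ "d - a"]) (simp add: comm_g scale_mult gi)
    qed
    show "g d * phi (d - n) = (if n < 0 then 0 else
        g d * L * fps_nth (sexp (Abs_fps (\<lambda>j. if j = 0 then 0 else (- kap) \<cdot> h (- int j)))) (nat n))"
      by (simp add: phi_eq mult.assoc scale_minus_left cong: if_cong)
    show "psi (d - n) = (if n > d then 0 else
        K * fps_nth (sexp (Abs_fps (\<lambda>j. if j = 0 then 0 else - ((- kap) \<cdot> h (- (- int j)))))) (nat (d - n)))"
      by (simp add: psi_eq scale_minus_left cong: if_cong)
    show "(- kap) \<cdot> comm (e (- 0)) (g n * f (d - n)) = g d * phi (d - n) - g n * psi (d - n)"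
      using ef[of 0 "d - n" 0 n] e_f_0[of "d - n"] by (simp add: inverse_simps)
    show "\<exists>k. \<forall>(k', l') \<in> {(k, s - k), (k + 1, s - k), (k, s - k + 1)}.
        (- kap) \<cdot> comm (e (- k')) (g l' * f (d - l')) = g d * phi (d - (k' + l')) - g l' * psi (d - (k' + l'))"
      if "d - B \<le> s" "s < B"
      using ex[OF e_f_down[of "d - s"]] that unfolding inverse_simps by simp
    show "\<exists>k. \<forall>(k', l') \<in> {(k, s - k), (k - 1, s - k), (k, s - k - 1)}.
        (- kap) \<cdot> comm (e (- k')) (g l' * f (d - l')) = g d * phi (d - (k' + l')) - g l' * psi (d - (k' + l'))"
      if "d - B < s" "s \<le> B"
    proof -
      have "\<exists>k. \<forall>(k', l') \<in> {(k, d - s - k), (k - (- 1), d - s - k), (k, d - s - k - (- 1))}.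
        kap \<cdot> comm (e k') (f l') = psi (k' + l') - g l' * phi (k' + l')"
        using e_f_up[of "d - s"] that by simp
      from ex[OF this] show ?thesis unfolding inverse_simps by simp
    qed
    show "\<exists>a. e (- (a + 1)) * e (- a) = qi \<cdot> (e (- a) * e (- (a + 1)))"
    proof -
      obtain a where "e (a + 1) * e a = q \<cdot> (e a * e (a + 1))" using e_e by blast
      then show ?thesis by (intro exI[of _ "- a - 1"]) (simp add: qqi add.commute[of 1])
    qed
    show "\<exists>a. g (a + 1) * f (d - (a + 1)) * (g a * f (d - a)) = q \<cdot> (g a * f (d - a) * (g (a + 1) * f (d - (a + 1))))"
    proof -
      obtain a where "f (a + 1) * f a = qi \<cdot> (f a * f (a + 1))" using f_f by blast
      then show ?thesis
        by (intro exI[of _ "d - a - 1"]) (simp add: qqi gl mult.assoc gi scale_mult add.commute[of 1])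
    qed
    show "0 \<le> d" "2 \<le> N" "d \<le> N" "N \<le> B" "2 * d + 1 \<le> B" by (fact bounds)+
  qed
qed

end

context current_seed
begin

declare comm_minus_left [simp] comm_minus_right [simp]

subsection \<open>The middle diagonals\<close>

definition X :: "int \<Rightarrow> int \<Rightarrow> 'a" where
  "X k l = kap \<cdot> comm (e k) (f l)"

lemma gap_X: "gap k l = X k l - (psi (k + l) - g l * phi (k + l))"
  by (simp add: gap_def X_def)

lemma X_good: "gap k l = 0 \<Longrightarrow> X k l = psi (k + l) - g l * phi (k + l)"
  by (simp add: gap_X)

lemma gap_0: "gap 0 n = 0"
  using e_f_0[of n] by (simp add: gap_def)

lemma comm_X:
  assumes "comm y (e k) = r \<cdot> e k'" "comm y (f l) = - (r \<cdot> (z * f l'))" and z: "\<And>x. z * x = x * z"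
  shows "comm y (X k l) = r \<cdot> (X k' l - z * X k l')"
proof -
  have "comm y (X k l) = kap \<cdot> (comm (r \<cdot> e k') (f l) + comm (e k) (- (r \<cdot> (z * f l'))))"
    by (simp add: X_def comm_jacobi[of y] assms(1,2))
  then show ?thesis
    by (simp add: X_def comm_minus_right comm_central[OF z] scale_mult scale_right_distrib scale_right_diff_distrib mult.commute)
qed

lemma comm_h1_X: "comm (h 1) (X k l) = wt 1 \<cdot> (X (k + 1) l - X k (l + 1))"
  using comm_X[of "h 1" k "wt 1" "k + 1" l 1 "l + 1"] by (simp add: h1_e h1_f)

lemma comm_hm1_X: "comm (h (-1)) (X k l) = wt 1 \<cdot> (X (k - 1) l - g 1 * X k (l - 1))"
  by (rule comm_X[OF hm1_e hm1_f g_central])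

lemma comm_psi_0:
  assumes "i \<noteq> 0" "\<And>j. 1 \<le> j \<Longrightarrow> j \<le> n \<Longrightarrow> comm (h i) (h j) = 0"
  shows "comm (h i) (psi n) = 0"
proof (cases "n < 0")
  case False
  have "comm (h i) (fps_nth (sexp A) (nat n)) = 0"
    by (rule comm_sexp) (use assms(2) in \<open>auto simp: A_def\<close>)
  then show ?thesis
    using psi_nonneg[of "nat n"] K_h[OF assms(1)] False by (simp add: comm_K)
qed (simp add: psi_neg)

lemma comm_psi_top:
  assumes "i \<noteq> 0" "n \<ge> 1" "\<And>j. 1 \<le> j \<Longrightarrow> j < n \<Longrightarrow> comm (h i) (h j) = 0"
  shows "comm (h i) (psi n) = kap \<cdot> (K * comm (h i) (h n))"
proof -
  have "comm (h i) (fps_nth (sexp A) (nat n)) = comm (h i) (fps_nth A (nat n))"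
    by (rule comm_sexp_top) (use assms in \<open>auto simp: A_def\<close>)
  then show ?thesis
    using psi_nonneg[of "nat n"] K_h[OF assms(1)] assms(2) by (simp add: comm_K A_pos scale_mult)
qed

text \<open>
  Applying \<open>[h\<^sub>1, \<cdot>]\<close> to the relation at the three points given by \<open>e_f_up\<close> yields one equation
  between \<open>[h\<^sub>1, \<psi>\<^sub>s]\<close>, \<open>[h\<^sub>1, \<phi>\<^sub>s]\<close> and \<open>\<phi>\<^bsub>s+1\<^esub>\<close>. For \<open>s \<le> N\<close> the first of them vanishes because \<open>\<psi>\<^sub>s\<close> is a polynomial in commuting
  elements, for \<open>s > N \<ge> d\<close> the other two do; in both cases the rest is determined.
\<close>

lemma h1_phi_psi:
  assumes "d - B \<le> s" "s < B"
  shows "comm (h 1) (psi s) = 0" "comm (h 1) (phi s) = - (wt 1 \<cdot> ((g 1 - 1) * phi (s + 1)))"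
proof -
  obtain k where "\<forall>(k', l') \<in> {(k, s - k), (k + 1, s - k), (k, s - k + 1)}.
        kap \<cdot> comm (e k') (f l') = psi (k' + l') - g l' * phi (k' + l')"
    using e_f_up[OF assms] by (elim exE)
  then have X: "X k (s - k) = psi s - g (s - k) * phi s"
    "X (k + 1) (s - k) = psi (s + 1) - g (s - k) * phi (s + 1)"
    "X k (s - k + 1) = psi (s + 1) - g (s - k + 1) * phi (s + 1)"
    by (simp_all add: X_def add.commute[of 1])
  have eq: "comm (h 1) (psi s) = g (s - k) * (comm (h 1) (phi s) + wt 1 \<cdot> ((g 1 - 1) * phi (s + 1)))"
    using comm_h1_X[of k "s - k"] unfolding X g_add[of "s - k" 1]
    by (simp add: comm_diff_right comm_g scale_mult algebra_simps)
  show psi: "comm (h 1) (psi s) = 0"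
  proof (cases "s \<le> N")
    case True
    show ?thesis by (rule comm_psi_0) (use True bounds h_h_pos in auto)
  next
    case False
    then show ?thesis using eq bounds by (simp add: phi_high)
  qed
  have "comm (h 1) (phi s) + wt 1 \<cdot> ((g 1 - 1) * phi (s + 1)) = 0"
    by (rule cancel_g[of "s - k"]) (use eq psi in simp)
  then show "comm (h 1) (phi s) = - (wt 1 \<cdot> ((g 1 - 1) * phi (s + 1)))"
    by (simp add: add_eq_0_iff2)
qed

lemma hm1_phi_psi:
  assumes "d - B < s" "s \<le> B"
  shows "comm (h (-1)) (phi s) = 0" "comm (h (-1)) (psi s) = - (wt 1 \<cdot> ((g 1 - 1) * psi (s - 1)))"
proof -
  interpret F: current_seed scale "inverse v" d N B g "\<lambda>k. e (- k)" "\<lambda>k. g k * f (d - k)" "\<lambda>k. h (- k)"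
    "\<lambda>n. g d * phi (d - n)" "\<lambda>n. psi (d - n)" "g d * L" "g (- d) * Li" K Ki by (rule flip)
  have "g d * comm (h (-1)) (phi s) = 0"
    using F.h1_phi_psi(1)[of "d - s"] assms by (simp add: comm_g)
  then show "comm (h (-1)) (phi s) = 0" using cancel_g[of d _ 0] by simp
  show "comm (h (-1)) (psi s) = - (wt 1 \<cdot> ((g 1 - 1) * psi (s - 1)))"
    using F.h1_phi_psi(2)[of "d - s"] assms by (simp add: inverse_simps diff_diff_eq2)
qed

text \<open>
  The right-hand side of the relation obeys the same shift rule as \<open>X\<close>, hence so does the defect.
\<close>

lemma gap_step_up:
  assumes "d - B \<le> k + l" "k + l < B" "gap k l = 0"
  shows "gap (k + 1) l = gap k (l + 1)"
proof -
  have "wt 1 \<cdot> (X (k + 1) l - X k (l + 1)) = comm (h 1) (psi (k + l) - g l * phi (k + l))"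
    using comm_h1_X[of k l] X_good[OF assms(3)] by simp
  also have "\<dots> = wt 1 \<cdot> (g l * ((g 1 - 1) * phi (k + l + 1)))"
    using h1_phi_psi[OF assms(1,2)] by (simp add: comm_diff_right comm_g scale_mult)
  finally have "X (k + 1) l - X k (l + 1) = g l * ((g 1 - 1) * phi (k + l + 1))"
    using wt_nz[of 1] by (simp only: scale_cancel_left) simp
  then show ?thesis unfolding gap_X g_add[of l 1] by (simp add: algebra_simps)
qed

lemma gap_step_down:
  assumes "d - B < k + l" "k + l \<le> B" "gap k l = 0"
  shows "gap (k - 1) l = g 1 * gap k (l - 1)"
proof -
  have "wt 1 \<cdot> (X (k - 1) l - g 1 * X k (l - 1)) = comm (h (-1)) (psi (k + l) - g l * phi (k + l))"
    using comm_hm1_X[of k l] X_good[OF assms(3)] by simp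
  also have "\<dots> = wt 1 \<cdot> (- ((g 1 - 1) * psi (k + l - 1)))"
    using hm1_phi_psi[OF assms(1,2)] by (simp add: comm_diff_right comm_g scale_mult)
  finally have 1: "X (k - 1) l - g 1 * X k (l - 1) = - ((g 1 - 1) * psi (k + l - 1))"
    using wt_nz[of 1] by (simp only: scale_cancel_left) simp
  have "g l = g 1 * g (l - 1)" by (simp flip: g_add)
  with 1 show ?thesis by (simp add: gap_X algebra_simps)
qed

text \<open>
  On two adjacent diagonals the defect vanishes at \<open>k = 0\<close>; the two shift rules alternate between the
  diagonals and move this zero along both of them.
\<close>

lemma gap_pair:
  assumes s: "d - B \<le> s" "s + 1 \<le> B"
  shows "gap k (s - k) = 0 \<and> gap k (s + 1 - k) = 0"
proof (induction k rule: int_induct[where k = 0])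
  case base
  then show ?case by (simp add: gap_0)
next
  case (step1 k)
  have 1: "gap (k + 1) (s - k) = 0"
    using gap_step_up[of k "s - k"] step1 s by (simp add: algebra_simps)
  have "g 1 * gap (k + 1) (s - k - 1) = 0"
    using gap_step_down[of "k + 1" "s - k"] step1 s 1 by simp
  then have "gap (k + 1) (s - k - 1) = 0" using cancel_g[of 1 _ 0] by simp
  with 1 show ?case by (simp add: algebra_simps)
next
  case (step2 k)
  have 1: "gap (k - 1) (s + 1 - k) = 0"
    using gap_step_down[of k "s + 1 - k"] step2 s by simp
  have "gap (k - 1) (s + 1 - k + 1) = 0"
    using gap_step_up[of "k - 1" "s + 1 - k"] step2 s 1 by simp
  with 1 show ?case by (simp add: algebra_simps)
qed

lemma gap_middle:
  assumes "d - B \<le> k + l" "k + l \<le> B"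
  shows "gap k l = 0"
proof (cases "k + l < B")
  case True
  then show ?thesis using gap_pair[of "k + l" k] assms by simp
next
  case False
  with assms have "l = B - k" by simp
  then show ?thesis using gap_pair[of "B - 1" k] bounds by simp
qed

lemma g_scaled_central: "(r \<cdot> (g n - 1)) * y = y * (r \<cdot> (g n - 1))"
  using g_central[of n y] by (simp add: scale_mult algebra_simps)

text \<open>
  Taking logarithms: a derivation that multiplies \<open>\<psi>(u)\<close> by a central \<open>z u\<^sup>l\<close> sends \<open>h\<^sub>l\<close> to a multiple of \<open>z\<close> and kills
  the other \<open>h\<^sub>n\<close>.
\<close>

lemma psi_derivation:
  assumes K: "comm x K = 0" and z: "\<And>y. z * y = y * z" and l: "l > 0"
    and D: "\<And>n. 0 < n \<Longrightarrow> n \<le> M \<Longrightarrow> comm x (psi (int n)) = z * psi (int n - int l)"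
  shows "0 < n \<Longrightarrow> n \<le> M \<Longrightarrow> kap \<cdot> comm x (h (int n)) = (if n = l then z else 0)"
proof (induction n rule: less_induct)
  case (less n)
  let ?P = "fps_nth (sexp A)"
  have DA: "comm x (fps_nth A j) = (if j = l then z else 0)" if "j < n" for j
    using less that l by (cases "j = 0") (auto simp: A_pos)
  have "K * comm x (?P n) = K * (if l \<le> n then z * ?P (n - l) else 0)"
  proof (cases "l \<le> n")
    case True
    then have "psi (int n - int l) = K * ?P (n - l)"
      using psi_nonneg[of "n - l"] by (simp add: of_nat_diff)
    moreover have "z * (K * y) = K * (z * y)" for y using z[of K] by (simp flip: mult.assoc)
    ultimately show ?thesis using D[OF less.prems] True K by (simp add: psi_nonneg comm_K)
  next
    case False
    then show ?thesis using D[OF less.prems] K by (simp add: psi_nonneg comm_K psi_neg)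
  qed
  then have "comm x (?P n) = (if l \<le> n then z * ?P (n - l) else 0)" by (rule cancel_K)
  moreover have "comm x (?P n) = (if l \<le> n then z * ?P (n - l) else 0) + (comm x (fps_nth A n) - (if n = l then z else 0))"
    by (rule comm_sexp_derivation[OF A_0 l DA]) (use z less.prems in \<open>auto simp: comm_def\<close>)
  ultimately show ?case using less.prems by (simp add: A_pos)
qed

lemma hm1_h_pos:
  assumes "2 \<le> i" "i \<le> N" shows "comm (h (-1)) (h i) = 0"
proof -
  have "kap \<cdot> comm (h (-1)) (h (int (nat i))) = (if nat i = 1 then - wt 1 \<cdot> (g 1 - 1) else 0)"
  proof (rule psi_derivation[where M = "nat N"])
    show "comm (h (-1)) (psi (int n)) = (- wt 1 \<cdot> (g 1 - 1)) * psi (int n - int 1)" if "0 < n" "n \<le> nat N" for n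
      using hm1_phi_psi(2)[of "int n"] that bounds by (simp add: scale_mult)
    show "(- wt 1 \<cdot> (g 1 - 1)) * y = y * (- wt 1 \<cdot> (g 1 - 1))" for y by (rule g_scaled_central)
  qed (use assms K_h in auto)
  moreover have "nat i \<noteq> 1" using assms by simp
  ultimately show ?thesis using assms kap_nz by simp
qed

lemma shift_e: "comm ((1 / wt 1) \<cdot> h 1) (e k) = e (k + 1)" "comm ((1 / wt 1) \<cdot> h (-1)) (e k) = e (k - 1)"
  using wt_nz[of 1] by (simp_all add: h1_e hm1_e)

lemma shift_f: "comm ((- (1 / wt 1)) \<cdot> h 1) (f k) = f (k + 1)"
  "comm ((- (1 / wt 1)) \<cdot> (g (-1) * h (-1))) (f k) = f (k - 1)"
proof -
  have "comm (g (-1) * h (-1)) (f k) = g (-1) * comm (h (-1)) (f k)"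
    by (metis comm_g comm_swap mult_minus_right)
  moreover have "g (-1) * (g 1 * x) = x" for x by (simp add: g_0 flip: mult.assoc g_add)
  ultimately show "comm ((- (1 / wt 1)) \<cdot> (g (-1) * h (-1))) (f k) = f (k - 1)"
    using wt_nz[of 1] by (simp add: hm1_f scale_mult)
  show "comm ((- (1 / wt 1)) \<cdot> h 1) (f k) = f (k + 1)"
    using wt_nz[of 1] by (simp add: h1_f)
qed

lemma h_e_f_upto_N:
  assumes l: "1 \<le> l" "l \<le> N"
  shows "comm (h l) (e k) = wt l \<cdot> e (k + l)" "comm (h l) (f k) = - (wt l \<cdot> f (k + l))"
proof -
  have "comm (h l) (e k) = wt l \<cdot> e (k + l) \<and> comm (h l) (f k) = - (wt l \<cdot> f (k + l))"
  proof (cases "l = 1")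
    case True
    then show ?thesis by (simp add: h1_e h1_f)
  next
    case False
    with l have c: "comm (h l) (h 1) = 0" "comm (h l) (h (-1)) = 0"
      using h_h_pos[of l 1] hm1_h_pos[of l] comm_swap[of "h l" "h (-1)"] bounds by auto
    obtain a where a: "comm (h l) (e a) = wt l \<cdot> e (a + l)" using h_e_pos[OF l] by blast
    obtain b where b: "comm (h l) (f b) = - (wt l \<cdot> f (b + l))" using h_f_pos[OF l] by blast
    have "comm (h l) (e k) = (wt l \<cdot> 1) * e (k + l)"
      by (rule shift_extend[OF shift_e]) (use a c in \<open>simp_all add: scale_mult\<close>)
    moreover have "comm (h l) (f k) = (- wt l \<cdot> 1) * f (k + l)"
      by (rule shift_extend[OF shift_f]) (use b c in \<open>simp_all add: scale_mult comm_g\<close>)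
    ultimately show ?thesis by (simp add: scale_mult)
  qed
  then show "comm (h l) (e k) = wt l \<cdot> e (k + l)" "comm (h l) (f k) = - (wt l \<cdot> f (k + l))" by auto
qed

lemma h_e_f_neg_upto_N:
  assumes l: "1 \<le> l" "l \<le> N"
  shows "comm (h (- l)) (e k) = wt l \<cdot> e (k - l)" "comm (h (- l)) (f k) = - (wt l \<cdot> (g l * f (k - l)))"
proof -
  interpret F: current_seed scale "inverse v" d N B g "\<lambda>k. e (- k)" "\<lambda>k. g k * f (d - k)" "\<lambda>k. h (- k)"
    "\<lambda>n. g d * phi (d - n)" "\<lambda>n. psi (d - n)" "g d * L" "g (- d) * Li" K Ki by (rule flip)
  show "comm (h (- l)) (e k) = wt l \<cdot> e (k - l)"
    using F.h_e_f_upto_N(1)[OF l, of "- k"] by (simp add: inverse_simps)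
  have "g (d - k) * comm (h (- l)) (f k) = g (d - k) * - (wt l \<cdot> (g l * f (k - l)))"
  proof -
    have "g (d - k + l) = g (d - k) * g l" by (rule g_add)
    then show ?thesis
      using F.h_e_f_upto_N(2)[OF l, of "d - k"] by (simp add: inverse_simps comm_g scale_mult mult.assoc diff_diff_eq2)
  qed
  then show "comm (h (- l)) (f k) = - (wt l \<cdot> (g l * f (k - l)))" by (rule cancel_g)
qed

lemma quad_e: "quad q e k l = 0"
proof -
  obtain a where a: "e (a + 1) * e a = q \<cdot> (e a * e (a + 1))" using e_e by blast
  show ?thesis
  proof (rule quad_all[OF shift_e _ _ a])
    show "comm ((1 / wt 2) \<cdot> h 2) (e k) = e (k + 2)" "comm ((1 / wt 2) \<cdot> h (- 2)) (e k) = e (k - 2)" for k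
      using wt_nz[of 2] h_e_f_upto_N[of 2 k] h_e_f_neg_upto_N[of 2 k] bounds by simp_all
  qed
qed

lemma quad_f: "quad qi f k l = 0"
proof -
  obtain a where a: "f (a + 1) * f a = qi \<cdot> (f a * f (a + 1))" using f_f by blast
  show ?thesis
  proof (rule quad_all[OF shift_f _ _ a])
    show "comm ((- (1 / wt 2)) \<cdot> h 2) (f k) = f (k + 2)" for k
      using wt_nz[of 2] h_e_f_upto_N[of 2 k] bounds by simp
    have "comm (g (-2) * h (-2)) (f k) = g (-2) * comm (h (-2)) (f k)" for k
      by (metis comm_g comm_swap mult_minus_right)
    moreover have "g (-2) * (g 2 * x) = x" for x by (simp add: g_0 flip: mult.assoc g_add)
    ultimately show "comm ((- (1 / wt 2)) \<cdot> (g (-2) * h (-2))) (f k) = f (k - 2)" for k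
      using wt_nz[of 2] h_e_f_neg_upto_N[of 2 k] bounds by (simp add: scale_mult)
  qed
qed

end

context current_seed
begin

subsection \<open>Induction over the diagonals\<close>

lemma X_high: "gap k l = 0 \<Longrightarrow> d < k + l \<Longrightarrow> X k l = psi (k + l)"
  by (simp add: X_good phi_high)

text \<open>
  The relation \<open>rel\<close> is the exchange relation of \<open>\<psi>\<close> and \<open>x\<close> in degree \<open>n\<close>; after division by \<open>K\<close> it is the left-hand side of
  \<open>sexp_exchange\<close>.
\<close>

lemma exchange_comm:
  fixes x :: "int \<Rightarrow> 'a"
  assumes r: "r * ri = 1" and n: "n > 0"
    and hh: "\<And>i j. 1 \<le> i \<Longrightarrow> 1 \<le> j \<Longrightarrow> i + j \<le> int n \<Longrightarrow> comm (h i) (h j) = 0"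
    and act: "\<And>j k. 0 < j \<Longrightarrow> j < n \<Longrightarrow> comm (fps_nth A j) (x k) = ((r ^ j - ri ^ j) / of_nat j) \<cdot> x (k + int j)"
    and xK: "\<And>k. x k * K = ri \<cdot> (K * x k)"
    and rel: "psi (int n) * x k + x (k + 1) * psi (int n - 1) = r \<cdot> (psi (int n - 1) * x (k + 1) + x k * psi (int n))"
  shows "comm (fps_nth A n) (x k) = ((r ^ n - ri ^ n) / of_nat n) \<cdot> x (k + int n)"
proof -
  let ?P = "fps_nth (sexp A)"
  have psi: "psi (int n) = K * ?P n" "psi (int n - 1) = K * ?P (n - 1)"
    using psi_nonneg[of n] psi_nonneg[of "n - 1"] n by (simp_all add: of_nat_diff)
  have xKy: "x k * (K * y) = ri \<cdot> (K * (x k * y))" for k y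
    by (simp add: xK scale_mult flip: mult.assoc)
  have "K * (?P n * x k + ri \<cdot> (x (k + 1) * ?P (n - 1))) = K * (r \<cdot> (?P (n - 1) * x (k + 1)) + x k * ?P n)"
    using rel unfolding psi by (simp add: xKy mult.assoc scale_mult distrib_left scale_right_distrib r)
  then have "?P n * x k + ri \<cdot> (x (k + 1) * ?P (n - 1)) = r \<cdot> (?P (n - 1) * x (k + 1)) + x k * ?P n"
    by (rule cancel_K)
  then have "?P n * x k - x k * ?P n - r \<cdot> (?P (n - 1) * x (k + 1)) + ri \<cdot> (x (k + 1) * ?P (n - 1)) = 0"
    by (simp add: algebra_simps)
  moreover have "?P n * x k - x k * ?P n - r \<cdot> (?P (n - 1) * x (k + 1)) + ri \<cdot> (x (k + 1) * ?P (n - 1))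
      = comm (fps_nth A n) (x k) - ((r ^ n - ri ^ n) / of_nat n) \<cdot> x (k + int n)"
  proof (rule sexp_exchange[OF _ A_0 n act])
    show "comm (fps_nth A i) (fps_nth A j) = 0" if "i + j \<le> n" for i j
      using hh[of "int i" "int j"] that by (auto simp: A_def)
  qed auto
  ultimately show ?thesis by simp
qed

lemma e_K: "e k * K = qi \<cdot> (K * e k)"
  by (simp add: K_e qqi)

lemma f_K: "f k * K = q \<cdot> (K * f k)"
  by (simp add: K_f qqi)

text \<open>
  The commutator of \<open>f\<^sub>l\<close> with the quadratic relation at \<open>k = l\<close>.
\<close>

lemma quad_e_f:
  "X (k + 1) l * e k + e (k + 1) * X k l = q \<cdot> (X k l * e (k + 1) + e k * X (k + 1) l)"
proof -
  have X: "X k l = - (kap \<cdot> comm (f l) (e k))" for k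
    unfolding X_def by (subst comm_swap) simp
  have "comm (f l) (e (k + 1) * e k) = comm (f l) (q \<cdot> (e k * e (k + 1)))"
    using quad_diag[OF quad_e] by simp
  then have "comm (f l) (e (k + 1)) * e k + e (k + 1) * comm (f l) (e k) =
      q \<cdot> (comm (f l) (e k) * e (k + 1) + e k * comm (f l) (e (k + 1)))"
    by (simp add: comm_mult_right)
  then have "(- kap) \<cdot> (comm (f l) (e (k + 1)) * e k + e (k + 1) * comm (f l) (e k)) =
      (- kap) \<cdot> q \<cdot> (comm (f l) (e k) * e (k + 1) + e k * comm (f l) (e (k + 1)))"
    by (simp only:)
  then show ?thesis unfolding X by (simp add: scale_mult scale_right_distrib scale_right_diff_distrib mult.commute[of kap])
qed

lemma quad_f_e:
  "X l (k + 1) * f k + f (k + 1) * X l k = qi \<cdot> (X l k * f (k + 1) + f k * X l (k + 1))"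
proof -
  have "comm (e l) (f (k + 1) * f k) = comm (e l) (qi \<cdot> (f k * f (k + 1)))"
    using quad_diag[OF quad_f] by simp
  then have "comm (e l) (f (k + 1)) * f k + f (k + 1) * comm (e l) (f k) =
      qi \<cdot> (comm (e l) (f k) * f (k + 1) + f k * comm (e l) (f (k + 1)))"
    by (simp add: comm_mult_right)
  then have "kap \<cdot> (comm (e l) (f (k + 1)) * f k + f (k + 1) * comm (e l) (f k)) =
      kap \<cdot> qi \<cdot> (comm (e l) (f k) * f (k + 1) + f k * comm (e l) (f (k + 1)))"
    by (simp only:)
  then show ?thesis unfolding X_def by (simp add: scale_mult scale_right_distrib scale_right_diff_distrib mult.commute[of kap])
qed

text \<open>
  On the diagonals in question only \<open>\<phi>\<^sub>d = L\<close> can occur besides \<open>\<psi>\<close>, and its contribution cancels because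
  \<open>L\<close> commutes with \<open>e\<close> up to the factor \<open>v\<^bsup>-2\<^esup>\<close>.
\<close>

lemma psi_e:
  assumes "d \<le> m" "gap k (m - k) = 0" "gap (k + 1) (m - k) = 0"
  shows "psi (m + 1) * e k + e (k + 1) * psi m = q \<cdot> (psi m * e (k + 1) + e k * psi (m + 1))"
proof -
  have X: "X (k + 1) (m - k) = psi (m + 1)" "X k (m - k) = psi m - g (m - k) * phi m"
    using X_high[OF assms(3)] X_good[OF assms(2)] assms(1) by (simp_all add: add.commute[of 1])
  have 1: "e (k + 1) * phi m = q \<cdot> (phi m * e (k + 1))"
    using assms(1) by (cases "m = d") (simp_all add: phi_d phi_high L_e qqi)
  have 2: "e (k + 1) * (g (m - k) * phi m) = q \<cdot> (g (m - k) * phi m * e (k + 1))"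
  proof -
    have "e (k + 1) * (g (m - k) * phi m) = g (m - k) * (e (k + 1) * phi m)"
      by (metis g_central mult.assoc)
    then show ?thesis unfolding 1 by (simp add: scale_mult mult.assoc)
  qed
  show ?thesis
    using quad_e_f[of k "m - k"] unfolding X left_diff_distrib right_diff_distrib 2
    by (simp add: scale_right_distrib scale_right_diff_distrib)
qed

lemma psi_f:
  assumes "d \<le> m" "gap (m - k) k = 0" "gap (m - k) (k + 1) = 0"
  shows "psi (m + 1) * f k + f (k + 1) * psi m = qi \<cdot> (psi m * f (k + 1) + f k * psi (m + 1))"
proof -
  have X: "X (m - k) (k + 1) = psi (m + 1)" "X (m - k) k = psi m - g k * phi m"
    using X_high[OF assms(3)] X_good[OF assms(2)] assms(1) by (simp_all add: add.commute[of 1])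
  have 1: "f (k + 1) * phi m = qi \<cdot> (phi m * f (k + 1))"
    using assms(1) by (cases "m = d") (simp_all add: phi_d phi_high L_f qqi)
  have 2: "f (k + 1) * (g k * phi m) = qi \<cdot> (g k * phi m * f (k + 1))"
  proof -
    have "f (k + 1) * (g k * phi m) = g k * (f (k + 1) * phi m)"
      by (metis g_central mult.assoc)
    then show ?thesis unfolding 1 by (simp add: scale_mult mult.assoc)
  qed
  show ?thesis
    using quad_f_e[of "m - k" k] unfolding X left_diff_distrib right_diff_distrib 2
    by (simp add: scale_right_distrib scale_right_diff_distrib)
qed

text \<open>
  The hypothesis of the induction over the diagonals.
\<close>

definition holds_upto :: "int \<Rightarrow> bool" where
  "holds_upto m \<longleftrightarrow> (\<forall>k l. 0 \<le> k + l \<longrightarrow> k + l \<le> m \<longrightarrow> gap k l = 0)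
    \<and> (\<forall>i j. 1 \<le> i \<longrightarrow> 1 \<le> j \<longrightarrow> i + j \<le> m \<longrightarrow> comm (h i) (h j) = 0)
    \<and> (\<forall>i k. 1 \<le> i \<longrightarrow> i \<le> m \<longrightarrow> comm (h i) (e k) = wt i \<cdot> e (k + i) \<and> comm (h i) (f k) = - (wt i \<cdot> f (k + i)))"

lemma holds_uptoD:
  assumes "holds_upto m"
  shows "0 \<le> k + l \<Longrightarrow> k + l \<le> m \<Longrightarrow> gap k l = 0"
    and "1 \<le> i \<Longrightarrow> 1 \<le> j \<Longrightarrow> i + j \<le> m \<Longrightarrow> comm (h i) (h j) = 0"
    and "1 \<le> i \<Longrightarrow> i \<le> m \<Longrightarrow> comm (h i) (e k) = wt i \<cdot> e (k + i)"
    and "1 \<le> i \<Longrightarrow> i \<le> m \<Longrightarrow> comm (h i) (f k) = - (wt i \<cdot> f (k + i))"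
  using assms by (auto simp: holds_upto_def)

lemma comm_h_X_upto:
  assumes "holds_upto m" "1 \<le> i" "i \<le> m"
  shows "comm (h i) (X k l) = wt i \<cdot> (X (k + i) l - X k (l + i))"
  using comm_X[of "h i" k "wt i" "k + i" l 1 "l + i"] holds_uptoD(3,4)[OF assms] by simp

lemma comm_psi_top_upto:
  assumes "holds_upto m" "1 \<le> i" "1 \<le> j" "i + j = m + 1"
  shows "comm (h i) (psi j) = kap \<cdot> (K * comm (h i) (h j))"
  by (rule comm_psi_top) (use assms holds_uptoD(2)[OF assms(1)] in auto)

text \<open>
  The progress beyond the diagonals that are covered by the assumptions. On the diagonal \<open>m + 1\<close> the
  values \<open>x\<^sub>k\<close> of \<open>X\<close> form an arithmetic progression, since \<open>[h\<^sub>1, \<psi>\<^sub>m]\<close> can be computed from \<open>\<psi>\<^sub>m = X\<close> at every point of the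
  diagonal \<open>m\<close>. Computing \<open>[h\<^sub>i, \<psi>\<^sub>j]\<close> and \<open>[h\<^sub>j, \<psi>\<^sub>i]\<close> for \<open>i + j = m + 1\<close> in the same way gives
  \<open>[2i] \<delta>\<close> and \<open>[2j] \<delta>\<close>, while both equal \<open>[h\<^sub>i, h\<^sub>j]\<close> up to sign and a common unit.
\<close>

lemma next_gap:
  assumes S: "holds_upto m" and m: "B \<le> m" and kl: "k + l = m + 1"
  shows "gap k l = 0"
proof -
  define x where "x = (\<lambda>k. X k (m + 1 - k))"
  define \<delta> where "\<delta> = x 1 - x 0"
  have h_psi: "comm (h i) (psi j) = wt i \<cdot> (x (k + i) - x k)" if "1 \<le> i" "i \<le> m" "d < j" "i + j = m + 1" for i j k
  proof -
    have "gap k (j - k) = 0" by (rule holds_uptoD(1)[OF S]) (use that bounds in auto)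
    then have "psi j = X k (j - k)" using X_high[of k "j - k"] that by simp
    moreover have eqs: "m + 1 - (k + i) = j - k" "m + 1 - k = j - k + i" using that by simp_all
    ultimately show ?thesis
      using comm_h_X_upto[OF S that(1,2), of k "j - k"] unfolding x_def eqs by simp
  qed
  have step: "x (k + 1) - x k = \<delta>" for k
  proof -
    have "wt 1 \<cdot> (x (k + 1) - x k) = wt 1 \<cdot> (x (0 + 1) - x 0)"
      by (rule trans[OF h_psi[of 1 m k, symmetric] h_psi[of 1 m 0]]) (use m bounds in auto)
    then show ?thesis using wt_nz[of 1] unfolding \<delta>_def by (simp only: scale_cancel_left) simp
  qed
  have lin: "x (k + int n) = x k + of_nat n \<cdot> \<delta>" for k n
  proof (induction n)
    case (Suc n)
    have "x (k + int (Suc n)) = x (k + int n) + \<delta>"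
      using step[of "k + int n"] by (simp add: algebra_simps)
    then show ?case by (simp add: Suc scale_left_distrib algebra_simps)
  qed simp
  have h_psi': "comm (h i) (psi j) = qnum v (2 * i) \<cdot> \<delta>" if "1 \<le> i" "i \<le> m" "d < j" "i + j = m + 1" for i j
  proof -
    have "x (0 + i) = x 0 + of_int i \<cdot> \<delta>" using lin[of 0 "nat i"] that by simp
    then show ?thesis using h_psi[OF that, of 0] that by (simp add: wt_def)
  qed
  have hh: "kap \<cdot> (K * comm (h i) (h j)) = qnum v (2 * i) \<cdot> \<delta>" if "1 \<le> i" "1 \<le> j" "d < j" "i + j = m + 1" for i j
    using h_psi'[of i j] comm_psi_top_upto[OF S, of i j] that by simp
  \<comment> \<open>Both indices exceed \<open>d\<close>, so that \<open>\<phi>\<close> does not enter; this needs \<open>m \<ge> 2d + 1\<close>.\<close>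
  define i j where "i = d + 1" and "j = m - d"
  have ij: "1 \<le> i" "1 \<le> j" "d < i" "d < j" "i + j = m + 1" using m bounds by (auto simp: i_def j_def)
  have "qnum v (2 * i) \<cdot> \<delta> + qnum v (2 * j) \<cdot> \<delta> = kap \<cdot> (K * comm (h i) (h j)) + kap \<cdot> (K * comm (h j) (h i))"
    using hh[of i j] hh[of j i] ij by simp
  also have "\<dots> = 0" using comm_swap[of "h j" "h i"] by simp
  finally have "(qnum v (2 * i) + qnum v (2 * j)) \<cdot> \<delta> = 0" by (simp add: scale_left_distrib)
  then have \<delta>0: "\<delta> = 0" using qnum_add_nz[of i j] ij by simp
  have const: "x k = x 0" for k
  proof (cases "k \<ge> 0")
    case True
    then show ?thesis using lin[of 0 "nat k"] \<delta>0 by simp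
  next
    case False
    then show ?thesis using lin[of k "nat (- k)"] \<delta>0 by simp
  qed
  have "x 0 = psi (m + 1)" using X_high[OF gap_0, of "m + 1"] m bounds by (simp add: x_def)
  then have "X k (m + 1 - k) = psi (m + 1)" using const[of k] by (simp add: x_def)
  moreover have "l = m + 1 - k" using kl by simp
  ultimately show ?thesis using m bounds by (simp add: gap_X phi_high)
qed

lemma next_upto:
  assumes S: "holds_upto m" and m: "N \<le> m"
  shows "holds_upto (m + 1)"
proof -
  have gap: "gap k l = 0" if "0 \<le> k + l" "k + l \<le> m + 1" for k l
  proof -
    consider "k + l \<le> m" | "k + l = m + 1" "m + 1 \<le> B" | "k + l = m + 1" "B \<le> m" using \<open>k + l \<le> m + 1\<close> by linarith
    then show ?thesis
    proof cases
      case 1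
      then show ?thesis using holds_uptoD(1)[OF S] that by blast
    next
      case 2
      then show ?thesis using gap_middle[of k l] that bounds by simp
    next
      case 3
      then show ?thesis using next_gap[OF S] by blast
    qed
  qed
  \<comment> \<open>A good diagonal \<open>i + j\<close> makes \<open>[h\<^sub>i, \<psi>\<^sub>j]\<close> vanish, if \<open>\<psi>\<^sub>j\<close> is a value of \<open>X\<close>, that is if \<open>j > d\<close>.\<close>
  have hh_aux: "comm (h i) (h j) = 0" if "1 \<le> i" "1 \<le> j" "i + j = m + 1" "N < j" for i j
  proof -
    have j: "d < j" using that bounds by simp
    have g: "gap 0 j = 0" "gap i j = 0" "gap 0 (j + i) = 0" by (rule gap; use that in simp)+
    have "psi j = X 0 j" using X_high[OF g(1)] j by simp
    moreover have "X (0 + i) j = X 0 (j + i)"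
      using X_high[OF g(2)] X_high[OF g(3)] j that by (simp add: add.commute)
    ultimately have "comm (h i) (psi j) = 0"
      using comm_h_X_upto[OF S, of i 0 j] that by simp
    then have "K * comm (h i) (h j) = K * 0"
      using comm_psi_top_upto[OF S that(1,2,3)] kap_nz by simp
    then show ?thesis by (rule cancel_K)
  qed
  have hh: "comm (h i) (h j) = 0" if ij: "1 \<le> i" "1 \<le> j" "i + j \<le> m + 1" for i j
  proof -
    consider "i + j \<le> m" | "i \<le> N" "j \<le> N" | "i + j = m + 1" "N < j" | "i + j = m + 1" "N < i" using ij by linarith
    then show ?thesis
    proof cases
      case 1
      then show ?thesis using holds_uptoD(2)[OF S] that by blast
    next
      case 2
      then show ?thesis using h_h_pos that by blast
    next
      case 3
      then show ?thesis using hh_aux that by blast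
    next
      case 4
      then show ?thesis using hh_aux[of j i] comm_swap[of "h i" "h j"] that by simp
    qed
  qed
  define n where "n = nat (m + 1)"
  have n: "int n = m + 1" "n > 0" using m bounds by (auto simp: n_def)
  have acte: "comm (fps_nth A j) (e k) = ((q ^ j - qi ^ j) / of_nat j) \<cdot> e (k + int j)" if "0 < j" "j < n" for j k
    using holds_uptoD(3)[OF S, of "int j" k] that n kap_wt[of j] by (simp add: A_pos)
  have actf: "comm (fps_nth A j) (f k) = ((qi ^ j - q ^ j) / of_nat j) \<cdot> f (k + int j)" if "0 < j" "j < n" for j k
  proof -
    have "comm (fps_nth A j) (f k) = (- (kap * wt (int j))) \<cdot> f (k + int j)"
      using holds_uptoD(4)[OF S, of "int j" k] that n by (simp add: A_pos scale_minus_left)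
    also have "- (kap * wt (int j)) = (qi ^ j - q ^ j) / of_nat j"
      unfolding kap_wt[OF that(1)] by (metis minus_diff_eq minus_divide_left)
    finally show ?thesis .
  qed
  have e: "comm (h (m + 1)) (e k) = wt (m + 1) \<cdot> e (k + (m + 1))" for k
  proof -
    have "comm (fps_nth A n) (e k) = ((q ^ n - qi ^ n) / of_nat n) \<cdot> e (k + int n)"
    proof (rule exchange_comm[OF _ n(2) _ acte e_K])
      show "psi (int n) * e k + e (k + 1) * psi (int n - 1) = q \<cdot> (psi (int n - 1) * e (k + 1) + e k * psi (int n))"
        using psi_e[of m k] gap[of k "m - k"] gap[of "k + 1" "m - k"] n m bounds by simp
    qed (use hh n qqi in auto)
    then have "kap \<cdot> comm (h (int n)) (e k) = kap \<cdot> (wt (int n) \<cdot> e (k + int n))"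
      using n(2) kap_wt[of n] by (simp add: A_pos)
    then show ?thesis using kap_nz n(1) by (simp only: scale_cancel_left) simp
  qed
  have f: "comm (h (m + 1)) (f k) = - (wt (m + 1) \<cdot> f (k + (m + 1)))" for k
  proof -
    have "comm (fps_nth A n) (f k) = ((qi ^ n - q ^ n) / of_nat n) \<cdot> f (k + int n)"
    proof (rule exchange_comm[OF _ n(2) _ actf f_K])
      show "psi (int n) * f k + f (k + 1) * psi (int n - 1) = qi \<cdot> (psi (int n - 1) * f (k + 1) + f k * psi (int n))"
        using psi_f[of m k] gap[of "m - k" k] gap[of "m - k" "k + 1"] n m bounds by simp
    qed (use hh n qqi in auto)
    also have "(qi ^ n - q ^ n) / of_nat n = - (kap * wt (int n))"
      unfolding kap_wt[OF n(2)] by (metis minus_diff_eq minus_divide_left)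
    finally have "kap \<cdot> comm (h (int n)) (f k) = kap \<cdot> (- (wt (int n) \<cdot> f (k + int n)))"
      using n(2) by (simp add: A_pos scale_minus_left)
    then show ?thesis using kap_nz n(1) by (simp only: scale_cancel_left) simp
  qed
  show ?thesis
    unfolding holds_upto_def
  proof (intro conjI allI impI)
    fix i k assume "1 \<le> i" "i \<le> m + 1"
    then have "i \<le> m \<or> i = m + 1" by auto
    then show "comm (h i) (e k) = wt i \<cdot> e (k + i)" "comm (h i) (f k) = - (wt i \<cdot> f (k + i))"
      using holds_uptoD(3,4)[OF S \<open>1 \<le> i\<close>] e f by auto
  qed (use gap hh in auto)
qed

lemma holds_upto: "holds_upto (N + int n)"
proof (induction n)
  case 0
  show ?case
    unfolding holds_upto_def
    using gap_middle h_h_pos h_e_f_upto_N bounds by auto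
next
  case (Suc n)
  then show ?case using next_upto[of "N + int n"] bounds by (simp add: algebra_simps)
qed

lemma pos_relations:
  shows "0 \<le> k + l \<Longrightarrow> gap k l = 0"
    and "1 \<le> i \<Longrightarrow> 1 \<le> j \<Longrightarrow> comm (h i) (h j) = 0"
    and "1 \<le> i \<Longrightarrow> comm (h i) (e k) = wt i \<cdot> e (k + i)"
    and "1 \<le> i \<Longrightarrow> comm (h i) (f k) = - (wt i \<cdot> f (k + i))"
proof -
  show "0 \<le> k + l \<Longrightarrow> gap k l = 0"
    by (rule holds_uptoD(1)[OF holds_upto[of "nat (k + l)"]]) (use bounds in auto)
  show "1 \<le> i \<Longrightarrow> 1 \<le> j \<Longrightarrow> comm (h i) (h j) = 0"
    by (rule holds_uptoD(2)[OF holds_upto[of "nat (i + j)"]]) (use bounds in auto)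
  show "1 \<le> i \<Longrightarrow> comm (h i) (e k) = wt i \<cdot> e (k + i)" "1 \<le> i \<Longrightarrow> comm (h i) (f k) = - (wt i \<cdot> f (k + i))"
    by (rule holds_uptoD(3,4)[OF holds_upto[of "nat i"]]; use bounds in auto)+
qed

lemma neg_relations:
  shows "k + l \<le> d \<Longrightarrow> gap k l = 0"
    and "1 \<le> i \<Longrightarrow> 1 \<le> j \<Longrightarrow> comm (h (- i)) (h (- j)) = 0"
    and "1 \<le> i \<Longrightarrow> comm (h (- i)) (e k) = wt i \<cdot> e (k - i)"
    and "1 \<le> i \<Longrightarrow> comm (h (- i)) (f k) = - (wt i \<cdot> (g i * f (k - i)))"
proof -
  interpret F: current_seed scale "inverse v" d N B g "\<lambda>k. e (- k)" "\<lambda>k. g k * f (d - k)" "\<lambda>k. h (- k)"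
    "\<lambda>n. g d * phi (d - n)" "\<lambda>n. psi (d - n)" "g d * L" "g (- d) * Li" K Ki by (rule flip)
  show "comm (h (- i)) (h (- j)) = 0" if "1 \<le> i" "1 \<le> j"
    using F.pos_relations(2)[OF that] by simp
  show "comm (h (- i)) (e k) = wt i \<cdot> e (k - i)" if "1 \<le> i"
    using F.pos_relations(3)[OF that, of "- k"] by (simp add: inverse_simps)
  show "comm (h (- i)) (f k) = - (wt i \<cdot> (g i * f (k - i)))" if "1 \<le> i"
  proof (rule cancel_g)
    have "g (d - k + i) = g (d - k) * g i" by (rule g_add)
    then show "g (d - k) * comm (h (- i)) (f k) = g (d - k) * - (wt i \<cdot> (g i * f (k - i)))"
      using F.pos_relations(4)[OF that, of "d - k"] by (simp add: inverse_simps comm_g scale_mult mult.assoc diff_diff_eq2)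
  qed
  show "gap k l = 0" if "k + l \<le> d"
  proof (rule cancel_g)
    have "F.gap (- k) (d - l) = 0" by (rule F.pos_relations(1)) (use that in simp)
    moreover have "F.gap (- k) (d - l) = - (g (d - l) * gap k l)"
    proof -
      have "g d * phi (k + l) = g (d - l) * (g l * phi (k + l))" by (simp flip: mult.assoc g_add)
      moreover have "d - (d - l - k) = k + l" by simp
      ultimately show ?thesis
        by (simp add: F.gap_def gap_def inverse_simps comm_g scale_mult scale_minus_left right_diff_distrib algebra_simps)
    qed
    ultimately show "g (d - l) * gap k l = g (d - l) * 0" by simp
  qed
qed

theorem gap_all: "gap k l = 0"
  using pos_relations(1)[of k l] neg_relations(1)[of k l] bounds by linarith

subsection \<open>Positive against negative modes\<close>

lemma comm_h_neg_phi:
  assumes "1 \<le> l" shows "comm (h (- l)) (phi n) = 0"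
proof -
  interpret F: current_seed scale "inverse v" d N B g "\<lambda>k. e (- k)" "\<lambda>k. g k * f (d - k)" "\<lambda>k. h (- k)"
    "\<lambda>n. g d * phi (d - n)" "\<lambda>n. psi (d - n)" "g d * L" "g (- d) * Li" K Ki by (rule flip)
  have "comm (h (- l)) (g d * phi (d - (d - n))) = 0"
    by (rule F.comm_psi_0) (use assms neg_relations(2) in auto)
  then have "g d * comm (h (- l)) (phi n) = g d * 0" by (simp add: comm_g)
  then show ?thesis by (rule cancel_g)
qed

text \<open>
  Once the relation for \<open>[e\<^sub>k, f\<^sub>l]\<close> holds everywhere, \<open>\<psi>\<^sub>n\<close> is expressed by \<open>X\<close> and \<open>\<phi>\<^sub>n\<close>, which commutes with the negative modes.
\<close>

lemma comm_h_neg_psi: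
  assumes "1 \<le> l" shows "comm (h (- l)) (psi n) = (- wt l \<cdot> (g l - 1)) * psi (n - l)"
proof -
  have X: "X k m = psi (k + m) - g m * phi (k + m)" for k m using X_good[OF gap_all] .
  have "comm (h (- l)) (X 0 n) = wt l \<cdot> (X (- l) n - g l * X 0 (n - l))"
    by (rule comm_X) (use neg_relations(3)[OF assms, of 0] neg_relations(4)[OF assms] in \<open>auto simp: g_central\<close>)
  moreover have "g n = g l * g (n - l)" by (simp flip: g_add)
  ultimately show ?thesis
    by (simp add: X comm_diff_right comm_g comm_h_neg_phi[OF assms] scale_mult algebra_simps)
qed

theorem h_h_mixed:
  assumes "1 \<le> n" "1 \<le> l"
  shows "comm (h n) (h (- l)) = (if n = l then (wt l / kap) \<cdot> (g l - 1) else 0)"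
proof -
  have "kap \<cdot> comm (h (- l)) (h (int (nat n))) = (if nat n = nat l then - wt l \<cdot> (g l - 1) else 0)"
  proof (rule psi_derivation[where M = "nat n"])
    show "comm (h (- l)) (psi (int m)) = (- wt l \<cdot> (g l - 1)) * psi (int m - int (nat l))" for m
      using comm_h_neg_psi[OF assms(2), of "int m"] assms by simp
    show "(- wt l \<cdot> (g l - 1)) * y = y * (- wt l \<cdot> (g l - 1))" for y by (rule g_scaled_central)
  qed (use assms K_h in auto)
  then have "kap \<cdot> comm (h n) (h (- l)) = kap \<cdot> (if n = l then (wt l / kap) \<cdot> (g l - 1) else 0)"
    using assms kap_nz by (subst comm_swap) (auto simp: scale_minus_left eq_nat_nat_iff)
  then show ?thesis using kap_nz by (simp only: scale_cancel_left) simp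
qed

end

section \<open>Homomorphisms from free algebras\<close>

instance fract :: ("{idom, ring_char_0}") field_char_0
  by standard (auto simp: inj_def of_nat_fract eq_fract)

lemma free_induct [case_names zero add_single]:
  fixes p :: "'g free"
  assumes "P 0" "\<And>p w c. P p \<Longrightarrow> P (p + Poly_Mapping.single w c)"
  shows "P p"
proof (induction p rule: Poly_Mapping.update_induct)
  case (update p w c)
  have "Poly_Mapping.update w c p = p + Poly_Mapping.single w c"
    by (rule poly_mapping_eqI)
      (use update in \<open>auto simp: lookup_update lookup_add lookup_single when_def in_keys_iff\<close>)
  then show ?case using assms(2)[OF update(3)] by simp
qed (rule assms)

lemma scal_commute: "scal c * p = p * scal (c::Cv)"
  by (induction p rule: free_induct) (simp_all add: distrib_left distrib_right scal_def mult_single mult.commute)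

lemma scal_mult: "scal (a * b) = scal a * scal b"
  by (simp add: scal_def mult_single)

lemma scal_add: "scal (a + b) = scal a + scal b"
  by (simp add: scal_def single_add)

lemma scal_1: "scal 1 = 1"
  by (simp add: scal_def)

context scalar_algebra
begin

definition lift :: "('g \<Rightarrow> 'a) \<Rightarrow> ('g word \<Rightarrow>\<^sub>0 'k) \<Rightarrow> 'a" where
  "lift f p = (\<Sum>w\<in>Poly_Mapping.keys p. Poly_Mapping.lookup p w \<cdot> prod_list (map f (letters w)))"

lemma lift_single: "lift f (Poly_Mapping.single w c) = c \<cdot> prod_list (map f (letters w))"
  by (simp add: lift_def)

lemma lift_add: "lift f (p + r) = lift f p + lift f r"
  unfolding lift_def by (rule setsum_keys_plus_distrib) (simp_all add: scale_left_distrib)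

end

locale cv_algebra = scalar_algebra scale
  for scale :: "Cv \<Rightarrow> 'a::ring_1 \<Rightarrow> 'a" (infixr \<open>\<cdot>\<close> 72)
begin

definition free_hom :: "('g free \<Rightarrow> 'a) \<Rightarrow> bool" where
  "free_hom \<phi> \<longleftrightarrow> (\<forall>p r. \<phi> (p + r) = \<phi> p + \<phi> r) \<and> (\<forall>p r. \<phi> (p * r) = \<phi> p * \<phi> r) \<and> (\<forall>c. \<phi> (scal c) = c \<cdot> 1)"

lemma free_hom_lift:
  fixes f :: "'g \<Rightarrow> 'a"
  shows "free_hom (lift f)"
proof -
  have "lift f (p * r) = lift f p * lift f r" for p r :: "'g free"
  proof (induction p rule: free_induct)
    case (add_single p w c)
    have "lift f (Poly_Mapping.single w c * r) = lift f (Poly_Mapping.single w c) * lift f r"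
    proof (induction r rule: free_induct)
      case (add_single r w' c')
      then show ?case
        by (simp add: distrib_left lift_add mult_single lift_single scale_mult mult.commute)
    qed (simp add: lift_def)
    then show ?case using add_single by (simp add: distrib_right lift_add)
  qed (simp add: lift_def)
  then show ?thesis
    by (simp add: free_hom_def lift_add scal_def lift_single)
qed

lemma lift_gen: "lift f (gen g) = f g"
  by (simp add: gen_def lift_single)

context
  fixes \<phi> :: "'g free \<Rightarrow> 'a"
  assumes \<phi>: "free_hom \<phi>"
begin

lemma hom_add: "\<phi> (p + r) = \<phi> p + \<phi> r" and hom_mult: "\<phi> (p * r) = \<phi> p * \<phi> r"
  and hom_scal: "\<phi> (scal c) = c \<cdot> 1"
  using \<phi> by (auto simp: free_hom_def)

lemma hom_0: "\<phi> 0 = 0"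
  using hom_add[of 0 0] by simp

lemma hom_1: "\<phi> 1 = 1"
  using hom_scal[of 1] by (simp add: scal_1)

lemma hom_minus: "\<phi> (- p) = - \<phi> p"
  using hom_add[of p "- p"] hom_0 by (simp add: eq_neg_iff_add_eq_0 add.commute)

lemma hom_diff: "\<phi> (p - r) = \<phi> p - \<phi> r"
  using hom_add[of p "- r"] by (simp add: hom_minus)

lemma hom_comm: "\<phi> (comm p r) = comm (\<phi> p) (\<phi> r)"
  by (simp add: comm_def hom_diff hom_mult)

lemma hom_power: "\<phi> (p ^ n) = \<phi> p ^ n"
  by (induction n) (simp_all add: hom_1 hom_mult)

lemma hom_scal_mult: "\<phi> (scal c * p) = c \<cdot> \<phi> p"
  by (simp add: hom_mult hom_scal scale_mult)

lemma hom_sum: "\<phi> (sum F I) = (\<Sum>i\<in>I. \<phi> (F i))"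
  by (induction I rule: infinite_finite_induct) (simp_all add: hom_0 hom_add)

lemma hom_fps_power: "\<phi> (fps_nth (P ^ i) n) = fps_nth (Abs_fps (\<lambda>j. \<phi> (fps_nth P j)) ^ i) n"
proof (induction i arbitrary: n)
  case 0
  then show ?case by (simp add: hom_0 hom_1)
next
  case (Suc i)
  then show ?case by (simp add: fps_mult_nth hom_sum hom_mult)
qed

lemma hom_series_exp: "\<phi> (fps_nth (series_exp P) n) = fps_nth (sexp (Abs_fps (\<lambda>j. \<phi> (fps_nth P j)))) n"
  by (simp add: series_exp_def sexp_def hom_sum hom_scal_mult hom_fps_power)

lemma hom_series_log:
  assumes "\<phi> (fps_nth P 0) = 1"
  shows "fps_nth (sexp (Abs_fps (\<lambda>j. \<phi> (fps_nth (series_log P) j)))) n = \<phi> (fps_nth P n)"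
  using assms hom_series_exp[of "series_log P" n] by (simp add: series_exp_log hom_1 split: if_splits)

end

text \<open>
  Uniqueness in the universal property of the free algebra.
\<close>

lemma free_hom_eq:
  fixes \<phi> \<psi> :: "'g free \<Rightarrow> 'a"
  assumes "free_hom \<phi>" "free_hom \<psi>" "\<And>g. g \<in> Y \<Longrightarrow> \<phi> (gen g) = \<psi> (gen g)" "p \<in> carrier (free_algebra Y)"
  shows "\<phi> p = \<psi> p"
proof -
  have word: "\<phi> (Poly_Mapping.single (Word ls) c) = \<psi> (Poly_Mapping.single (Word ls) c)" if "set ls \<subseteq> Y" for ls c
    using that
  proof (induction ls)
    case Nil
    have "Poly_Mapping.single (Word []) c = (scal c :: 'g free)" by (simp add: scal_def zero_word_def)
    then show ?case using assms(1,2) by (simp add: free_hom_def)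
  next
    case (Cons l ls)
    have "Poly_Mapping.single (Word (l # ls)) c = gen l * Poly_Mapping.single (Word ls) c"
      by (simp add: gen_def mult_single plus_word_def)
    then show ?case using Cons assms by (simp add: free_hom_def)
  qed
  have p: "p = (\<Sum>w\<in>Poly_Mapping.keys p. Poly_Mapping.single w (Poly_Mapping.lookup p w))"
    by (rule poly_mapping_eqI) (simp add: lookup_sum lookup_single when_def in_keys_iff)
  have "\<phi> (Poly_Mapping.single w c) = \<psi> (Poly_Mapping.single w c)" if "w \<in> Poly_Mapping.keys p" for w c
    using word[of "letters w" c] that assms(4) by (simp add: carrier_free_algebra)
  then show ?thesis
    by (subst (1 2) p) (simp add: hom_sum[OF assms(1)] hom_sum[OF assms(2)])
qed

end

interpretation free: cv_algebra "\<lambda>c (p :: 'g free). scal c * p"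
proof
  fix a b :: Cv and x y :: "'g free"
  show "x * (scal a * y) = scal a * (x * y)" by (metis mult.assoc scal_commute)
qed (simp_all add: distrib_left distrib_right scal_add scal_mult scal_1 mult.assoc)

lemma lift_in:
  assumes "\<And>g. f g \<in> carrier (free_algebra Y)"
  shows "free.lift f p \<in> carrier (free_algebra Y)"
proof -
  have "prod_list (map f ls) \<in> carrier (free_algebra Y)" for ls
    by (induction ls) (auto intro!: free_in assms)
  then show ?thesis unfolding free.lift_def by (intro sum_in free_in)
qed

section \<open>Presented algebras as rings\<close>

text \<open>
  Letter types of a presentation, so that the quotient algebra can be a type constructor.
\<close>

class presentation =
  fixes letters_of :: "'a set" and relations :: "('a free \<times> 'a free) set"
  assumes relations_in: "(p, r) \<in> relations \<Longrightarrow>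
    p \<in> carrier (free_algebra letters_of) \<and> r \<in> carrier (free_algebra letters_of)"

abbreviation car :: "'g::presentation free set" where
  "car \<equiv> carrier (free_algebra letters_of)"

text \<open>
  The ideal of the relations, replaced by zero if it is everything. The quotient is then never the
  zero ring, which would not be an instance of \<^class>\<open>ring_1\<close>.
\<close>

definition pideal :: "'g::presentation free set" where
  "pideal = (if 1 \<in> rel_ideal letters_of (relations :: ('g free \<times> 'g free) set) then {0} else rel_ideal letters_of relations)"

text \<open>
  Killing the letters outside the presentation extends the congruence of the ideal to the whole
  free type, so that the projection to the quotient is a homomorphism on all elements.
\<close>

definition retract :: "'g::presentation free \<Rightarrow> 'g free" where
  "retract = free.lift (\<lambda>g. if g \<in> letters_of then gen g else 0)"

lemma hom_retract: "free.free_hom retract"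
  unfolding retract_def by (rule free.free_hom_lift)

lemma retract_in: "retract p \<in> car"
  unfolding retract_def by (rule lift_in) (auto intro: gen_in zero_in)

lemma retract_id: "p \<in> car \<Longrightarrow> retract p = p"
proof (rule free.free_hom_eq[OF hom_retract, of "\<lambda>p. p"])
  show "free.free_hom (\<lambda>p. p)" by (simp add: free.free_hom_def)
qed (simp_all add: retract_def free.lift_gen)

lemma ideal_rel: "ideal (rel_ideal letters_of relations) (free_algebra (letters_of :: 'g::presentation set))"
  unfolding rel_ideal_def
  by (rule ring.genideal_ideal[OF ring_free_algebra]) (auto dest!: relations_in intro: diff_in)

lemma ideal_pideal: "ideal pideal (free_algebra (letters_of :: 'g::presentation set))"
proof (cases "1 \<in> rel_ideal letters_of (relations :: ('g free \<times> 'g free) set)")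
  case True
  then show ?thesis using ring.zeroideal[OF ring_free_algebra] by (simp add: pideal_def free_algebra_sel)
next
  case False
  then show ?thesis using ideal_rel by (simp add: pideal_def)
qed

lemma one_notin_pideal: "1 \<notin> (pideal :: 'g::presentation free set)"
  by (simp add: pideal_def)

lemma pideal_subset: "p \<in> pideal \<Longrightarrow> p \<in> car"
  using additive_subgroup.a_Hcarr[OF ideal.axioms(1)[OF ideal_pideal]] .

lemma pideal_0: "0 \<in> pideal"
  using additive_subgroup.zero_closed[OF ideal.axioms(1)[OF ideal_pideal]] by (simp add: free_algebra_sel)

lemma pideal_add: "p \<in> pideal \<Longrightarrow> r \<in> pideal \<Longrightarrow> p + r \<in> pideal"
  using additive_subgroup.a_closed[OF ideal.axioms(1)[OF ideal_pideal]] by (simp add: free_algebra_sel)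

lemma pideal_mult:
  "p \<in> pideal \<Longrightarrow> r \<in> car \<Longrightarrow> r * p \<in> pideal" "p \<in> pideal \<Longrightarrow> r \<in> car \<Longrightarrow> p * r \<in> pideal"
  using ideal.I_l_closed[OF ideal_pideal] ideal.I_r_closed[OF ideal_pideal] by (simp_all add: free_algebra_sel)

lemma pideal_minus: "p \<in> pideal \<Longrightarrow> - p \<in> pideal"
  using pideal_mult(1)[of p "- 1"] by (simp add: uminus_in one_in)

lemma pideal_diff: "p \<in> pideal \<Longrightarrow> r \<in> pideal \<Longrightarrow> p - r \<in> pideal"
  using pideal_add[OF _ pideal_minus] by fastforce

text \<open>
  In this case \<^const>\<open>pideal\<close> is the ideal of the relations.
\<close>

definition nontrivial :: "'g::presentation itself \<Rightarrow> bool" where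
  "nontrivial _ \<longleftrightarrow> 1 \<notin> rel_ideal letters_of (relations :: ('g free \<times> 'g free) set)"

lemma relation_pideal:
  fixes a b :: "'g::presentation free"
  assumes "nontrivial TYPE('g)" "(a, b) \<in> relations"
  shows "a - b \<in> pideal"
  using assms unfolding pideal_def nontrivial_def rel_ideal_def genideal_def by auto

definition same_class :: "'g::presentation free \<Rightarrow> 'g free \<Rightarrow> bool" where
  "same_class p r \<longleftrightarrow> retract p - retract r \<in> pideal"

lemma equivp_same_class: "equivp same_class"
proof (rule equivpI)
  show "reflp same_class" by (simp add: reflp_def same_class_def pideal_0)
  show "symp same_class" unfolding symp_def same_class_def using pideal_minus by fastforce
  show "transp same_class" unfolding transp_def same_class_def
  proof (intro allI impI)
    fix x y z :: "'g::presentation free"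
    assume "retract x - retract y \<in> pideal" "retract y - retract z \<in> pideal"
    from pideal_add[OF this] show "retract x - retract z \<in> pideal" by simp
  qed
qed

quotient_type (overloaded) 'g palg = "'g::presentation free" / same_class
  by (rule equivp_same_class)

instantiation palg :: (presentation) ring_1
begin

lift_definition zero_palg :: "'a palg" is 0 .
lift_definition one_palg :: "'a palg" is 1 .
lift_definition plus_palg :: "'a palg \<Rightarrow> 'a palg \<Rightarrow> 'a palg" is "(+)"
  unfolding same_class_def free.hom_add[OF hom_retract] using pideal_add by (simp add: add_diff_add)
lift_definition minus_palg :: "'a palg \<Rightarrow> 'a palg \<Rightarrow> 'a palg" is "(-)"
proof -
  fix a b c d :: "'a free"
  assume "same_class a b" "same_class c d"
  then have "(retract a - retract b) - (retract c - retract d) \<in> pideal"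
    unfolding same_class_def by (rule pideal_diff)
  then show "same_class (a - c) (b - d)"
    unfolding same_class_def free.hom_diff[OF hom_retract] by (simp add: algebra_simps)
qed
lift_definition uminus_palg :: "'a palg \<Rightarrow> 'a palg" is uminus
proof -
  fix a b :: "'a free"
  assume "same_class a b"
  then have "- (retract a - retract b) \<in> pideal"
    unfolding same_class_def by (rule pideal_minus)
  then show "same_class (- a) (- b)"
    unfolding same_class_def free.hom_minus[OF hom_retract] by (simp add: algebra_simps)
qed
lift_definition times_palg :: "'a palg \<Rightarrow> 'a palg \<Rightarrow> 'a palg" is "(*)"
proof -
  fix a b c d :: "'a free"
  assume "same_class a b" "same_class c d"
  then have "(retract a - retract b) * retract c + retract b * (retract c - retract d) \<in> pideal"
    unfolding same_class_def by (intro pideal_add pideal_mult retract_in)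
  then show "same_class (a * c) (b * d)"
    unfolding same_class_def free.hom_mult[OF hom_retract] by (simp add: algebra_simps)
qed

instance
proof
  have eq: "same_class p r" if "p = r" for p r :: "'a free"
    using that by (simp add: same_class_def pideal_0)
  fix a b c :: "'a palg"
  show "a + b + c = a + (b + c)" by transfer (rule eq, simp add: add.assoc)
  show "a + b = b + a" by transfer (rule eq, simp add: add.commute)
  show "0 + a = a" by transfer (rule eq, simp)
  show "- a + a = 0" by transfer (rule eq, simp)
  show "a - b = a + - b" by transfer (rule eq, simp)
  show "a * b * c = a * (b * c)" by transfer (rule eq, simp add: mult.assoc)
  show "(a + b) * c = a * c + b * c" by transfer (rule eq, simp add: distrib_right)
  show "a * (b + c) = a * b + a * c" by transfer (rule eq, simp add: distrib_left)
  show "1 * a = a" "a * 1 = a" by (transfer, rule eq, simp)+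
  show "(0 :: 'a palg) \<noteq> 1"
  proof (transfer, rule notI)
    assume "same_class 0 (1 :: 'a free)"
    then have "- 1 \<in> (pideal :: 'a free set)"
      by (simp add: same_class_def free.hom_0[OF hom_retract] free.hom_1[OF hom_retract])
    from pideal_minus[OF this] show False by (simp add: one_notin_pideal)
  qed
qed

end

abbreviation cl :: "'g::presentation free \<Rightarrow> 'g palg" where
  "cl \<equiv> abs_palg"

definition pscale :: "Cv \<Rightarrow> 'g::presentation palg \<Rightarrow> 'g palg" where
  "pscale c x = cl (scal c) * x"

lemma cl_add: "cl (p + r) = cl p + cl r" by (simp add: plus_palg.abs_eq)
lemma cl_mult: "cl (p * r) = cl p * cl r" by (simp add: times_palg.abs_eq)
lemma cl_1: "cl 1 = 1" by (simp add: one_palg.abs_eq)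

lemma cl_surj: "\<exists>p \<in> car. x = cl p"
proof -
  obtain p where "x = cl p" by (metis Quotient3_abs_rep Quotient3_palg)
  moreover have "cl p = cl (retract p)"
    unfolding palg.abs_eq_iff same_class_def by (simp add: retract_id[OF retract_in] pideal_0)
  ultimately show ?thesis using retract_in by blast
qed

interpretation palg: cv_algebra pscale
proof
  fix a b :: Cv and x y :: "'g::presentation palg"
  have central: "cl (scal a) * z = z * cl (scal a)" for z :: "'g palg"
    using cl_surj[of z] by (auto simp flip: cl_mult simp: scal_commute)
  show "x * pscale a y = pscale a (x * y)" by (metis central mult.assoc pscale_def)
qed (simp_all add: pscale_def distrib_left distrib_right scal_add scal_mult scal_1 cl_add cl_mult cl_1 mult.assoc)

lemma hom_cl: "palg.free_hom cl"
  by (simp add: palg.free_hom_def cl_add cl_mult pscale_def)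

lemma cl_eq_iff: "p \<in> car \<Longrightarrow> r \<in> car \<Longrightarrow> cl p = cl r \<longleftrightarrow> p - r \<in> pideal"
  unfolding palg.abs_eq_iff same_class_def by (simp add: retract_id)

lemma cl_relation: "nontrivial TYPE('g) \<Longrightarrow> (p, r) \<in> relations \<Longrightarrow> cl p = cl (r :: 'g::presentation free)"
  using relations_in relation_pideal by (subst cl_eq_iff) auto

context cv_algebra
begin

text \<open>
  The kernel of a homomorphism is an ideal, and the ideal of the relations is the least one that contains them.
\<close>

lemma kernel_rel_ideal:
  fixes \<phi> :: "'g::presentation free \<Rightarrow> 'a"
  assumes \<phi>: "free_hom \<phi>" and rel: "\<And>p r. (p, r) \<in> relations \<Longrightarrow> \<phi> p = \<phi> r"
    and p: "p \<in> rel_ideal letters_of relations"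
  shows "\<phi> p = 0"
proof -
  let ?A = "free_algebra (letters_of :: 'g set)"
  have "ideal {p \<in> carrier ?A. \<phi> p = 0} ?A"
  proof (rule idealI[OF ring_free_algebra])
    interpret A: ring ?A by (rule ring_free_algebra)
    show "subgroup {p \<in> carrier ?A. \<phi> p = 0} (add_monoid ?A)"
    proof (rule A.add.subgroupI)
      show "\<ominus>\<^bsub>?A\<^esub> a \<in> {p \<in> carrier ?A. \<phi> p = 0}" if "a \<in> {p \<in> carrier ?A. \<phi> p = 0}" for a
      proof -
        have "\<ominus>\<^bsub>?A\<^esub> a = - a"
          by (rule A.minus_equality) (use that in \<open>auto simp: free_algebra_sel intro: uminus_in\<close>)
        then show ?thesis using that by (auto intro: uminus_in simp: hom_minus[OF \<phi>])
      qed
      show "{p \<in> carrier ?A. \<phi> p = 0} \<noteq> {}" using hom_0[OF \<phi>] zero_in by blast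
    qed (auto simp: free_algebra_sel hom_add[OF \<phi>] intro: add_in)
  qed (auto simp: free_algebra_sel hom_mult[OF \<phi>] intro: mult_in)
  moreover have "{a - b | a b. (a, b) \<in> relations} \<subseteq> {p \<in> carrier ?A. \<phi> p = 0}"
    using relations_in rel by (auto simp: hom_diff[OF \<phi>] intro!: diff_in)
  ultimately have "rel_ideal letters_of relations \<subseteq> {p \<in> carrier ?A. \<phi> p = 0}"
    unfolding rel_ideal_def by (rule ring.genideal_minimal[OF ring_free_algebra])
  then show ?thesis using p by blast
qed

text \<open>
  The homomorphism out of the presented algebra that is given on letters. Its existence shows
  that the algebra is not zero, because its target is not.
\<close>

definition extend :: "('g::presentation \<Rightarrow> 'a) \<Rightarrow> 'g palg \<Rightarrow> 'a" where
  "extend f x = lift f (retract (rep_palg x))"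

context
  fixes f :: "'g::presentation \<Rightarrow> 'a"
  assumes rel: "\<And>p r. (p, r) \<in> relations \<Longrightarrow> lift f p = lift f r"
begin

lemma nontrivial_extend: "nontrivial TYPE('g)"
  using kernel_rel_ideal[OF free_hom_lift rel, of 1] hom_1[OF free_hom_lift, of f]
  by (auto simp: nontrivial_def)

lemma extend_cl:
  assumes "p \<in> car" shows "extend f (cl p) = lift f p"
proof -
  have "cl (rep_palg (cl p)) = cl p" by (metis Quotient3_abs_rep Quotient3_palg)
  then have "retract (rep_palg (cl p)) - p \<in> pideal"
    using assms by (simp add: palg.abs_eq_iff same_class_def retract_id)
  then have "retract (rep_palg (cl p)) - p \<in> rel_ideal letters_of relations"
    using nontrivial_extend by (simp add: pideal_def nontrivial_def)
  then have "lift f (retract (rep_palg (cl p)) - p) = 0"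
    by (intro kernel_rel_ideal[OF free_hom_lift] rel)
  then show ?thesis by (simp add: extend_def hom_diff[OF free_hom_lift])
qed

lemma extend_add: "extend f (x + y) = extend f x + extend f y"
  and extend_mult: "extend f (x * y) = extend f x * extend f y"
  using cl_surj[of x] cl_surj[of y]
  by (auto simp: extend_cl add_in mult_in hom_add[OF free_hom_lift] hom_mult[OF free_hom_lift] simp flip: cl_add cl_mult)

lemma extend_scal: "extend f (cl (scal c)) = c \<cdot> 1"
  by (simp add: extend_cl scal_in hom_scal[OF free_hom_lift])

lemma extend_1: "extend f 1 = 1"
  using extend_scal[of 1] by (simp add: scal_1 cl_1)

lemma extend_scale: "extend f (pscale c x) = c \<cdot> extend f x"
  by (simp add: pscale_def extend_mult extend_scal scale_mult)

end

end

lemma palg_induct: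
  fixes x :: "'g::presentation palg"
  assumes scal: "\<And>c. P (pscale c 1)" and gens: "\<And>g. g \<in> letters_of \<Longrightarrow> P (cl (gen g))"
    and add: "\<And>x y. P x \<Longrightarrow> P y \<Longrightarrow> P (x + y)" and mult: "\<And>x y. P x \<Longrightarrow> P y \<Longrightarrow> P (x * y)"
  shows "P x"
proof -
  obtain p :: "'g free" where p: "p \<in> car" "x = cl p" using cl_surj by blast
  have word: "P (cl (Poly_Mapping.single (Word ls) c))" if "set ls \<subseteq> letters_of" for ls c
    using that
  proof (induction ls)
    case Nil
    have "Poly_Mapping.single (Word []) c = (scal c :: 'g free)" by (simp add: scal_def zero_word_def)
    then show ?case using scal[of c] by (simp add: pscale_def)
  next
    case (Cons l ls)
    have "Poly_Mapping.single (Word (l # ls)) c = gen l * Poly_Mapping.single (Word ls) c"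
      by (simp add: gen_def mult_single plus_word_def)
    then show ?case using Cons gens mult by (simp add: cl_mult)
  qed
  have "p = (\<Sum>w\<in>Poly_Mapping.keys p. Poly_Mapping.single w (Poly_Mapping.lookup p w))"
    by (rule poly_mapping_eqI) (simp add: lookup_sum lookup_single when_def in_keys_iff)
  then have "x = (\<Sum>w\<in>Poly_Mapping.keys p. cl (Poly_Mapping.single w (Poly_Mapping.lookup p w)))"
    unfolding p(2) by (subst palg.hom_sum[OF hom_cl, symmetric]) simp
  also have "P (\<Sum>w\<in>W. cl (Poly_Mapping.single w (Poly_Mapping.lookup p w)))" if "W \<subseteq> Poly_Mapping.keys p" for W
    using finite_subset[OF that finite_keys] that
  proof (induction W rule: finite_induct)
    case empty
    then show ?case using scal[of 0] by simp
  next
    case (insert w W)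
    then have "set (letters w) \<subseteq> letters_of" using p(1) by (auto simp: carrier_free_algebra)
    from word[OF this] show ?case using insert by (auto intro: add)
  qed
  finally show ?thesis by simp
qed

lemmas cl_simps = palg.hom_0[OF hom_cl] palg.hom_1[OF hom_cl] palg.hom_add[OF hom_cl] palg.hom_minus[OF hom_cl]
  palg.hom_diff[OF hom_cl] palg.hom_mult[OF hom_cl] palg.hom_scal[OF hom_cl] palg.hom_power[OF hom_cl]
  palg.hom_comm[OF hom_cl] palg.mult_scale_left palg.mult_scale_right

lemma central_cl:
  fixes z :: "'g::presentation palg"
  assumes "\<And>g. g \<in> letters_of \<Longrightarrow> z * cl (gen g) = cl (gen g) * z"
  shows "z * x = x * z"
proof (induction x rule: palg_induct)
  case (4 x y)
  then show ?case by (metis mult.assoc)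
qed (simp_all add: assms distrib_left distrib_right cl_simps)

section \<open>Isomorphisms of presented algebras\<close>

text \<open>
  The coset that corresponds to an element of the quotient type; it identifies this type with the
  carrier of \<^const>\<open>presented_algebra\<close>.
\<close>

definition fibre :: "'g::presentation palg \<Rightarrow> 'g free set" where
  "fibre x = {p \<in> car. cl p = x}"

lemma presented_algebra_trivial:
  assumes "\<not> nontrivial TYPE('g::presentation)"
  shows "carrier (presented_algebra letters_of (relations :: ('g free \<times> 'g free) set)) = {rel_ideal letters_of (relations :: ('g free \<times> 'g free) set)}"
proof -
  let ?A = "free_algebra (letters_of :: 'g set)" and ?I = "rel_ideal letters_of (relations :: ('g free \<times> 'g free) set)"
  interpret I: ideal ?I ?A by (rule ideal_rel)
  have "\<one>\<^bsub>?A\<^esub> \<in> ?I" using assms by (simp add: nontrivial_def free_algebra_sel)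
  then have I: "?I = carrier ?A" by (rule I.one_imp_carrier)
  have "?I +>\<^bsub>?A\<^esub> a = ?I" if "a \<in> carrier ?A" for a
    using I.a_rcos_const[of a] that I by simp
  then show ?thesis
    unfolding presented_algebra_def Let_def FactRing_def A_RCOSETS_def' by (auto simp: one_in intro: exI[of _ 1])
qed

lemma rcoset_fibre:
  fixes p :: "'g::presentation free"
  assumes n: "nontrivial TYPE('g)" and p: "p \<in> car"
  shows "rel_ideal letters_of relations +>\<^bsub>free_algebra letters_of\<^esub> p = fibre (cl p)"
proof -
  have I: "rel_ideal letters_of relations = (pideal :: 'g free set)" using n by (simp add: pideal_def nontrivial_def)
  have "r \<in> fibre (cl p) \<longleftrightarrow> (\<exists>h \<in> pideal. r = h + p)" for r
  proof
    assume "r \<in> fibre (cl p)"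
    then have "r - p \<in> pideal" using p by (auto simp: fibre_def cl_eq_iff)
    then show "\<exists>h \<in> pideal. r = h + p" by (intro bexI[of _ "r - p"]) auto
  next
    assume "\<exists>h \<in> pideal. r = h + p"
    then obtain h where h: "h \<in> pideal" "r = h + p" by blast
    then have "r \<in> car" using p pideal_subset add_in by blast
    then show "r \<in> fibre (cl p)" using h p by (auto simp: fibre_def cl_eq_iff)
  qed
  then show ?thesis unfolding I a_r_coset_def' by (auto simp: free_algebra_sel)
qed

lemma presented_algebra_fibre:
  fixes x y :: "'g::presentation palg"
  assumes n: "nontrivial TYPE('g)"
  defines "P \<equiv> presented_algebra letters_of (relations :: ('g free \<times> 'g free) set)"
  shows "carrier P = range (fibre :: 'g palg \<Rightarrow> _)" "fibre x \<otimes>\<^bsub>P\<^esub> fibre y = fibre (x * y)" "fibre x \<oplus>\<^bsub>P\<^esub> fibre y = fibre (x + y)"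
    "\<one>\<^bsub>P\<^esub> = fibre 1" "c \<odot>\<^bsub>P\<^esub> fibre x = fibre (pscale c x)"
proof -
  let ?A = "free_algebra (letters_of :: 'g set)" and ?I = "rel_ideal letters_of (relations :: ('g free \<times> 'g free) set)"
  interpret I: ideal ?I ?A by (rule ideal_rel)
  have surj: "\<exists>p \<in> car. x = cl p \<and> fibre x = ?I +>\<^bsub>?A\<^esub> p" for x :: "'g palg"
    using cl_surj[of x] rcoset_fibre[OF n] by auto
  obtain p where p: "p \<in> car" "x = cl p" "fibre x = ?I +>\<^bsub>?A\<^esub> p" using surj by blast
  obtain r where r: "r \<in> car" "y = cl r" "fibre y = ?I +>\<^bsub>?A\<^esub> r" using surj by blast
  show "carrier P = range fibre"
    unfolding P_def presented_algebra_def Let_def FactRing_def A_RCOSETS_def'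
    using surj rcoset_fibre[OF n] by (fastforce simp: image_iff)
  have mult: "(?I +>\<^bsub>?A\<^esub> a) \<otimes>\<^bsub>?A Quot ?I\<^esub> (?I +>\<^bsub>?A\<^esub> b) = fibre (cl a * cl b)" if "a \<in> car" "b \<in> car" for a b
    using I.rcoset_mult_add[OF that] that by (simp add: FactRing_def free_algebra_sel rcoset_fibre[OF n] mult_in cl_mult)
  show "fibre x \<otimes>\<^bsub>P\<^esub> fibre y = fibre (x * y)"
    unfolding P_def presented_algebra_def Let_def p(3) r(3) using mult p r by simp
  show "fibre x \<oplus>\<^bsub>P\<^esub> fibre y = fibre (x + y)"
    unfolding P_def presented_algebra_def Let_def p(3) r(3) using I.a_rcos_sum[OF p(1) r(1)] p r
    by (simp add: FactRing_def free_algebra_sel rcoset_fibre[OF n] add_in cl_add)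
  show "\<one>\<^bsub>P\<^esub> = fibre 1"
    unfolding P_def presented_algebra_def Let_def
    by (simp add: FactRing_def free_algebra_sel rcoset_fibre[OF n] one_in cl_1)
  show "c \<odot>\<^bsub>P\<^esub> fibre x = fibre (pscale c x)"
    unfolding P_def presented_algebra_def Let_def p(3) using mult[OF scal_in p(1)] p
    by (simp add: pscale_def)
qed

lemma inj_fibre: "inj fibre"
proof (rule injI)
  fix x y :: "'g::presentation palg"
  assume "fibre x = fibre y"
  moreover obtain p where "p \<in> fibre x" using cl_surj[of x] by (auto simp: fibre_def)
  ultimately show "x = y" by (auto simp: fibre_def)
qed

lemma algebras_isomorphicI:
  fixes F :: "'g::presentation palg \<Rightarrow> 'h::presentation palg"
  assumes n: "nontrivial TYPE('g)" "nontrivial TYPE('h)"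
    and F: "bij F" "\<And>x y. F (x + y) = F x + F y" "\<And>x y. F (x * y) = F x * F y" "F 1 = 1" "\<And>c x. F (pscale c x) = pscale c (F x)"
  shows "algebras_isomorphic (presented_algebra letters_of (relations :: ('g free \<times> 'g free) set))
     (presented_algebra letters_of (relations :: ('h free \<times> 'h free) set))"
proof -
  let ?P = "presented_algebra letters_of (relations :: ('g free \<times> 'g free) set)"
  let ?R = "presented_algebra letters_of (relations :: ('h free \<times> 'h free) set)"
  note P = presented_algebra_fibre[OF n(1)] and R = presented_algebra_fibre[OF n(2)]
  define G where "G = (\<lambda>C. fibre (F (inv_into UNIV fibre C)))"
  have G: "G (fibre x) = fibre (F x)" for x by (simp add: G_def inj_fibre)
  have "bij_betw G (carrier ?P) (carrier ?R)"
    unfolding P(1) R(1)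
  proof (rule bij_betwI')
    show "G x = G y \<longleftrightarrow> x = y" if "x \<in> range fibre" "y \<in> range fibre" for x y
      using that F(1) by (auto simp: G inj_eq[OF inj_fibre] bij_def inj_eq)
    show "G x \<in> range fibre" if "x \<in> range fibre" for x using that by (auto simp: G)
    show "\<exists>x \<in> range fibre. y = G x" if y: "y \<in> range fibre" for y
    proof -
      obtain z where z: "y = fibre z" using y by blast
      obtain x where "z = F x" using F(1) by (metis bij_pointE)
      then show ?thesis using z by (intro bexI[of _ "fibre x"]) (auto simp: G)
    qed
  qed
  moreover have "G \<in> ring_hom ?P ?R"
    by (rule ring_hom_memI) (auto simp: P(1) R(1) P(2-4) R(2-4) G F)
  moreover have "G (c \<odot>\<^bsub>?P\<^esub> x) = c \<odot>\<^bsub>?R\<^esub> G x" if "x \<in> carrier ?P" for c x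
    using that by (auto simp: P(1) P(5) R(5) G F)
  ultimately have "G \<in> algebra_iso ?P ?R" by (simp add: algebra_iso_def ring_iso_def)
  then show ?thesis unfolding algebras_isomorphic_def by blast
qed

lemma algebras_isomorphic_trivial:
  assumes n: "\<not> nontrivial TYPE('g::presentation)" "\<not> nontrivial TYPE('h::presentation)"
  shows "algebras_isomorphic (presented_algebra letters_of (relations :: ('g free \<times> 'g free) set))
     (presented_algebra letters_of (relations :: ('h free \<times> 'h free) set))"
proof -
  let ?P = "presented_algebra letters_of (relations :: ('g free \<times> 'g free) set)"
  let ?R = "presented_algebra letters_of (relations :: ('h free \<times> 'h free) set)"
  let ?I = "rel_ideal letters_of (relations :: ('h free \<times> 'h free) set)"
  note P = presented_algebra_trivial[OF n(1)] and R = presented_algebra_trivial[OF n(2)]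
  let ?A = "free_algebra (letters_of :: 'h set)"
  interpret I: ideal ?I ?A by (rule ideal_rel)
  interpret Q: ring "?A Quot ?I" by (rule I.quotient_is_ring)
  have C: "carrier (?A Quot ?I) = {?I}" using R by (simp add: presented_algebra_def Let_def)
  have ops: "?I \<otimes>\<^bsub>?R\<^esub> ?I = ?I" "?I \<oplus>\<^bsub>?R\<^esub> ?I = ?I" "\<one>\<^bsub>?R\<^esub> = ?I" "c \<odot>\<^bsub>?R\<^esub> ?I = ?I" for c
  proof -
    have "?I +>\<^bsub>?A\<^esub> scal c \<in> carrier (?A Quot ?I)"
      by (auto simp: FactRing_def A_RCOSETS_def' scal_in)
    then show "?I \<otimes>\<^bsub>?R\<^esub> ?I = ?I" "?I \<oplus>\<^bsub>?R\<^esub> ?I = ?I" "\<one>\<^bsub>?R\<^esub> = ?I" "c \<odot>\<^bsub>?R\<^esub> ?I = ?I"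
      using Q.m_closed[of ?I ?I] Q.a_closed[of ?I ?I] Q.one_closed C by (simp_all add: presented_algebra_def Let_def)
  qed
  have "(\<lambda>_. ?I) \<in> ring_hom ?P ?R"
    by (rule ring_hom_memI) (auto simp: R ops)
  moreover have "bij_betw (\<lambda>_. ?I) (carrier ?P) (carrier ?R)"
    unfolding P R by (simp add: bij_betw_def)
  ultimately have "(\<lambda>_. ?I) \<in> algebra_iso ?P ?R" by (simp add: algebra_iso_def ring_iso_def ops)
  then show ?thesis unfolding algebras_isomorphic_def by blast
qed

section \<open>The two presentations\<close>

lemma qint_qnum: "qint n = qnum qv n"
  by (simp add: qint_def qnum_def qdiff_def)

interpretation Q: quantum_parameter qv
proof
  show "qv \<noteq> 0" by (simp add: qv_def Zero_fract_def eq_fract)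
  have pow: "qv ^ n = Fract ([:0, 1:] ^ n) 1" for n
    by (induction n) (simp_all add: qv_def One_fract_def)
  show "qv ^ n \<noteq> 1" if "0 < n" for n
  proof
    assume "qv ^ n = 1"
    then have "([:0, 1:] :: complex poly) ^ n = 1" by (simp add: pow One_fract_def eq_fract)
    then have "degree (([:0, 1:] :: complex poly) ^ n) = degree (1 :: complex poly)" by (rule arg_cong)
    then show False using that by (simp add: degree_power_eq)
  qed
qed

lemma kap_qdiff: "Q.kap = qdiff"
  by (simp add: Q.kap_def qdiff_def)

lemma wt_qint: "qint (2 * l) / of_int l = Q.wt l"
  by (simp add: Q.wt_def qint_qnum)

lemma Q_wt_minus: "Q.wt (- l) = Q.wt l"
proof -
  have "qnum qv (- n) = - qnum qv n" for n
    by (simp add: qnum_def minus_divide_left)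
  from this[of "2 * l"] show ?thesis by (simp add: Q.wt_def)
qed

lemma qint2: "qint 2 \<noteq> 0"
  unfolding qint_qnum by (rule Q.qnum_nz) simp

lemma Q_wt_1: "Q.wt 1 = qint 2" "Q.wt (- 1) = qint 2"
  by (simp_all add: Q_wt_minus Q.wt_1 qint_qnum)

text \<open>
  A type cannot depend on a variable, so the two quotients are formed for one constant degree. It is a
  counterexample to the theorem if there is one; about it only \<open>0 \<le> d0\<close> is used until the end.
\<close>

definition d0 :: int where
  "d0 = (SOME d. 0 \<le> d \<and> \<not> algebras_isomorphic (U_algebra d) (F_quotient d))"

instantiation U_letter :: presentation
begin
definition "letters_of_U_letter = U_letters"
definition "relations_U_letter = U_rels d0"
instance
  by standard (simp add: letters_of_U_letter_def relations_U_letter_def U_rels_in)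
end

instantiation F_letter :: presentation
begin
definition "letters_of_F_letter = F_letters d0"
definition "relations_F_letter = F_rels d0"
instance
  by standard (simp add: letters_of_F_letter_def relations_F_letter_def F_rels_in)
end

section \<open>The finitely presented algebra satisfies the current relations\<close>

text \<open>
  The elements of the finitely presented algebra. \<open>Fc n\<close> is \<open>C\<^bsup>n/2\<^esup>\<close>.
\<close>

definition Fc :: "int \<Rightarrow> F_letter palg" where "Fc n = cl (el_Cpow n)"
definition FE :: "int \<Rightarrow> F_letter palg" where "FE n = cl (el_E n)"
definition FF :: "int \<Rightarrow> F_letter palg" where "FF n = cl (el_F d0 n)"
definition FH :: "int \<Rightarrow> F_letter palg" where "FH n = cl (el_H d0 n)"
definition FPsi :: "int \<Rightarrow> F_letter palg" where "FPsi n = cl (el_Psi d0 n)"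
definition FPhi :: "int \<Rightarrow> F_letter palg" where "FPhi n = cl (el_Phi d0 n)"
definition FS :: "F_letter palg" where "FS = cl (gen F_S)"
definition FSi :: "F_letter palg" where "FSi = cl (gen F_Si)"
definition FK :: "F_letter palg" where "FK = cl el_K"
definition FKi :: "F_letter palg" where "FKi = cl el_Ki"

locale finite_presentation =
  assumes nF: "nontrivial TYPE(F_letter)" and d0: "0 \<le> d0"
begin

lemma F_rel: "(p, r) \<in> F_rels d0 \<Longrightarrow> cl p = cl r"
  using cl_relation[OF nF] by (simp add: relations_F_letter_def)

lemma F_S_inv: "FS * FSi = 1" "FSi * FS = 1"
  using F_rel[OF F_rels.S_inv1] F_rel[OF F_rels.S_inv2] by (simp_all add: cl_simps FS_def FSi_def)

lemma F_C_inv: "cl (gen F_C) * cl (gen F_Ci) = 1" "cl (gen F_Ci) * cl (gen F_C) = 1"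
  using F_rel[OF F_rels.C_inv1] F_rel[OF F_rels.C_inv2] by (simp_all add: cl_simps)

lemma F_C_central: "cl (gen F_C) * x = x * cl (gen F_C)"
  by (rule central_cl) (use F_rel[OF F_rels.C_central] in \<open>simp add: cl_simps letters_of_F_letter_def\<close>)

lemma Fc_eq: "Fc n = (if 0 \<le> n then cl (gen F_C) ^ nat n else cl (gen F_Ci) ^ nat (- n))"
  by (simp add: Fc_def el_Cpow_def cl_simps)

lemma Fc_0 [simp]: "Fc 0 = 1" and Fc_1: "Fc 1 = cl (gen F_C)" and Fc_m1: "Fc (- 1) = cl (gen F_Ci)"
  by (simp_all add: Fc_eq)

lemma Fc_add: "Fc (m + n) = Fc m * Fc n"
  using zpow_add[OF F_C_inv] by (simp add: Fc_eq zpow_def)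

lemma Fc_central: "Fc n * x = x * Fc n"
  using zpow_central[OF F_C_central inverse_central[OF F_C_inv F_C_central]] by (simp add: Fc_eq zpow_def)

lemma Fc_mult: "Fc m * Fc n = Fc (m + n)" "Fc m * (Fc n * x) = Fc (m + n) * x"
  by (simp_all add: Fc_add mult.assoc)

lemma Fc_left: "x * (Fc n * y) = Fc n * (x * y)"
  by (metis Fc_central mult.assoc)

lemma comm_Fc: "comm x (Fc n * y) = Fc n * comm x y" "comm (Fc n * y) x = Fc n * comm y x" "comm x (Fc n) = 0"
  "comm (Fc n) x = 0"
proof -
  show 1: "comm x (Fc n * y) = Fc n * comm x y" for x y by (rule palg.comm_central) (rule Fc_central)
  show "comm (Fc n * y) x = Fc n * comm y x" using 1[of x y] comm_swap[of x] by (metis mult_minus_right neg_equal_iff_equal)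
qed (simp_all add: comm_def Fc_central)

lemma Fc_power: "Fc (int n) = Fc 1 ^ n"
  by (simp add: Fc_eq)

lemma Fc_cancel: "Fc n * x = Fc n * y \<Longrightarrow> x = y"
proof -
  assume "Fc n * x = Fc n * y"
  then have "Fc (- n) * (Fc n * x) = Fc (- n) * (Fc n * y)" by simp
  then show ?thesis by (simp add: Fc_mult)
qed

subsection \<open>The shifts by \<open>H\<^sub>1\<close> and \<open>H\<close> with index \<open>-1\<close>\<close>

lemma FH_1: "FH 1 = cl (gen F_H)" and FH_m1: "FH (- 1) = cl (gen F_Hm)"
  by (simp_all add: FH_def el_H_def)

lemma FE_up_def: "0 \<le> n \<Longrightarrow> FE (n + 1) = pscale (1 / qint 2) (Fc 1 * comm (FH 1) (FE n))"
  by (simp add: FE_def el_E_def nat_add_distrib cl_simps Fc_1 FH_1)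

lemma FE_down_def: "n \<le> 0 \<Longrightarrow> FE (n - 1) = pscale (1 / qint 2) (Fc 1 * comm (FH (- 1)) (FE n))"
proof -
  assume "n \<le> 0"
  then have "nat (- (n - 1)) = Suc (nat (- n))" "\<not> 0 \<le> n - 1" by simp_all
  then have "el_E (n - 1) = scal (1 / qint 2) * gen F_C * comm (gen F_Hm) (el_E n)"
    using \<open>n \<le> 0\<close> by (cases "n = 0") (simp_all add: el_E_def)
  then show ?thesis by (simp add: FE_def cl_simps Fc_1 FH_m1)
qed

lemma FF_up_def: "d0 \<le> n \<Longrightarrow> FF (n + 1) = - pscale (1 / qint 2) (Fc (- 1) * comm (FH 1) (FF n))"
proof -
  assume n: "d0 \<le> n"
  then have "nat (n + 1 - d0) = Suc (nat (n - d0))" by simp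
  then show ?thesis using n by (simp add: FF_def el_F_def cl_simps Fc_m1 FH_1)
qed

lemma FF_down_def: "n \<le> d0 \<Longrightarrow> FF (n - 1) = - pscale (1 / qint 2) (Fc (- 1) * comm (FH (- 1)) (FF n))"
proof -
  assume n: "n \<le> d0"
  then have "nat (d0 - (n - 1)) = Suc (nat (d0 - n))" "\<not> d0 \<le> n - 1" by simp_all
  then have "el_F d0 (n - 1) = - (scal (1 / qint 2) * gen F_Ci * comm (gen F_Hm) (el_F d0 n))"
    using n by (cases "n = d0") (simp_all add: el_F_def)
  then show ?thesis by (simp add: FF_def cl_simps Fc_m1 FH_m1)
qed

lemma H_E_base:
  assumes "1 \<le> l" "l \<le> max 2 (2 * d0 - 2)"
  shows "comm (FH l) (FE (- 1)) = pscale (Q.wt l) (Fc (- l) * FE (l - 1))"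
    and "comm (FH (- l)) (FE 1) = pscale (Q.wt l) (Fc (- l) * FE (- l + 1))"
    and "comm (FH l) (FF (d0 - 1)) = - pscale (Q.wt l) (Fc l * FF (d0 + l - 1))"
    and "comm (FH (- l)) (FF (d0 + 1)) = - pscale (Q.wt l) (Fc l * FF (d0 - l + 1))"
  using F_rel[OF F_rels.H_E_pos[OF assms]] F_rel[OF F_rels.H_E_neg[OF assms]]
    F_rel[OF F_rels.H_F_pos[OF assms]] F_rel[OF F_rels.H_F_neg[OF assms]]
  by (simp_all add: cl_simps FH_def FE_def FF_def Fc_def wt_qint)

lemma H1_Hm1: "comm (FH 1) (FH (- 1)) = pscale (qint 2 / qdiff) (Fc 2 - Fc (- 2))"
  using F_rel[OF F_rels.H1_Hm1] by (simp add: cl_simps FH_def Fc_def palg.scale_right_diff_distrib)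

lemma H1_Hm1_comm: "comm (comm (FH 1) (FH (- 1))) x = 0"
  unfolding H1_Hm1 by (simp add: comm_def palg.mult_scale_left palg.mult_scale_right left_diff_distrib right_diff_distrib Fc_central)

lemma
  shows H1_E: "comm (FH 1) (FE n) = pscale (qint 2) (Fc (- 1) * FE (n + 1))"
    and Hm1_E: "comm (FH (- 1)) (FE n) = pscale (qint 2) (Fc (- 1) * FE (n - 1))"
proof -
  let ?u = "pscale (1 / qint 2) (Fc 1 * FH 1)" and ?t = "pscale (1 / qint 2) (Fc 1 * FH (- 1))"
  have base: "comm ?u (FE (0 - 1)) = FE 0" "comm ?t (FE (0 + 1)) = FE 0"
    using H_E_base(1,2)[of 1] qint2 by (simp_all add: comm_Fc Q_wt_1 palg.mult_scale_right Fc_mult)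
  have ut: "comm (comm ?u ?t) (FE k) = 0" for k
    by (simp add: comm_Fc H1_Hm1_comm)
  have up: "comm ?u (FE k) = FE (k + 1)" if "0 \<le> k" for k using FE_up_def[OF that] by (simp add: comm_Fc)
  have down: "comm ?t (FE k) = FE (k - 1)" if "k \<le> 0" for k using FE_down_def[OF that] by (simp add: comm_Fc)
  note sh = palg.shift_two_sided[OF up down base ut]
  have "Fc 1 * comm (FH 1) (FE n) = Fc 1 * pscale (qint 2) (Fc (- 1) * FE (n + 1))"
    using arg_cong[OF sh(1)[of n], of "pscale (qint 2)"] qint2 by (simp add: comm_Fc palg.mult_scale_right Fc_mult)
  then show "comm (FH 1) (FE n) = pscale (qint 2) (Fc (- 1) * FE (n + 1))" by (rule Fc_cancel)
  have "Fc 1 * comm (FH (- 1)) (FE n) = Fc 1 * pscale (qint 2) (Fc (- 1) * FE (n - 1))"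
    using arg_cong[OF sh(2)[of n], of "pscale (qint 2)"] qint2 by (simp add: comm_Fc palg.mult_scale_right Fc_mult)
  then show "comm (FH (- 1)) (FE n) = pscale (qint 2) (Fc (- 1) * FE (n - 1))" by (rule Fc_cancel)
qed

lemma
  shows H1_F: "comm (FH 1) (FF n) = - pscale (qint 2) (Fc 1 * FF (n + 1))"
    and Hm1_F: "comm (FH (- 1)) (FF n) = - pscale (qint 2) (Fc 1 * FF (n - 1))"
proof -
  let ?u = "pscale (- (1 / qint 2)) (Fc (- 1) * FH 1)" and ?t = "pscale (- (1 / qint 2)) (Fc (- 1) * FH (- 1))"
  have base: "comm ?u (FF (d0 - 1)) = FF d0" "comm ?t (FF (d0 + 1)) = FF d0"
    using H_E_base(3,4)[of 1] qint2
    by (simp_all add: comm_Fc Q_wt_1 palg.mult_scale_right Fc_mult comm_minus_left palg.scale_minus_left)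
  have ut: "comm (comm ?u ?t) (FF k) = 0" for k
    by (simp add: comm_Fc H1_Hm1_comm comm_minus_left comm_minus_right palg.scale_minus_left)
  have up: "comm ?u (FF k) = FF (k + 1)" if "d0 \<le> k" for k
    using FF_up_def[OF that] by (simp add: comm_Fc comm_minus_left palg.scale_minus_left)
  have down: "comm ?t (FF k) = FF (k - 1)" if "k \<le> d0" for k
    using FF_down_def[OF that] by (simp add: comm_Fc comm_minus_left palg.scale_minus_left)
  note sh = palg.shift_two_sided[OF up down base ut]
  have "Fc (- 1) * comm (FH 1) (FF n) = Fc (- 1) * - pscale (qint 2) (Fc 1 * FF (n + 1))"
    using arg_cong[OF sh(1)[of n], of "pscale (- qint 2)"] qint2
    by (simp add: comm_Fc palg.mult_scale_right Fc_mult comm_minus_left palg.scale_minus_left)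
  then show "comm (FH 1) (FF n) = - pscale (qint 2) (Fc 1 * FF (n + 1))" by (rule Fc_cancel)
  have "Fc (- 1) * comm (FH (- 1)) (FF n) = Fc (- 1) * - pscale (qint 2) (Fc 1 * FF (n - 1))"
    using arg_cong[OF sh(2)[of n], of "pscale (- qint 2)"] qint2
    by (simp add: comm_Fc palg.mult_scale_right Fc_mult comm_minus_left palg.scale_minus_left)
  then show "comm (FH (- 1)) (FF n) = - pscale (qint 2) (Fc 1 * FF (n - 1))" by (rule Fc_cancel)
qed

end

context finite_presentation
begin

subsection \<open>Weights under conjugation by \<open>S\<close>\<close>

text \<open>
  Conjugation by \<open>S\<close> multiplies \<open>x\<close> by \<open>r\<close>. As weights are multiplicative, those of the generators determine
  those of all elements that are built from them.
\<close>

definition weight :: "Cv \<Rightarrow> F_letter palg \<Rightarrow> bool" where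
  "weight r x \<longleftrightarrow> FS * x = pscale r (x * FS)"

lemma weight_mult: "weight r x \<Longrightarrow> weight t y \<Longrightarrow> weight (r * t) (x * y)"
proof -
  assume x: "weight r x" and y: "weight t y"
  have "FS * (x * y) = pscale r (x * (FS * y))"
    using x unfolding weight_def mult.assoc[symmetric] by (simp add: palg.mult_scale_left)
  also have "\<dots> = pscale (r * t) (x * y * FS)"
    using y unfolding weight_def by (simp add: palg.mult_scale_right mult.assoc)
  finally show ?thesis by (simp add: weight_def)
qed

lemma weight_add: "weight r x \<Longrightarrow> weight r y \<Longrightarrow> weight r (x + y)"
  by (simp add: weight_def distrib_left distrib_right palg.scale_right_distrib)

lemma weight_diff: "weight r x \<Longrightarrow> weight r y \<Longrightarrow> weight r (x - y)"
  by (simp add: weight_def left_diff_distrib right_diff_distrib palg.scale_right_diff_distrib)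

lemma weight_minus: "weight r x \<Longrightarrow> weight r (- x)"
  by (simp add: weight_def)

lemma weight_scale: "weight r x \<Longrightarrow> weight r (pscale a x)"
  by (simp add: weight_def palg.mult_scale_left palg.mult_scale_right mult.commute)

lemma weight_comm: "weight r x \<Longrightarrow> weight t y \<Longrightarrow> weight (r * t) (comm x y)"
  unfolding comm_def using weight_mult[of r x t y] weight_mult[of t y r x]
  by (intro weight_diff) (simp_all add: mult.commute)

lemma weight_c: "weight r x \<Longrightarrow> weight r (Fc n * x)"
  by (simp add: weight_def Fc_left palg.mult_scale_right mult.assoc)

lemma weight_1_iff: "weight 1 x \<longleftrightarrow> comm FS x = 0"
  by (simp add: weight_def comm_eq_0_iff)

lemma weight_H: "weight 1 (FH 1)" "weight 1 (FH (- 1))"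
  using F_rel[OF F_rels.S_H_pos] F_rel[OF F_rels.S_H_neg]
  by (simp_all add: weight_1_iff cl_simps FH_def FS_def)

lemma weight_conj: "FS * x * FSi = pscale r x \<Longrightarrow> weight r x"
proof -
  assume "FS * x * FSi = pscale r x"
  then have "FS * x * (FSi * FS) = pscale r x * FS" by (simp flip: mult.assoc)
  then show ?thesis by (simp add: weight_def F_S_inv palg.mult_scale_left)
qed

lemma weight_E: "weight qv (FE n)"
proof -
  have 0: "weight qv (FE 0)"
    by (rule weight_conj) (use F_rel[OF F_rels.S_E] in \<open>simp add: cl_simps FS_def FSi_def FE_def\<close>)
  show ?thesis
  proof (induction n rule: int_induct[where k = 0])
    case (step1 i)
    then show ?case
      using FE_up_def[of i] weight_comm[OF weight_H(1) step1(2)] by (simp add: weight_scale weight_c)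
  next
    case (step2 i)
    then show ?case
      using FE_down_def[of i] weight_comm[OF weight_H(2) step2(2)] by (simp add: weight_scale weight_c)
  qed (rule 0)
qed

lemma weight_F: "weight (inverse qv) (FF n)"
proof -
  have 0: "weight (inverse qv) (FF d0)"
    by (rule weight_conj) (use F_rel[OF F_rels.S_F] in \<open>simp add: cl_simps FS_def FSi_def FF_def\<close>)
  show ?thesis
  proof (induction n rule: int_induct[where k = d0])
    case (step1 i)
    then show ?case
      using FF_up_def[of i] weight_comm[OF weight_H(1) step1(2)] by (simp add: weight_scale weight_c weight_minus)
  next
    case (step2 i)
    then show ?case
      using FF_down_def[of i] weight_comm[OF weight_H(2) step2(2)] by (simp add: weight_scale weight_c weight_minus)
  qed (rule 0)
qed

lemma FK_eq: "FK = FS * (FS * Fc (- 1))" and FKi_eq: "FKi = Fc 1 * (FSi * FSi)"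
  by (simp_all add: FK_def FKi_def el_K_def el_Ki_def cl_simps FS_def FSi_def Fc_1 Fc_m1 power2_eq_square mult.assoc)

lemma F_S_inv2: "FS * (FSi * x) = x" "FSi * (FS * x) = x"
  by (simp_all add: F_S_inv flip: mult.assoc)

lemma FK_inv: "FK * FKi = 1" "FKi * FK = 1"
proof -
  have "FK * FKi = FS * (FS * (Fc (- 1) * (Fc 1 * (FSi * FSi))))" by (simp add: FK_eq FKi_eq mult.assoc)
  then show "FK * FKi = 1" by (simp add: Fc_mult F_S_inv2 F_S_inv)
  have "FKi * FK = Fc 1 * (FSi * (FSi * (FS * (FS * Fc (- 1)))))" by (simp add: FK_eq FKi_eq mult.assoc)
  then show "FKi * FK = 1" by (simp add: Fc_mult F_S_inv2 F_S_inv)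
qed

lemma weight_K: "weight 1 FK"
  using Fc_central[of "- 1" FS] by (simp add: weight_def FK_eq mult.assoc)

lemma weight_Ki: "weight 1 FKi"
  by (simp add: weight_def FKi_eq Fc_left F_S_inv2 F_S_inv mult.assoc)

text \<open>
  Up to a central factor \<open>K\<close> is \<open>S\<^sup>2\<close>.
\<close>

lemma weight_FK_mult: "weight r x \<Longrightarrow> FK * x = pscale (r\<^sup>2) (x * FK)"
proof -
  assume x: "weight r x"
  have "FK * x = Fc (- 1) * (FS * (FS * x))" by (simp add: FK_eq mult.assoc Fc_left)
  also have "FS * x = pscale r (x * FS)" using x by (simp add: weight_def)
  also have "FS * pscale r (x * FS) = pscale r (pscale r (x * FS) * FS)"
    using x by (simp add: weight_def palg.mult_scale_right flip: mult.assoc)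
  also have "Fc (- 1) * pscale r (pscale r (x * FS) * FS) = pscale (r\<^sup>2) (x * FK)"
    by (simp add: FK_eq palg.mult_scale_left palg.mult_scale_right mult.assoc Fc_left power2_eq_square Fc_central[of "- 1" FS, symmetric])
  finally show ?thesis .
qed

lemma weight_FKi_mult:
  assumes "weight r x" "r \<noteq> 0"
  shows "FKi * x = pscale ((inverse r)\<^sup>2) (x * FKi)"
proof -
  have "FKi * (FK * x) * FKi = FKi * pscale (r\<^sup>2) (x * FK) * FKi"
    using weight_FK_mult[OF assms(1)] by simp
  then have "x * FKi = pscale (r\<^sup>2) (FKi * x)"
    by (simp add: mult.assoc FK_inv palg.mult_scale_left palg.mult_scale_right) (simp add: FK_inv flip: mult.assoc)
  then have "pscale ((inverse r)\<^sup>2) (x * FKi) = pscale ((inverse r)\<^sup>2 * r\<^sup>2) (FKi * x)" by simp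
  also have "(inverse r)\<^sup>2 * r\<^sup>2 = 1" using assms(2) by (simp flip: power_mult_distrib)
  finally show ?thesis by simp
qed

lemma el_Phi_high: "min 2 (d0 - 1) \<le> n \<Longrightarrow> el_Phi d0 n = el_Phi_high d0 n"
  by (simp add: el_Phi_def)

lemma FPhi_high: "d0 < n \<Longrightarrow> FPhi n = 0"
  by (simp add: FPhi_def el_Phi_high el_Phi_high_def cl_simps)

lemma FPhi_d: "FPhi d0 = FKi"
  by (simp add: FPhi_def el_Phi_high el_Phi_high_def FKi_def)

lemma FPhi_d1: "FPhi (d0 - 1) = - pscale qdiff (FKi * FH (- 1))"
  by (simp add: FPhi_def el_Phi_high el_Phi_high_def cl_simps FKi_def FH_m1)

lemma FPsi_neg: "n < 0 \<Longrightarrow> FPsi n = 0"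
  by (simp add: FPsi_def el_Psi_def el_Psi_low_def cl_simps)

lemma FPsi_0: "FPsi 0 = FK"
  by (simp add: FPsi_def el_Psi_def el_Psi_low_def FK_def)

lemma FPsi_1: "FPsi 1 = pscale qdiff (FK * FH 1)"
  by (simp add: FPsi_def el_Psi_def el_Psi_low_def cl_simps FK_def FH_1)

lemma FPsi_solved: "1 < n \<Longrightarrow> FPsi n = Fc n * (pscale qdiff (comm (FE 0) (FF n)) + Fc n * FPhi n)"
  by (simp add: FPsi_def el_Psi_def FPhi_def el_Phi_high cl_simps Fc_def FE_def FF_def)

lemma FPhi_solved: "n < min 2 (d0 - 1) \<Longrightarrow> FPhi n = Fc (- n) * (Fc (- n) * FPsi n - pscale qdiff (comm (FE 0) (FF n)))"
  by (simp add: FPsi_def el_Psi_def FPhi_def el_Phi_def cl_simps Fc_def FE_def FF_def min_le_iff_disj)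

lemma weight_EF: "weight 1 (comm (FE k) (FF l))"
proof -
  have "qv * inverse qv = 1" using Q.v_nz by simp
  then show ?thesis using weight_comm[OF weight_E weight_F, of k l] by simp
qed

lemma weight_FPsi_low: "n \<le> 1 \<Longrightarrow> weight 1 (FPsi n)"
proof -
  assume "n \<le> 1"
  then consider "n < 0" | "n = 0" | "n = 1" by linarith
  then show ?thesis
  proof cases
    case 1
    then show ?thesis by (simp add: FPsi_neg weight_def)
  next
    case 2
    then show ?thesis by (simp add: FPsi_0 weight_K)
  next
    case 3
    then show ?thesis using weight_mult[OF weight_K weight_H(1)] by (simp add: FPsi_1 weight_scale)
  qed
qed

lemma weight_FPhi: "weight 1 (FPhi n)"
proof -
  consider "d0 < n" | "n = d0" | "n = d0 - 1" | "n < min 2 (d0 - 1)" | "2 \<le> n" "n \<le> d0 - 2" by linarith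
  then show ?thesis
  proof cases
    case 1
    then show ?thesis by (simp add: FPhi_high weight_def)
  next
    case 2
    then show ?thesis by (simp add: FPhi_d weight_Ki)
  next
    case 3
    then show ?thesis using weight_mult[OF weight_Ki weight_H(2)] by (simp add: FPhi_d1 weight_scale weight_minus)
  next
    case 4
    then have "weight 1 (FPsi n)" by (intro weight_FPsi_low) simp
    then show ?thesis unfolding FPhi_solved[OF 4]
      by (intro weight_c weight_diff weight_scale weight_EF)
  next
    case 5
    then show ?thesis using F_rel[OF F_rels.S_Phi[OF 5]] by (simp add: weight_1_iff FPhi_def FS_def cl_simps)
  qed
qed

lemma weight_FPsi: "weight 1 (FPsi n)"
proof (cases "n \<le> 1")
  case True
  then show ?thesis by (rule weight_FPsi_low)
next
  case False
  then have "FPsi n = Fc n * (pscale qdiff (comm (FE 0) (FF n)) + Fc n * FPhi n)" by (intro FPsi_solved) simp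
  then show ?thesis by (auto intro!: weight_c weight_add weight_scale weight_EF weight_FPhi)
qed

subsection \<open>The exponential formulas\<close>

lemma qdiff_nz: "qdiff \<noteq> 0"
  using Q.kap_nz by (simp add: kap_qdiff)

definition FA :: "F_letter palg fps" where
  "FA = Abs_fps (\<lambda>j. if j = 0 then 0 else pscale qdiff (FH (int j)))"

definition FB :: "F_letter palg fps" where
  "FB = Abs_fps (\<lambda>j. if j = 0 then 0 else - pscale qdiff (FH (- int j)))"

text \<open>
  The elements \<open>H\<^sub>n\<close> are defined by a logarithm of \<open>K\<^bsup>-1\<^esup> \<Psi>\<close> in the free algebra, where \<open>K\<^bsup>-1\<^esup> K = 1\<close> fails; the
  logarithm ignores the constant coefficient, which becomes \<open>1\<close> only in the quotient. The
  coefficient of degree \<open>1\<close> has to be compared with the letter \<open>H\<^sub>1\<close> separately.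
\<close>

lemma FPsi_exp: "FPsi (int n) = FK * fps_nth (palg.sexp FA) n"
proof -
  define P where "P = Abs_fps (\<lambda>k. el_Ki * el_Psi d0 (int k))"
  have P: "cl (fps_nth P k) = FKi * FPsi (int k)" for k
    by (simp add: P_def cl_simps FKi_def FPsi_def)
  have e: "fps_nth (palg.sexp (Abs_fps (\<lambda>j. cl (fps_nth (series_log P) j)))) k = cl (fps_nth P k)" for k
    by (rule palg.hom_series_log[OF hom_cl]) (simp add: P FPsi_0 FK_inv)
  have s0: "fps_nth (series_log P) 0 = 0" by (simp add: series_log_def series_log_coeff.simps)
  have "cl (fps_nth (series_log P) j) = fps_nth FA j" for j
  proof -
    consider "j = 0" | "j = 1" | "j > 1" by linarith
    then show ?thesis
    proof cases
      case 1
      then show ?thesis by (simp add: FA_def s0 cl_simps)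
    next
      case 2
      have "cl (fps_nth (series_log P) 1) = FKi * FPsi 1"
        using e[of 1] by (simp add: palg.sexp_nth P)
      also have "\<dots> = pscale qdiff (FH 1)"
        by (simp add: FPsi_1 palg.mult_scale_right FK_inv flip: mult.assoc)
      finally show ?thesis using 2 by (simp add: FA_def)
    next
      case 3
      then have "el_H d0 (int j) = scal (1 / qdiff) * fps_nth (series_log P) j" by (simp add: el_H_def P_def)
      then show ?thesis using 3 qdiff_nz by (simp add: FA_def FH_def cl_simps)
    qed
  qed
  then have "Abs_fps (\<lambda>j. cl (fps_nth (series_log P) j)) = FA" by (intro fps_ext) simp
  with e[of n] have "fps_nth (palg.sexp FA) n = FKi * FPsi (int n)" by (simp add: P)
  then show ?thesis by (simp add: FK_inv flip: mult.assoc)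
qed

lemma FPhi_exp: "FPhi (d0 - int n) = FKi * fps_nth (palg.sexp FB) n"
proof -
  define P where "P = Abs_fps (\<lambda>k. el_K * el_Phi d0 (d0 - int k))"
  have P: "cl (fps_nth P k) = FK * FPhi (d0 - int k)" for k
    by (simp add: P_def cl_simps FK_def FPhi_def)
  have e: "fps_nth (palg.sexp (Abs_fps (\<lambda>j. cl (fps_nth (series_log P) j)))) k = cl (fps_nth P k)" for k
    by (rule palg.hom_series_log[OF hom_cl]) (simp add: P FPhi_d FK_inv)
  have s0: "fps_nth (series_log P) 0 = 0" by (simp add: series_log_def series_log_coeff.simps)
  have "cl (fps_nth (series_log P) j) = fps_nth FB j" for j
  proof -
    consider "j = 0" | "j = 1" | "j > 1" by linarith
    then show ?thesis
    proof cases
      case 1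
      then show ?thesis by (simp add: FB_def s0 cl_simps)
    next
      case 2
      have "cl (fps_nth (series_log P) 1) = FK * FPhi (d0 - 1)"
        using e[of 1] by (simp add: palg.sexp_nth P)
      also have "\<dots> = - pscale qdiff (FH (- 1))"
        by (simp add: FPhi_d1 palg.mult_scale_right FK_inv flip: mult.assoc)
      finally show ?thesis using 2 by (simp add: FB_def)
    next
      case 3
      then have "el_H d0 (- int j) = - (scal (1 / qdiff) * fps_nth (series_log P) j)" by (simp add: el_H_def P_def)
      then show ?thesis using 3 qdiff_nz by (simp add: FB_def FH_def cl_simps)
    qed
  qed
  then have "Abs_fps (\<lambda>j. cl (fps_nth (series_log P) j)) = FB" by (intro fps_ext) simp
  with e[of n] have "fps_nth (palg.sexp FB) n = FK * FPhi (d0 - int n)" by (simp add: P)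
  then show ?thesis by (simp add: FK_inv flip: mult.assoc)
qed

text \<open>
  If all coefficients of the exponential commute with \<open>S\<close>, so do those of the series.
\<close>

lemma weight_sexp_coeffs:
  assumes "fps_nth P 0 = 0" "\<And>n. weight 1 (fps_nth (palg.sexp P) n)"
  shows "weight 1 (fps_nth P n)"
proof (induction n rule: less_induct)
  case (less n)
  show ?case
  proof (cases "n = 0")
    case False
    then have "comm FS (fps_nth (palg.sexp P) n) = comm FS (fps_nth P n)"
      by (intro palg.comm_sexp_top) (use less assms(1) in \<open>auto simp: weight_1_iff\<close>)
    then show ?thesis using assms(2)[of n] by (simp add: weight_1_iff)
  qed (simp add: assms weight_def)
qed

lemma weight_FH: "n \<noteq> 0 \<Longrightarrow> weight 1 (FH n)"
proof -
  have "weight 1 (fps_nth FA j)" for j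
  proof (rule weight_sexp_coeffs)
    fix n
    have "fps_nth (palg.sexp FA) n = FKi * FPsi (int n)" by (simp add: FPsi_exp FK_inv flip: mult.assoc)
    then show "weight 1 (fps_nth (palg.sexp FA) n)" using weight_mult[OF weight_Ki weight_FPsi] by simp
  qed (simp add: FA_def)
  moreover have "weight 1 (fps_nth FB j)" for j
  proof (rule weight_sexp_coeffs)
    fix n
    have "fps_nth (palg.sexp FB) n = FK * FPhi (d0 - int n)" by (simp add: FPhi_exp FK_inv flip: mult.assoc)
    then show "weight 1 (fps_nth (palg.sexp FB) n)" using weight_mult[OF weight_K weight_FPhi] by simp
  qed (simp add: FB_def)
  moreover have "FH n = (if n > 0 then pscale (1 / qdiff) (fps_nth FA (nat n)) else - pscale (1 / qdiff) (fps_nth FB (nat (- n))))" if "n \<noteq> 0"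
    using that qdiff_nz by (simp add: FA_def FB_def)
  ultimately show "n \<noteq> 0 \<Longrightarrow> weight 1 (FH n)" by (simp add: weight_scale weight_minus)
qed

lemma FK_H: "n \<noteq> 0 \<Longrightarrow> comm (FH n) FK = 0" "n \<noteq> 0 \<Longrightarrow> comm (FH n) FKi = 0"
  using weight_FK_mult[OF weight_FH[of n]] weight_FKi_mult[OF weight_FH[of n]] by (simp_all add: comm_eq_0_iff)

end

context finite_presentation
begin

subsection \<open>The normalised generators\<close>

lemmas Fc_lefts = Fc_left[where x = "FF a" for a] Fc_left[where x = "FE a" for a] Fc_left[where x = FK] Fc_left[where x = FKi]

definition N where "N = max 2 (2 * d0 - 2)"
definition M where "M = max 2 (2 * d0 - 1)"
definition ng :: "int \<Rightarrow> F_letter palg" where "ng n = Fc (4 * n)"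
definition nf :: "int \<Rightarrow> F_letter palg" where "nf k = Fc (2 * k) * FF k"
definition nh :: "int \<Rightarrow> F_letter palg" where "nh l = Fc \<bar>l\<bar> * FH l"
definition npsi :: "int \<Rightarrow> F_letter palg" where "npsi s = Fc s * FPsi s"
definition nphi :: "int \<Rightarrow> F_letter palg" where "nphi s = Fc (- s) * FPhi s"

text \<open>
  Multiplication by \<open>C\<^sup>l\<close> moves all powers of \<open>C\<close> to \<open>\<phi>\<close> and into the rescaling.
\<close>

lemma E_F_normalised:
  "comm (FE k) (FF l) = pscale (1 / qdiff) (Fc (k - l) * FPsi (k + l) - Fc (l - k) * FPhi (k + l))
    \<longleftrightarrow> pscale qdiff (comm (FE k) (nf l)) = npsi (k + l) - ng l * nphi (k + l)"
  (is "?c = pscale _ ?r \<longleftrightarrow> _")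
proof -
  have "?c = pscale (1 / qdiff) ?r \<longleftrightarrow> pscale qdiff ?c = pscale qdiff (pscale (1 / qdiff) ?r)"
    using qdiff_nz by (simp only: palg.scale_cancel_left) simp
  also have "\<dots> \<longleftrightarrow> pscale qdiff ?c = ?r" using qdiff_nz by simp
  also have "\<dots> \<longleftrightarrow> Fc (2 * l) * pscale qdiff ?c = Fc (2 * l) * ?r"
    by (rule iffI, simp, erule Fc_cancel)
  also have "Fc (2 * l) * pscale qdiff ?c = pscale qdiff (comm (FE k) (nf l))"
    by (simp add: nf_def comm_Fc palg.mult_scale_right)
  also have "Fc (2 * l) * ?r = npsi (k + l) - ng l * nphi (k + l)"
    by (simp add: npsi_def nphi_def ng_def right_diff_distrib Fc_mult algebra_simps)
  finally show ?thesis .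
qed

lemma E_F_square:
  assumes "\<bar>k\<bar> \<le> M" "\<bar>l\<bar> \<le> M"
  shows "pscale qdiff (comm (FE k) (nf l)) = npsi (k + l) - ng l * nphi (k + l)"
  unfolding E_F_normalised[symmetric]
  using F_rel[OF F_rels.E_F[of k d0 l]] assms
  by (simp add: M_def cl_simps FE_def FF_def FPsi_def FPhi_def Fc_def)

text \<open>
  Either \<open>\<Psi>\<^sub>n\<close> or \<open>\<Phi>\<^sub>n\<close> is defined by this relation, except for the few \<open>n\<close> where both are given; these lie in the
  square where the relation is imposed.
\<close>

lemma E_F_zero: "pscale qdiff (comm (FE 0) (nf n)) = npsi n - ng n * nphi n"
proof -
  consider "1 < n" | "n < min 2 (d0 - 1)" | "d0 - 1 \<le> n" "n \<le> 1" by linarith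
  then show ?thesis
  proof cases
    case 1
    have "npsi n = pscale qdiff (comm (FE 0) (nf n)) + ng n * nphi n"
      unfolding npsi_def FPsi_solved[OF 1]
      by (simp add: nf_def ng_def nphi_def comm_Fc Fc_mult palg.mult_scale_right distrib_left)
    then show ?thesis by simp
  next
    case 2
    have "ng n * nphi n = npsi n - pscale qdiff (comm (FE 0) (nf n))"
      unfolding nphi_def FPhi_solved[OF 2]
      by (simp add: nf_def ng_def npsi_def comm_Fc Fc_mult palg.mult_scale_right right_diff_distrib)
    then show ?thesis by simp
  next
    case 3
    then show ?thesis using E_F_square[of 0 n] d0 by (simp add: M_def)
  qed
qed

text \<open>
  With \<open>M = max {2, 2d - 1}\<close> the square \<open>|k|, |l| \<le> M\<close> contains the required three points on all diagonals
  from \<open>d - B\<close> to \<open>B = 2M - 1\<close>, and \<open>2d + 1 \<le> B\<close> as the induction requires.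
\<close>

lemma normalised_seed:
  "current_seed pscale qv d0 N (2 * M - 1) ng FE nf nh npsi nphi FK FKi (Fc (- d0) * FKi) (Fc d0 * FK)"
proof (unfold_locales, unfold kap_qdiff)
  note Fcs = comm_Fc Fc_mult palg.mult_scale_right palg.mult_scale_left
  have M2: "2 \<le> M" "2 * d0 - 1 \<le> M" by (simp_all add: M_def)
  then have M3: "d0 + 1 \<le> M" by presburger
  fix m n i j l s :: int and x :: "F_letter palg"
  show "ng 0 = 1" "ng (m + n) = ng m * ng n"
    by (simp_all add: ng_def Fc_add[symmetric] distrib_left)
  show "ng n * x = x * ng n"
    unfolding ng_def by (rule Fc_central)
  show "FK * FKi = 1" "FKi * FK = 1" by (fact FK_inv)+
  show "Fc (- d0) * FKi * (Fc d0 * FK) = 1" "Fc d0 * FK * (Fc (- d0) * FKi) = 1"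
    by (simp_all add: mult.assoc Fc_lefts Fc_mult FK_inv)
  show "FK * FE n = pscale Q.q (FE n * FK)"
    using weight_FK_mult[OF weight_E] by (simp add: Q.q_def)
  show "FK * nf n = pscale Q.qi (nf n * FK)"
    using weight_FK_mult[OF weight_c[OF weight_F]] by (simp add: Q.qi_def nf_def)
  show "Fc (- d0) * FKi * FE n = pscale Q.qi (FE n * (Fc (- d0) * FKi))"
    using weight_FKi_mult[OF weight_E] Q.v_nz by (simp add: Q.qi_def mult.assoc Fc_lefts palg.mult_scale_right)
  show "Fc (- d0) * FKi * nf n = pscale Q.q (nf n * (Fc (- d0) * FKi))"
    using weight_FKi_mult[OF weight_c[OF weight_F]] Q.v_nz
    by (simp add: Q.q_def mult.assoc Fc_lefts nf_def palg.mult_scale_right Fc_mult add.commute)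
  show "n \<noteq> 0 \<Longrightarrow> comm (nh n) FK = 0" "n \<noteq> 0 \<Longrightarrow> comm (nh n) (Fc (- d0) * FKi) = 0"
    by (simp_all add: nh_def comm_Fc FK_H)
  show "comm (nh 1) (FE n) = pscale (Q.wt 1) (FE (n + 1))" "comm (nh (- 1)) (FE n) = pscale (Q.wt 1) (FE (n - 1))"
    by (simp_all add: nh_def Fcs H1_E Hm1_E Q_wt_1)
  show "comm (nh 1) (nf n) = - pscale (Q.wt 1) (nf (n + 1))"
    by (simp add: nh_def nf_def Fcs H1_F Q_wt_1 algebra_simps)
  show "comm (nh (- 1)) (nf n) = - pscale (Q.wt 1) (ng 1 * nf (n - 1))"
    by (simp add: nh_def nf_def ng_def Fcs Hm1_F Q_wt_1 algebra_simps)
  show "comm (nh 1) (nh (- 1)) = pscale (Q.wt 1 / qdiff) (ng 1 - 1)"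
    by (simp add: nh_def ng_def Fcs H1_Hm1 Q_wt_1 right_diff_distrib)
  have hh: "comm (FH i) (FH j) = 0" "comm (FH (- i)) (FH (- j)) = 0" if "1 \<le> i" "i \<le> N" "1 \<le> j" "j \<le> N" for i j
    using F_rel[OF F_rels.H_H_pos[of j d0 i]] F_rel[OF F_rels.H_H_neg[of i d0 j]] that
    by (simp_all add: N_def cl_simps FH_def)
  show "1 \<le> i \<Longrightarrow> i \<le> N \<Longrightarrow> 1 \<le> j \<Longrightarrow> j \<le> N \<Longrightarrow> comm (nh i) (nh j) = 0"
    "1 \<le> i \<Longrightarrow> i \<le> N \<Longrightarrow> 1 \<le> j \<Longrightarrow> j \<le> N \<Longrightarrow> comm (nh (- i)) (nh (- j)) = 0"
    using hh[of i j] by (simp_all add: nh_def comm_Fc)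
  note base = H_E_base[of l, folded N_def]
  show "1 \<le> l \<Longrightarrow> l \<le> N \<Longrightarrow> \<exists>a. comm (nh l) (FE a) = pscale (Q.wt l) (FE (a + l))"
    using base(1) by (intro exI[of _ "- 1"]) (simp add: nh_def Fcs)
  show "1 \<le> l \<Longrightarrow> l \<le> N \<Longrightarrow> \<exists>a. comm (nh l) (nf a) = - pscale (Q.wt l) (nf (a + l))"
    using base(3) by (intro exI[of _ "d0 - 1"]) (simp add: nh_def nf_def Fcs algebra_simps)
  show "1 \<le> l \<Longrightarrow> l \<le> N \<Longrightarrow> \<exists>a. comm (nh (- l)) (FE a) = pscale (Q.wt l) (FE (a - l))"
    using base(2) by (intro exI[of _ 1]) (simp add: nh_def Fcs)
  show "1 \<le> l \<Longrightarrow> l \<le> N \<Longrightarrow> \<exists>a. comm (nh (- l)) (nf a) = - pscale (Q.wt l) (ng l * nf (a - l))"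
    using base(4) by (intro exI[of _ "d0 + 1"]) (simp add: nh_def nf_def ng_def Fcs algebra_simps)
  show "npsi n = (if n < 0 then 0 else
        FK * fps_nth (palg.sexp (Abs_fps (\<lambda>j. if j = 0 then 0 else pscale qdiff (nh (int j))))) (nat n))"
  proof (cases "n < 0")
    case False
    then obtain k where k: "n = int k" by (metis nonneg_int_cases not_less)
    have "(if j = 0 then 0 else pscale qdiff (nh (int j))) = Fc 1 ^ j * fps_nth FA j" for j
      by (simp add: FA_def nh_def Fc_power palg.mult_scale_right)
    then have "fps_nth (palg.sexp (Abs_fps (\<lambda>j. if j = 0 then 0 else pscale qdiff (nh (int j))))) k = Fc (int k) * fps_nth (palg.sexp FA) k"
      using palg.sexp_rescale[of "Fc 1" FA k, OF Fc_central] by (simp add: Fc_power)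
    then show ?thesis by (simp add: k npsi_def FPsi_exp Fc_lefts)
  qed (simp add: npsi_def FPsi_neg)
  show "nphi n = (if d0 < n then 0 else
        Fc (- d0) * FKi * fps_nth (palg.sexp (Abs_fps (\<lambda>j. if j = 0 then 0 else - pscale qdiff (nh (- int j))))) (nat (d0 - n)))"
  proof (cases "d0 < n")
    case False
    then obtain k where k: "n = d0 - int k" by (metis diff_diff_eq2 add_diff_cancel_left' zle_iff_zadd not_less)
    have "(if j = 0 then 0 else - pscale qdiff (nh (- int j))) = Fc 1 ^ j * fps_nth FB j" for j
      by (simp add: FB_def nh_def Fc_power palg.mult_scale_right)
    then have "fps_nth (palg.sexp (Abs_fps (\<lambda>j. if j = 0 then 0 else - pscale qdiff (nh (- int j))))) k = Fc (int k) * fps_nth (palg.sexp FB) k"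
      using palg.sexp_rescale[of "Fc 1" FB k, OF Fc_central] by (simp add: Fc_power)
    then show ?thesis by (simp add: k nphi_def FPhi_exp Fc_lefts Fc_mult mult.assoc)
  qed (simp add: nphi_def FPhi_high)
  show "pscale qdiff (comm (FE 0) (nf n)) = npsi n - ng n * nphi n" by (rule E_F_zero)
  show "\<exists>k. \<forall>(k', l') \<in> {(k, s - k), (k + 1, s - k), (k, s - k + 1)}.
      pscale qdiff (comm (FE k') (nf l')) = npsi (k' + l') - ng l' * nphi (k' + l')"
    if s: "d0 - (2 * M - 1) \<le> s" "s < 2 * M - 1"
  proof -
    define k where "k = (if s \<ge> 0 then M - 1 else - M)"
    have "\<bar>k\<bar> \<le> M" "\<bar>k + 1\<bar> \<le> M" "\<bar>s - k\<bar> \<le> M" "\<bar>s - k + 1\<bar> \<le> M"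
      using s d0 M2 by (auto simp: k_def abs_le_iff)
    then show ?thesis by (intro exI[of _ k]) (auto simp: E_F_square)
  qed
  show "\<exists>k. \<forall>(k', l') \<in> {(k, s - k), (k - 1, s - k), (k, s - k - 1)}.
      pscale qdiff (comm (FE k') (nf l')) = npsi (k' + l') - ng l' * nphi (k' + l')"
    if s: "d0 - (2 * M - 1) < s" "s \<le> 2 * M - 1"
  proof -
    define k where "k = (if s > 0 then M else - M + 1)"
    have "\<bar>k\<bar> \<le> M" "\<bar>k - 1\<bar> \<le> M" "\<bar>s - k\<bar> \<le> M" "\<bar>s - k - 1\<bar> \<le> M"
      using s d0 M2 by (auto simp: k_def abs_le_iff)
    then show ?thesis by (intro exI[of _ k]) (auto simp: E_F_square)
  qed
  show "\<exists>a. FE (a + 1) * FE a = pscale Q.q (FE a * FE (a + 1))"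
    using F_rel[OF F_rels.E_E] by (intro exI[of _ 0]) (simp add: cl_simps FE_def Q.q_def)
  show "\<exists>a. nf (a + 1) * nf a = pscale Q.qi (nf a * nf (a + 1))"
  proof -
    have "FF d0 * FF (d0 - 1) = pscale Q.qi (FF (d0 - 1) * FF d0)"
      using F_rel[OF F_rels.F_F] by (simp add: cl_simps FF_def Q.qi_def power_int_minus power_inverse)
    then show ?thesis
      by (intro exI[of _ "d0 - 1"]) (simp add: nf_def Fcs mult.assoc Fc_lefts add.commute)
  qed
  show "0 \<le> d0" "2 \<le> N" "d0 \<le> N" "N \<le> 2 * M - 1"
    using d0 M2 by (auto simp: N_def)
  show "2 * d0 + 1 \<le> 2 * M - 1"
    using M3 by linarith
qed

sublocale C: current_seed pscale qv d0 N "2 * M - 1" ng FE nf nh npsi nphi FK FKi "Fc (- d0) * FKi" "Fc d0 * FK"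
  by (rule normalised_seed)

lemma U_E_F: "comm (FE k) (FF l) = pscale (1 / qdiff) (Fc (k - l) * FPsi (k + l) - Fc (l - k) * FPhi (k + l))"
  using C.gap_all[of k l] by (simp add: E_F_normalised C.gap_def kap_qdiff)

lemma Fc_solve: "Fc n * x = y \<Longrightarrow> x = Fc (- n) * y"
  by (rule Fc_cancel[of n]) (simp add: Fc_mult)

lemma U_H_E: "l \<noteq> 0 \<Longrightarrow> comm (FH l) (FE k) = pscale (Q.wt l) (Fc (- \<bar>l\<bar>) * FE (k + l))"
proof -
  assume l: "l \<noteq> 0"
  have "Fc \<bar>l\<bar> * comm (FH l) (FE k) = pscale (Q.wt l) (FE (k + l))"
  proof (cases "l > 0")
    case True
    then show ?thesis using C.pos_relations(3)[of l k] by (simp add: nh_def comm_Fc)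
  next
    case False
    then show ?thesis using C.neg_relations(3)[of "- l" k] l by (simp add: nh_def comm_Fc Q_wt_minus)
  qed
  from Fc_solve[OF this] show ?thesis by (simp add: palg.mult_scale_right)
qed

lemma U_H_F: "l \<noteq> 0 \<Longrightarrow> comm (FH l) (FF k) = - pscale (Q.wt l) (Fc \<bar>l\<bar> * FF (k + l))"
proof -
  assume l: "l \<noteq> 0"
  have "Fc (\<bar>l\<bar> + 2 * k) * comm (FH l) (FF k) = - pscale (Q.wt l) (Fc (2 * \<bar>l\<bar> + 2 * k) * FF (k + l))"
  proof (cases "l > 0")
    case True
    then show ?thesis using C.pos_relations(4)[of l k]
      by (simp add: nh_def nf_def comm_Fc Fc_mult algebra_simps)
  next
    case False
    then show ?thesis using C.neg_relations(4)[of "- l" k] l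
      by (simp add: nh_def nf_def ng_def comm_Fc Fc_mult Q_wt_minus algebra_simps)
  qed
  from Fc_solve[OF this] show ?thesis by (simp add: palg.mult_scale_right Fc_mult)
qed

lemma U_H_H:
  assumes "l \<noteq> 0" "k \<noteq> 0"
  shows "comm (FH l) (FH k) = (if l = - k then pscale (Q.wt l / qdiff) (Fc (2 * l) - Fc (- 2 * l)) else 0)"
proof -
  have mixed: "comm (FH n) (FH (- m)) = (if n = m then pscale (Q.wt n / qdiff) (Fc (2 * n) - Fc (- 2 * n)) else 0)"
    if "1 \<le> n" "1 \<le> m" for n m
  proof -
    have "Fc (n + m) * comm (FH n) (FH (- m)) = (if n = m then pscale (Q.wt m / qdiff) (Fc (4 * m) - 1) else 0)"
      using C.h_h_mixed[OF that] that by (simp add: nh_def ng_def comm_Fc Fc_mult kap_qdiff add.commute)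
    from Fc_solve[OF this] show ?thesis
      by (auto simp: palg.mult_scale_right Fc_mult right_diff_distrib)
  qed
  consider "l > 0" "k > 0" | "l < 0" "k < 0" | "l > 0" "k < 0" | "l < 0" "k > 0" using assms by linarith
  then show ?thesis
  proof cases
    case 1
    then have "Fc (l + k) * comm (FH l) (FH k) = 0"
      using C.pos_relations(2)[of l k] by (simp add: nh_def comm_Fc Fc_mult add.commute)
    from Fc_solve[OF this] show ?thesis using 1 by simp
  next
    case 2
    then have "Fc (- k - l) * comm (FH l) (FH k) = 0"
      using C.neg_relations(2)[of "- l" "- k"] by (simp add: nh_def comm_Fc Fc_mult algebra_simps)
    from Fc_solve[OF this] show ?thesis using 2 by simp
  next
    case 3
    then show ?thesis using mixed[of l "- k"] by simp
  next
    case 4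
    then have "comm (FH l) (FH k) = - (if k = - l then pscale (Q.wt k / qdiff) (Fc (2 * k) - Fc (- 2 * k)) else 0)"
      using mixed[of k "- l"] comm_swap[of "FH l" "FH k"] by simp
    then show ?thesis by (auto simp: Q_wt_minus palg.scale_right_diff_distrib)
  qed
qed

lemma U_E_E: "FE (k + 1) * FE l - pscale (qv\<^sup>2) (FE l * FE (k + 1)) = pscale (qv\<^sup>2) (FE k * FE (l + 1)) - FE (l + 1) * FE k"
  using C.quad_e[of k l] by (simp add: palg.quad_def Q.q_def algebra_simps)

lemma U_F_F: "FF (k + 1) * FF l - pscale (qv powi - 2) (FF l * FF (k + 1)) = pscale (qv powi - 2) (FF k * FF (l + 1)) - FF (l + 1) * FF k"
proof (rule Fc_cancel[of "2 * k + 2 * l + 2"])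
  have q: "qv powi - 2 = Q.qi" by (simp add: Q.qi_def power_int_minus power_inverse)
  have m: "nf a * nf b = Fc (2 * a + 2 * b) * (FF a * FF b)" for a b
    by (simp add: nf_def mult.assoc Fc_lefts Fc_mult algebra_simps)
  have "nf (k + 1) * nf l - pscale Q.qi (nf l * nf (k + 1)) = pscale Q.qi (nf k * nf (l + 1)) - nf (l + 1) * nf k"
    using C.quad_f[of k l] by (simp add: palg.quad_def algebra_simps)
  then show "Fc (2 * k + 2 * l + 2) * (FF (k + 1) * FF l - pscale (qv powi - 2) (FF l * FF (k + 1)))
     = Fc (2 * k + 2 * l + 2) * (pscale (qv powi - 2) (FF k * FF (l + 1)) - FF (l + 1) * FF k)"
    unfolding m q by (simp add: right_diff_distrib palg.mult_scale_right algebra_simps)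
qed

end

context finite_presentation
begin

fun theta :: "U_letter \<Rightarrow> F_letter palg" where
  "theta (UE k) = FE k" | "theta (UF k) = FF k" | "theta (UH n) = FH n"
| "theta US = FS" | "theta USi = FSi" | "theta UK = FK" | "theta UKi = FKi"
| "theta UC = Fc 1" | "theta UCi = Fc (- 1)"

lemmas theta_hom = palg.free_hom_lift[of theta]

lemmas theta_simps = palg.hom_0[OF theta_hom] palg.hom_1[OF theta_hom] palg.hom_add[OF theta_hom] palg.hom_minus[OF theta_hom]
  palg.hom_diff[OF theta_hom] palg.hom_mult[OF theta_hom] palg.hom_scal[OF theta_hom] palg.hom_power[OF theta_hom]
  palg.hom_comm[OF theta_hom] palg.lift_gen palg.mult_scale_left palg.mult_scale_right

lemma theta_Cpow: "palg.lift theta (UCpow n) = Fc n"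
  by (simp add: UCpow_def theta_simps Fc_eq Fc_1 Fc_m1)

lemma theta_Psi: "palg.lift theta (UPsi n) = FPsi n"
proof (cases "n < 0")
  case False
  then obtain k where k: "n = int k" by (metis nonneg_int_cases not_less)
  have "Abs_fps (\<lambda>j. palg.lift theta (if j = 0 then 0 else scal qdiff * gen (UH (int j)))) = FA"
    by (rule fps_ext) (simp add: FA_def theta_simps)
  then show ?thesis
    by (simp add: k UPsi_def FPsi_exp theta_simps palg.hom_series_exp[OF theta_hom])
qed (simp add: UPsi_def FPsi_neg theta_simps)

lemma theta_Phi: "palg.lift theta (UPhi d0 n) = FPhi n"
proof (cases "d0 < n")
  case False
  then obtain k where k: "n = d0 - int k" by (metis diff_diff_eq2 add_diff_cancel_left' zle_iff_zadd not_less)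
  have "Abs_fps (\<lambda>j. palg.lift theta (if j = 0 then 0 else - (scal qdiff * gen (UH (- int j))))) = FB"
    by (rule fps_ext) (simp add: FB_def theta_simps)
  then show ?thesis
    by (simp add: k UPhi_def FPhi_exp theta_simps palg.hom_series_exp[OF theta_hom])
qed (simp add: UPhi_def FPhi_high theta_simps)

lemma weight_conj_eq: "weight r x \<Longrightarrow> FS * x * FSi = pscale r x"
  by (simp add: weight_def palg.mult_scale_left mult.assoc F_S_inv)

lemma theta_relations: "(p, r) \<in> U_rels d0 \<Longrightarrow> palg.lift theta p = palg.lift theta r"
proof (erule U_rels.cases; clarify)
  show "palg.lift theta (gen US * gen USi) = palg.lift theta 1" "palg.lift theta (gen USi * gen US) = palg.lift theta 1"
    by (simp_all add: theta_simps F_S_inv)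
  show "palg.lift theta (gen UK * gen UKi) = palg.lift theta 1" "palg.lift theta (gen UKi * gen UK) = palg.lift theta 1"
    by (simp_all add: theta_simps FK_inv)
  show "palg.lift theta (gen UC * gen UCi) = palg.lift theta 1" "palg.lift theta (gen UCi * gen UC) = palg.lift theta 1"
    by (simp_all add: theta_simps Fc_mult)
  show "palg.lift theta (gen UC * gen g) = palg.lift theta (gen g * gen UC)" for g
    by (simp add: theta_simps Fc_central)
  show "palg.lift theta ((gen US)\<^sup>2) = palg.lift theta (gen UK * gen UC)"
    by (simp add: theta_simps FK_eq power2_eq_square mult.assoc Fc_mult)
  show "palg.lift theta (gen US * gen (UE k) * gen USi) = palg.lift theta (scal qv * gen (UE k))" for k
    by (simp add: theta_simps weight_conj_eq[OF weight_E])
  show "palg.lift theta (gen US * gen (UF k) * gen USi) = palg.lift theta (scal (inverse qv) * gen (UF k))" for k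
    by (simp add: theta_simps weight_conj_eq[OF weight_F])
  show "palg.lift theta (gen US * gen (UH n) * gen USi) = palg.lift theta (gen (UH n))" if "n \<noteq> 0" for n
    by (simp add: theta_simps weight_conj_eq[OF weight_FH[OF that]])
  show "palg.lift theta (gen (UE (k + 1)) * gen (UE l) - scal (qv\<^sup>2) * gen (UE l) * gen (UE (k + 1))) =
       palg.lift theta (scal (qv\<^sup>2) * gen (UE k) * gen (UE (l + 1)) - gen (UE (l + 1)) * gen (UE k))" for k l
    using U_E_E[of k l] by (simp add: theta_simps)
  show "palg.lift theta (gen (UF (k + 1)) * gen (UF l) - scal (qv powi - 2) * gen (UF l) * gen (UF (k + 1))) =
       palg.lift theta (scal (qv powi - 2) * gen (UF k) * gen (UF (l + 1)) - gen (UF (l + 1)) * gen (UF k))" for k l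
    using U_F_F[of k l] by (simp add: theta_simps)
  show "palg.lift theta (comm (gen (UE k)) (gen (UF l))) =
       palg.lift theta (scal (1 / qdiff) * (UCpow (k - l) * UPsi (k + l) - UCpow (l - k) * UPhi d0 (k + l)))" for k l
    using U_E_F[of k l] by (simp add: theta_simps theta_Cpow theta_Psi theta_Phi)
  show "palg.lift theta (comm (gen (UH l)) (gen (UE k))) =
       palg.lift theta (scal (qint (2 * l) / of_int l) * UCpow (- \<bar>l\<bar>) * gen (UE (k + l)))" if "l \<noteq> 0" for k l
    using U_H_E[OF that, of k] by (simp add: theta_simps theta_Cpow wt_qint)
  show "palg.lift theta (comm (gen (UH l)) (gen (UF k))) =
       palg.lift theta (- (scal (qint (2 * l) / of_int l) * UCpow \<bar>l\<bar> * gen (UF (k + l))))" if "l \<noteq> 0" for k l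
    using U_H_F[OF that, of k] by (simp add: theta_simps theta_Cpow wt_qint)
  show "palg.lift theta (comm (gen (UH l)) (gen (UH k))) =
       palg.lift theta (if l = - k then scal (qint (2 * l) / of_int l) * (scal (1 / qdiff) * (UCpow (2 * l) - UCpow (- 2 * l))) else 0)"
    if "l \<noteq> 0" "k \<noteq> 0" for l k
    using U_H_H[OF that] unfolding wt_qint[symmetric] by (simp add: theta_simps theta_Cpow)
qed

end

section \<open>The finite relations hold in \<open>\<U>\<^sub>d\<close>\<close>

definition Uc :: "int \<Rightarrow> U_letter palg" where "Uc n = cl (UCpow n)"
definition uE :: "int \<Rightarrow> U_letter palg" where "uE n = cl (gen (UE n))"
definition uF :: "int \<Rightarrow> U_letter palg" where "uF n = cl (gen (UF n))"
definition uH :: "int \<Rightarrow> U_letter palg" where "uH n = cl (gen (UH n))"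
definition uPsi :: "int \<Rightarrow> U_letter palg" where "uPsi n = cl (UPsi n)"
definition uPhi :: "int \<Rightarrow> U_letter palg" where "uPhi n = cl (UPhi d0 n)"
definition uS :: "U_letter palg" where "uS = cl (gen US)"
definition uSi :: "U_letter palg" where "uSi = cl (gen USi)"
definition uK :: "U_letter palg" where "uK = cl (gen UK)"
definition uKi :: "U_letter palg" where "uKi = cl (gen UKi)"

lemmas u_defs = Uc_def uE_def uF_def uH_def uPsi_def uPhi_def uS_def uSi_def uK_def uKi_def

fun eta :: "F_letter \<Rightarrow> U_letter palg" where
  "eta F_E = uE 0" | "eta F_F = uF d0" | "eta F_S = uS" | "eta F_Si = uSi"
| "eta F_C = Uc 1" | "eta F_Ci = Uc (- 1)" | "eta F_H = uH 1" | "eta F_Hm = uH (- 1)"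
| "eta (F_Phi n) = uPhi n"

lemmas eta_hom = palg.free_hom_lift[of eta]

lemmas eta_simps = palg.hom_0[OF eta_hom] palg.hom_1[OF eta_hom] palg.hom_add[OF eta_hom] palg.hom_minus[OF eta_hom]
  palg.hom_diff[OF eta_hom] palg.hom_mult[OF eta_hom] palg.hom_scal[OF eta_hom] palg.hom_power[OF eta_hom]
  palg.hom_comm[OF eta_hom] palg.lift_gen palg.mult_scale_left palg.mult_scale_right

locale infinite_presentation =
  assumes nU: "nontrivial TYPE(U_letter)" and d0: "0 \<le> d0"
begin

lemma U_rel: "(p, r) \<in> U_rels d0 \<Longrightarrow> cl p = cl r"
  using cl_relation[OF nU] by (simp add: relations_U_letter_def)

lemma u_inv: "uS * uSi = 1" "uSi * uS = 1" "uK * uKi = 1" "uKi * uK = 1"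
  using U_rel[OF U_rels.S_inv1] U_rel[OF U_rels.S_inv2] U_rel[OF U_rels.K_inv1] U_rel[OF U_rels.K_inv2]
  by (simp_all add: cl_simps u_defs)

lemma Uc_zpow: "Uc n = zpow (cl (gen UC)) (cl (gen UCi)) n"
  by (simp add: Uc_def UCpow_def zpow_def cl_simps)

lemma Uc_0 [simp]: "Uc 0 = 1" and Uc_1: "Uc 1 = cl (gen UC)" and Uc_m1: "Uc (- 1) = cl (gen UCi)"
  by (simp_all add: Uc_zpow zpow_def)

lemma Uc_mult: "Uc m * Uc n = Uc (m + n)" "Uc m * (Uc n * x) = Uc (m + n) * x"
proof -
  have "cl (gen UC) * cl (gen UCi) = 1" "cl (gen UCi) * cl (gen UC) = 1"
    using U_rel[OF U_rels.C_inv1] U_rel[OF U_rels.C_inv2] by (simp_all add: cl_simps)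
  from zpow_add[OF this] show 1: "Uc m * Uc n = Uc (m + n)" by (simp add: Uc_zpow)
  show "Uc m * (Uc n * x) = Uc (m + n) * x" by (simp flip: mult.assoc 1)
qed

lemma Uc_1_central: "Uc 1 * x = x * Uc 1"
  unfolding Uc_1
  by (rule central_cl) (use U_rel[OF U_rels.C_central] in \<open>simp add: cl_simps letters_of_U_letter_def\<close>)

lemma u_E_F: "comm (uE k) (uF l) = pscale (1 / qdiff) (Uc (k - l) * uPsi (k + l) - Uc (l - k) * uPhi (k + l))"
  using U_rel[OF U_rels.E_F[of k l]] by (simp add: cl_simps u_defs)

lemma u_H_E: "l \<noteq> 0 \<Longrightarrow> comm (uH l) (uE k) = pscale (Q.wt l) (Uc (- \<bar>l\<bar>) * uE (k + l))"
  using U_rel[OF U_rels.H_E[of l k]] by (simp add: cl_simps u_defs wt_qint)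

lemma u_H_F: "l \<noteq> 0 \<Longrightarrow> comm (uH l) (uF k) = - pscale (Q.wt l) (Uc \<bar>l\<bar> * uF (k + l))"
  using U_rel[OF U_rels.H_F[of l k]] by (simp add: cl_simps u_defs wt_qint)

lemma eta_Cpow: "palg.lift eta (el_Cpow n) = Uc n"
  by (simp add: el_Cpow_def eta_simps Uc_zpow zpow_def Uc_1 Uc_m1)

lemma eta_E: "palg.lift eta (el_E n) = uE n"
proof (cases "0 \<le> n")
  case True
  have "palg.lift eta (((\<lambda>x. scal (1 / qint 2) * gen F_C * comm (gen F_H) x) ^^ m) (gen F_E)) = uE (int m)" for m
    by (induction m) (use qint2 in \<open>simp_all add: eta_simps u_H_E Uc_mult Q_wt_1 add.commute\<close>)
  from this[of "nat n"] True show ?thesis by (simp add: el_E_def)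
next
  case False
  have "palg.lift eta (((\<lambda>x. scal (1 / qint 2) * gen F_C * comm (gen F_Hm) x) ^^ m) (gen F_E)) = uE (- int m)" for m
    by (induction m) (use qint2 in \<open>simp_all add: eta_simps u_H_E Uc_mult Q_wt_1 algebra_simps\<close>)
  from this[of "nat (- n)"] False show ?thesis by (simp add: el_E_def)
qed

lemma eta_F: "palg.lift eta (el_F d0 n) = uF n"
proof (cases "d0 \<le> n")
  case True
  have "palg.lift eta (((\<lambda>x. - (scal (1 / qint 2) * gen F_Ci * comm (gen F_H) x)) ^^ m) (gen F_F)) = uF (d0 + int m)" for m
    by (induction m) (use qint2 in \<open>simp_all add: eta_simps u_H_F Uc_mult Q_wt_1 algebra_simps\<close>)
  from this[of "nat (n - d0)"] True show ?thesis by (simp add: el_F_def)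
next
  case False
  have "palg.lift eta (((\<lambda>x. - (scal (1 / qint 2) * gen F_Ci * comm (gen F_Hm) x)) ^^ m) (gen F_F)) = uF (d0 - int m)" for m
    by (induction m) (use qint2 in \<open>simp_all add: eta_simps u_H_F Uc_mult Q_wt_1 algebra_simps\<close>)
  from this[of "nat (d0 - n)"] False show ?thesis by (simp add: el_F_def)
qed

lemma uK_eq: "uK = uS * (uS * Uc (- 1))"
proof -
  have "uS * uS = uK * Uc 1"
    using U_rel[OF U_rels.S_square] by (simp add: cl_simps u_defs Uc_1[unfolded Uc_def] power2_eq_square)
  then have "uS * uS * Uc (- 1) = uK" by (simp add: mult.assoc Uc_mult)
  then show ?thesis by (simp add: mult.assoc)
qed

lemma uKi_eq: "uKi = Uc 1 * (uSi * uSi)"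
proof -
  have S: "uS * (uSi * x) = x" for x by (simp add: u_inv flip: mult.assoc)
  have "uK * (Uc 1 * (uSi * uSi)) = 1" by (simp add: uK_eq mult.assoc Uc_mult S u_inv)
  then have "uKi * (uK * (Uc 1 * (uSi * uSi))) = uKi" by simp
  then show ?thesis by (simp add: u_inv flip: mult.assoc)
qed

lemma eta_K: "palg.lift eta el_K = uK" and eta_Ki: "palg.lift eta el_Ki = uKi"
  by (simp_all add: el_K_def el_Ki_def eta_simps uK_eq uKi_eq power2_eq_square mult.assoc)

definition UA :: "U_letter palg fps" where
  "UA = Abs_fps (\<lambda>j. if j = 0 then 0 else pscale qdiff (uH (int j)))"

definition UB :: "U_letter palg fps" where
  "UB = Abs_fps (\<lambda>j. if j = 0 then 0 else - pscale qdiff (uH (- int j)))"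

lemma UA_0: "fps_nth UA 0 = 0" and UB_0: "fps_nth UB 0 = 0"
  by (simp_all add: UA_def UB_def)

lemma uPsi_exp: "uPsi (int n) = uK * fps_nth (palg.sexp UA) n"
proof -
  have "Abs_fps (\<lambda>j. cl (if j = 0 then 0 else scal qdiff * gen (UH (int j)))) = UA"
    by (rule fps_ext) (simp add: UA_def cl_simps u_defs)
  then show ?thesis by (simp add: uPsi_def UPsi_def cl_simps palg.hom_series_exp[OF hom_cl] uK_def)
qed

lemma uPhi_exp: "uPhi (d0 - int n) = uKi * fps_nth (palg.sexp UB) n"
proof -
  have "Abs_fps (\<lambda>j. cl (if j = 0 then 0 else - (scal qdiff * gen (UH (- int j))))) = UB"
    by (rule fps_ext) (simp add: UB_def cl_simps u_defs)
  then show ?thesis by (simp add: uPhi_def UPhi_def cl_simps palg.hom_series_exp[OF hom_cl] uKi_def)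
qed

lemma uPsi_neg: "n < 0 \<Longrightarrow> uPsi n = 0" and uPhi_high: "d0 < n \<Longrightarrow> uPhi n = 0"
  by (simp_all add: uPsi_def UPsi_def uPhi_def UPhi_def cl_simps)

lemma eta_Phi_high: "palg.lift eta (el_Phi_high d0 n) = uPhi n"
proof -
  consider "d0 < n" | "n = d0" | "n = d0 - 1" | "n < d0 - 1" by linarith
  then show ?thesis
  proof cases
    case 1
    then show ?thesis by (simp add: el_Phi_high_def uPhi_high eta_simps)
  next
    case 2
    then show ?thesis using uPhi_exp[of 0] by (simp add: el_Phi_high_def eta_Ki)
  next
    case 3
    then show ?thesis using uPhi_exp[of 1]
      by (simp add: el_Phi_high_def eta_Ki eta_simps palg.sexp_nth UB_def)
  next
    case 4
    then show ?thesis by (simp add: el_Phi_high_def eta_simps)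
  qed
qed

lemma eta_Psi_low: "n \<le> 1 \<Longrightarrow> palg.lift eta (el_Psi_low n) = uPsi n"
proof -
  assume "n \<le> 1"
  then consider "n < 0" | "n = 0" | "n = 1" by linarith
  then show ?thesis
  proof cases
    case 1
    then show ?thesis by (simp add: el_Psi_low_def uPsi_neg eta_simps)
  next
    case 2
    then show ?thesis using uPsi_exp[of 0] by (simp add: el_Psi_low_def eta_K)
  next
    case 3
    then show ?thesis using uPsi_exp[of 1]
      by (simp add: el_Psi_low_def eta_K eta_simps palg.sexp_nth UA_def)
  qed
qed

lemma u_E_F_0: "pscale qdiff (comm (uE 0) (uF n)) = Uc (- n) * uPsi n - Uc n * uPhi n"
  using Q.kap_nz by (simp add: u_E_F kap_qdiff)

lemma eta_Psi: "palg.lift eta (el_Psi d0 n) = uPsi n"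
  by (simp add: el_Psi_def eta_Psi_low eta_Phi_high eta_simps eta_Cpow eta_E eta_F u_E_F_0 Uc_mult)

lemma eta_Phi: "palg.lift eta (el_Phi d0 n) = uPhi n"
proof (cases "min 2 (d0 - 1) \<le> n")
  case True
  then show ?thesis by (simp add: el_Phi_def eta_Phi_high)
next
  case False
  then have "n \<le> 1" by simp
  then show ?thesis using False
    by (simp add: el_Phi_def eta_Psi_low eta_simps eta_Cpow eta_E eta_F u_E_F_0 Uc_mult)
qed

text \<open>
  The logarithm is determined by its exponential, so it suffices to compare exponentials.
\<close>

lemma eta_series_log:
  assumes "fps_nth R 0 = 0" "\<And>k. palg.lift eta (fps_nth P k) = fps_nth (palg.sexp R) k"
  shows "palg.lift eta (fps_nth (series_log P) n) = fps_nth R n"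
proof -
  define T where "T = Abs_fps (\<lambda>j. palg.lift eta (fps_nth (series_log P) j))"
  have "fps_nth T n = fps_nth R n"
  proof (rule palg.sexp_inj[where n = n])
    show "fps_nth T 0 = 0" by (simp add: T_def series_log_def series_log_coeff.simps eta_simps)
    show "fps_nth (palg.sexp T) k = fps_nth (palg.sexp R) k" for k
      unfolding T_def by (subst palg.hom_series_log[OF eta_hom]) (simp_all add: assms(2))
  qed (simp_all add: assms(1))
  then show ?thesis by (simp add: T_def)
qed

lemma eta_H: "n \<noteq> 0 \<Longrightarrow> palg.lift eta (el_H d0 n) = uH n"
proof -
  assume "n \<noteq> 0"
  then consider "n = 1" | "n = - 1" | "n > 1" | "n < - 1" by linarith
  then show ?thesis
  proof cases
    case 3
    have "palg.lift eta (fps_nth (series_log (Abs_fps (\<lambda>k. el_Ki * el_Psi d0 (int k)))) (nat n)) = fps_nth UA (nat n)"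
      by (rule eta_series_log) (simp_all add: UA_0 eta_simps eta_Ki eta_Psi uPsi_exp u_inv flip: mult.assoc)
    then show ?thesis using 3 Q.kap_nz by (simp add: el_H_def eta_simps UA_def kap_qdiff)
  next
    case 4
    have "palg.lift eta (fps_nth (series_log (Abs_fps (\<lambda>k. el_K * el_Phi d0 (d0 - int k)))) (nat (- n))) = fps_nth UB (nat (- n))"
      by (rule eta_series_log) (simp_all add: UB_0 eta_simps eta_K eta_Phi uPhi_exp u_inv flip: mult.assoc)
    then show ?thesis using 4 Q.kap_nz by (simp add: el_H_def eta_simps UB_def kap_qdiff)
  qed (simp_all add: el_H_def eta_simps)
qed

lemma comm_uS_H: "n \<noteq> 0 \<Longrightarrow> comm uS (uH n) = 0"
proof -
  assume "n \<noteq> 0"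
  from U_rel[OF U_rels.S_H[OF this]] have "uS * uH n * uSi * uS = uH n * uS"
    by (simp add: cl_simps u_defs)
  then show ?thesis by (simp add: comm_def mult.assoc u_inv)
qed

lemma comm_uS_Phi: "comm uS (uPhi n) = 0"
proof (cases "d0 < n")
  case False
  then obtain k where k: "n = d0 - int k" by (metis diff_diff_eq2 add_diff_cancel_left' zle_iff_zadd not_less)
  have "comm uS uKi = 0"
  proof -
    have c: "uS * (Uc 1 * x) = Uc 1 * (uS * x)" for x
      using Uc_1_central[of uS] by (simp flip: mult.assoc)
    have S: "uS * (uSi * x) = x" for x by (simp add: u_inv flip: mult.assoc)
    show ?thesis by (simp add: comm_def uKi_eq c S u_inv mult.assoc)
  qed
  moreover have "comm uS (fps_nth (palg.sexp UB) k) = 0"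
    by (rule palg.comm_sexp) (auto simp: UB_def comm_minus_right comm_uS_H)
  ultimately show ?thesis by (simp add: k uPhi_exp comm_mult_right)
qed (simp add: uPhi_high)

lemma u_H_H_0: "l \<noteq> 0 \<Longrightarrow> k \<noteq> 0 \<Longrightarrow> l \<noteq> - k \<Longrightarrow> comm (uH l) (uH k) = 0"
  using U_rel[OF U_rels.H_H[of l k]] by (simp add: cl_simps u_defs)

lemma eta_relations: "(p, r) \<in> F_rels d0 \<Longrightarrow> palg.lift eta p = palg.lift eta r"
proof (erule F_rels.cases; clarify)
  note es = eta_simps eta_Cpow eta_E eta_F eta_Psi eta_Phi eta_H
  show "palg.lift eta (gen F_S * gen F_Si) = palg.lift eta 1" "palg.lift eta (gen F_Si * gen F_S) = palg.lift eta 1"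
    by (simp_all add: es u_inv)
  show "palg.lift eta (gen F_C * gen F_Ci) = palg.lift eta 1" "palg.lift eta (gen F_Ci * gen F_C) = palg.lift eta 1"
    by (simp_all add: es Uc_mult)
  show "palg.lift eta (gen F_C * gen g) = palg.lift eta (gen g * gen F_C)" for g
    by (simp add: es Uc_1_central)
  show "palg.lift eta (comm (gen F_S) (el_H d0 1)) = palg.lift eta 0"
    "palg.lift eta (comm (gen F_S) (el_H d0 (- 1))) = palg.lift eta 0"
    by (simp_all add: es comm_uS_H)
  show "palg.lift eta (comm (gen F_S) (el_Phi d0 n)) = palg.lift eta 0" for n
    by (simp add: es comm_uS_Phi)
  show "palg.lift eta (gen F_S * el_E 0 * gen F_Si) = palg.lift eta (scal qv * el_E 0)"
    using U_rel[OF U_rels.S_E[of 0]] by (simp add: es) (simp add: cl_simps u_defs)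
  show "palg.lift eta (gen F_S * el_F d0 d0 * gen F_Si) = palg.lift eta (scal (inverse qv) * el_F d0 d0)"
    using U_rel[OF U_rels.S_F[of d0]] by (simp add: es) (simp add: cl_simps u_defs)
  show "palg.lift eta (comm (el_H d0 n) (el_H d0 m)) = palg.lift eta 0"
    "palg.lift eta (comm (el_H d0 (- m)) (el_H d0 (- n))) = palg.lift eta 0" if "1 \<le> m" "1 \<le> n" for m n
    using that by (simp_all add: es u_H_H_0)
  show "palg.lift eta (el_E 1 * el_E 0) = palg.lift eta (scal (qv\<^sup>2) * el_E 0 * el_E 1)"
  proof -
    have "palg.quad (qv\<^sup>2) uE 0 0 = 0"
      using U_rel[OF U_rels.E_E[of 0 0]] by (simp add: palg.quad_def cl_simps u_defs algebra_simps)
    from palg.quad_diag[OF this] show ?thesis by (simp add: es)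
  qed
  show "palg.lift eta (el_F d0 d0 * el_F d0 (d0 - 1)) = palg.lift eta (scal (qv powi - 2) * el_F d0 (d0 - 1) * el_F d0 d0)"
  proof -
    have "palg.quad (qv powi - 2) uF (d0 - 1) (d0 - 1) = 0"
      using U_rel[OF U_rels.F_F[of "d0 - 1" "d0 - 1"]] by (simp add: palg.quad_def cl_simps u_defs algebra_simps)
    from palg.quad_diag[OF this] show ?thesis by (simp add: es)
  qed
  show "palg.lift eta (comm (el_E k) (el_F d0 l)) =
    palg.lift eta (scal (1 / qdiff) * (el_Cpow (k - l) * el_Psi d0 (k + l) - el_Cpow (l - k) * el_Phi d0 (k + l)))" for k l
    by (simp add: es u_E_F)
  show "palg.lift eta (comm (el_H d0 1) (el_H d0 (- 1))) =
    palg.lift eta (scal (qint 2) * (scal (1 / qdiff) * (el_Cpow 2 - el_Cpow (- 2))))"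
    using U_rel[OF U_rels.H_H[of 1 "- 1"]] by (simp add: es) (simp add: cl_simps u_defs palg.scale_right_diff_distrib)
  show "palg.lift eta (comm (el_H d0 l) (el_E (- 1))) =
    palg.lift eta (scal (qint (2 * l) / of_int l) * el_Cpow (- l) * el_E (l - 1))"
    "palg.lift eta (comm (el_H d0 (- l)) (el_E 1)) =
    palg.lift eta (scal (qint (2 * l) / of_int l) * el_Cpow (- l) * el_E (- l + 1))"
    "palg.lift eta (comm (el_H d0 l) (el_F d0 (d0 - 1))) =
    palg.lift eta (- (scal (qint (2 * l) / of_int l) * el_Cpow l * el_F d0 (d0 + l - 1)))"
    "palg.lift eta (comm (el_H d0 (- l)) (el_F d0 (d0 + 1))) =
    palg.lift eta (- (scal (qint (2 * l) / of_int l) * el_Cpow l * el_F d0 (d0 - l + 1)))"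
    if "1 \<le> l" for l
    unfolding wt_qint using that by (simp_all add: es u_H_E u_H_F Q_wt_minus algebra_simps)
qed

end

section \<open>The isomorphism\<close>

text \<open>
  If one algebra is not zero, then the relations of the other one hold in it, and the resulting
  homomorphism shows that the other algebra is not zero either.
\<close>

lemma nontrivial_iff:
  assumes "0 \<le> d0" shows "nontrivial TYPE(U_letter) \<longleftrightarrow> nontrivial TYPE(F_letter)"
proof
  assume "nontrivial TYPE(U_letter)"
  interpret infinite_presentation by (rule infinite_presentation.intro) fact+
  show "nontrivial TYPE(F_letter)"
    by (rule palg.nontrivial_extend[of eta]) (use eta_relations in \<open>simp add: relations_F_letter_def\<close>)
next
  assume "nontrivial TYPE(F_letter)"
  interpret finite_presentation by (rule finite_presentation.intro) fact+
  show "nontrivial TYPE(U_letter)"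
    by (rule palg.nontrivial_extend[of theta]) (use theta_relations in \<open>simp add: relations_U_letter_def\<close>)
qed

text \<open>
  The composites of the two homomorphisms are the identity on letters. For the letters \<open>\<Phi>\<^sub>n\<close> with \<open>2 \<le> n \<le> d - 2\<close> this
  holds because the element \<open>\<Phi>\<^sub>n\<close> of \<open>\<F>\<close> is the letter in this range.
\<close>

lemma isomorphic_d0:
  assumes "0 \<le> d0" shows "algebras_isomorphic (U_algebra d0) (F_quotient d0)"
proof -
  have "algebras_isomorphic (presented_algebra letters_of (relations :: (U_letter free \<times> U_letter free) set))
     (presented_algebra letters_of (relations :: (F_letter free \<times> F_letter free) set))"
  proof (cases "nontrivial TYPE(U_letter)")
    case False
    then show ?thesis using nontrivial_iff[OF assms] algebras_isomorphic_trivial by blast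
  next
    case True
    have "nontrivial TYPE(F_letter)" using True nontrivial_iff[OF assms] by simp
    interpret U: infinite_presentation by (rule infinite_presentation.intro) fact+
    interpret F: finite_presentation by (rule finite_presentation.intro) fact+
    have rU: "palg.lift F.theta p = palg.lift F.theta r" if "(p, r) \<in> relations" for p r
      using that F.theta_relations by (simp add: relations_U_letter_def)
    have rF: "palg.lift eta p = palg.lift eta r" if "(p, r) \<in> relations" for p r
      using that U.eta_relations by (simp add: relations_F_letter_def)
    define f where "f = palg.extend F.theta"
    define g where "g = palg.extend eta"
    have f: "p \<in> car \<Longrightarrow> f (cl p) = palg.lift F.theta p" "f (x + y) = f x + f y" "f (x * y) = f x * f y"
      "f (pscale c x) = pscale c (f x)" "f 1 = 1" for p x y c
      unfolding f_def using rU by (blast intro: palg.extend_cl palg.extend_add palg.extend_mult palg.extend_scale palg.extend_1)+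
    have g: "p \<in> car \<Longrightarrow> g (cl p) = palg.lift eta p" "g (x + y) = g x + g y" "g (x * y) = g x * g y"
      "g (pscale c x) = pscale c (g x)" "g 1 = 1" for p x y c
      unfolding g_def using rF by (blast intro: palg.extend_cl palg.extend_add palg.extend_mult palg.extend_scale palg.extend_1)+
    have gf: "g (f x) = x" for x
    proof (induction x rule: palg_induct)
      case (2 l)
      have "f (cl (gen l)) = F.theta l" using 2 f(1)[OF gen_in[OF 2]] by (simp add: palg.lift_gen)
      moreover have "g (F.theta l) = cl (gen l)"
      proof -
        have g': "g (cl p) = palg.lift eta p" if "p \<in> carrier (free_algebra (F_letters d0))" for p
          using g(1) that by (simp add: letters_of_F_letter_def)
        have "l \<noteq> UH 0" using 2 by (auto simp: letters_of_U_letter_def U_letters_def)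
        then show ?thesis
          by (cases l) (auto simp: FE_def FF_def FH_def FS_def FSi_def FK_def FKi_def Fc_def g'
            el_E_in el_F_in el_H_in el_K_in el_Ki_in el_Cpow_in F_letters_in gen_in U.eta_E U.eta_F U.eta_H U.eta_K U.eta_Ki
            U.eta_Cpow palg.lift_gen u_defs UCpow_def)
      qed
      ultimately show ?case by simp
    qed (simp_all add: f g)
    have fg: "f (g x) = x" for x
    proof (induction x rule: palg_induct)
      case (2 l)
      have l: "l \<in> F_letters d0" using 2 by (simp add: letters_of_F_letter_def)
      have "g (cl (gen l)) = eta l" using g(1)[OF gen_in[OF 2]] by (simp add: palg.lift_gen)
      moreover have "f (eta l) = cl (gen l)"
      proof -
        have f': "f (cl p) = palg.lift F.theta p" if "p \<in> carrier (free_algebra U_letters)" for p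
          using f(1) that by (simp add: letters_of_U_letter_def)
        have Phi: "cl (el_Phi d0 n) = cl (gen (F_Phi n))" if "2 \<le> n" "n \<le> d0 - 2" for n
          using that by (simp add: el_Phi_def el_Phi_high_def)
        show ?thesis using l
          by (cases l) (auto simp: u_defs f' gen_in U_letters_in UCpow_in UPhi_in F.theta_Cpow F.theta_Phi palg.lift_gen
            FE_def FF_def FH_def FS_def FSi_def F.Fc_1 F.Fc_m1 FPhi_def el_E_def el_F_def el_H_def F_letters_def Phi)
      qed
      ultimately show ?case by simp
    qed (simp_all add: f g)
    show ?thesis
    proof (rule algebras_isomorphicI[of f])
      show "bij f" by (rule o_bij[of g]) (auto simp: fg gf)
    qed (use True nontrivial_iff assms f in auto)
  qed
  then show ?thesis
    by (simp add: U_algebra_def F_quotient_def letters_of_U_letter_def relations_U_letter_def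
      letters_of_F_letter_def relations_F_letter_def)
qed

theorem theorem8p14:
  fixes d :: int
  assumes "0 \<le> d"
  shows "algebras_isomorphic (U_algebra d) (F_quotient d)"
proof (rule ccontr)
  assume "\<not> algebras_isomorphic (U_algebra d) (F_quotient d)"
  with assms have "0 \<le> d0 \<and> \<not> algebras_isomorphic (U_algebra d0) (F_quotient d0)"
    unfolding d0_def by (rule_tac someI) blast
  then show False using isomorphic_d0 by blast
qed

end
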